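(* Let $\{s_j\}_{j=1}^\infty$ be an infinite conformal IFS and let $J$ be its limit set. Let $a>\theta$ be the number such that $\varrho(T_a)=1$ (assumed to exist). If the $a$-dimensional Hausdorff measure satisfies $H^a(J)=H^a(\overline J)>0$, then the system $\{s_j\}_{j=1}^\infty$ satisfies the finite strong open set condition.
   Context: Setting. $X\subset\mathbb{R}^d$ is a locally connected compact set and $U_0\supset X$ is an open set with $\mathrm{diam}(U_0)\le 1$. A self-map $w$ of $X$ is conformal if it is (defined and) continuously differentiable on $U_0$ and for each $x\in U_0$ the derivative $w'(x)$ is a similarity matrix (a scalar multiple of an orthogonal matrix); $|w'(x)|$ denotes its norm. A family $\{p_j\}_{j=1}^\infty$ of positive functions on $U_0$ is uniformly Dini continuous on $U_0$ if $\int_0^1\frac{\alpha(t)}{t}\,dt<+\infty$, where $\alpha(t)=\sup_{j\ge1}\sup_{x,y\in U_0,\,|x-y|\le t}|\log p_j(x)-\log p_j(y)|$, and $\sum_{j=1}^\infty p_j(x)<\infty$ for $x\in U_0$. An infinite conformal IFS is a sequence $\{s_j\}_{j=1}^\infty$ of conformal self-maps of $X$ such that: (i) each $s_j:X\to X$ is one-to-one and there is $0<s<1$ with $|s_j(x)-s_j(y)|\le s|x-y|$ for all $j\ge 1$ and $x,y\in X$; (ii) for each $j$, $0<\inf_{x\in U_0}|s_j'(x)|\le\sup_{x\in U_0}|s_j'(x)|<1$; (iii) $\{|s_j'(\cdot)|\}_{j=1}^\infty$ is uniformly Dini continuous on $U_0$. Limit set. Let $I=\{1,2,3,\dots\}$.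 For $\mathbf{w}=w_1w_2\cdots\in I^{\infty}$ let $\mathbf{w}|_n=w_1\cdots w_n$ and $s_{\mathbf{w}|_n}=s_{w_1}\circ\cdots\circ s_{w_n}$. The limit set is $J=\bigcup_{\mathbf{w}\in I^\infty}\bigcap_{n=1}^\infty s_{\mathbf{w}|_n}(X)$; $\overline J$ is its closure. The operators $T_s$. Let $R_i=\sup_{x\in U_0}|s_i'(x)|$, $\psi(t)=\sum_{i\in I}R_i^t$ for $t\ge0$, and $\theta=\inf\{t:\psi(t)<\infty\}$. For $s>\theta$ define $T_s:C(\overline J)\to C(\overline J)$ by $T_sf(x)=\sum_{j=1}^\infty|s_j'(x)|^sf(s_j(x))$, and let $\varrho(T_s)$ be its spectral radius. Finite strong open set condition. $\{s_j\}_{j=1}^\infty$ satisfies the finite open set condition if for any integer $n\ge1$ there is a nonempty open set $U_n\subseteq U_0$ such that $s_j(U_n)\subset U_n$ for each $1\le j\le n$ and $s_i(U_n)\cap s_j(U_n)=\emptyset$ for all $1\le i,j\le n$ with $i\ne j$. It satisfies the finite strong open set condition if furthermore $U_n$ can be chosen with $U_n\cap J\ne\emptyset$ for every $n$. *)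

theory Defs
  imports "HOL-Analysis.Analysis"
begin

(* The index set I = {1,2,3,...} is shifted to nat: the map usually written s_(j+1) is
   "s j", and the range 1 <= j <= n becomes j < n. *)

section \<open>Conformal iterated function systems\<close>

definition similarity_matrix :: "real^'n^'n \<Rightarrow> bool" where
  "similarity_matrix A \<longleftrightarrow> (\<exists>c Q. orthogonal_matrix Q \<and> A = c *\<^sub>R Q)"

(* A map defined on U is a total function whose values outside U play no role. *)
definition conformal_self_map ::
    "(real^'n) set \<Rightarrow> (real^'n) set \<Rightarrow> (real^'n \<Rightarrow> real^'n) \<Rightarrow> bool" where
  "conformal_self_map X U w \<longleftrightarrow>
     w ` X \<subseteq> X \<and>
     (\<forall>x\<in>U. w differentiable (at x)) \<and>
     continuous_on U (\<lambda>x. jacobian w (at x)) \<and>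
     (\<forall>x\<in>U. similarity_matrix (jacobian w (at x)))"

definition deriv_norm :: "(real^'n \<Rightarrow> real^'n) \<Rightarrow> real^'n \<Rightarrow> real" where
  "deriv_norm w x = onorm ((*v) (jacobian w (at x)))"

definition Dini_modulus ::
    "'a::metric_space set \<Rightarrow> (nat \<Rightarrow> 'a \<Rightarrow> real) \<Rightarrow> real \<Rightarrow> ennreal" where
  "Dini_modulus U p t =
     (SUP j. SUP (x, y)\<in>{(x, y). x \<in> U \<and> y \<in> U \<and> dist x y \<le> t}.
        ennreal \<bar>ln (p j x) - ln (p j y)\<bar>)"

definition uniformly_Dini_continuous ::
    "'a::metric_space set \<Rightarrow> (nat \<Rightarrow> 'a \<Rightarrow> real) \<Rightarrow> bool" where
  "uniformly_Dini_continuous U p \<longleftrightarrow>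
     (\<forall>j. \<forall>x\<in>U. 0 < p j x) \<and>
     (\<integral>\<^sup>+t\<in>{0<..1}. Dini_modulus U p t / ennreal t \<partial>lborel) < \<infinity> \<and>
     (\<forall>x\<in>U. summable (\<lambda>j. p j x))"

(* The bdd_above conjunct is needed because SUP of an unbounded set of reals is unspecified. *)
definition infinite_conformal_IFS ::
    "(real^'n) set \<Rightarrow> (real^'n) set \<Rightarrow> (nat \<Rightarrow> real^'n \<Rightarrow> real^'n) \<Rightarrow> bool" where
  "infinite_conformal_IFS X U s \<longleftrightarrow>
     (\<forall>j. conformal_self_map X U (s j)) \<and>
     (\<forall>j. inj_on (s j) X) \<and>
     (\<exists>r. 0 < r \<and> r < 1 \<and> (\<forall>j. \<forall>x\<in>X. \<forall>y\<in>X. dist (s j x) (s j y) \<le> r * dist x y)) \<and>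
     (\<forall>j. bdd_above (deriv_norm (s j) ` U) \<and>
          0 < (INF x\<in>U. deriv_norm (s j) x) \<and> (SUP x\<in>U. deriv_norm (s j) x) < 1) \<and>
     uniformly_Dini_continuous U (\<lambda>j. deriv_norm (s j))"

primrec word_map :: "(nat \<Rightarrow> 'a \<Rightarrow> 'a) \<Rightarrow> (nat \<Rightarrow> nat) \<Rightarrow> nat \<Rightarrow> 'a \<Rightarrow> 'a" where
  "word_map s w 0 = id"
| "word_map s w (Suc n) = word_map s w n \<circ> s (w n)"

definition limit_set :: "'a set \<Rightarrow> (nat \<Rightarrow> 'a \<Rightarrow> 'a) \<Rightarrow> 'a set" where
  "limit_set X s = (\<Union>w::nat \<Rightarrow> nat. \<Inter>n\<in>{1..}. word_map s w n ` X)"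

section \<open>Spectral radius of an operator on the continuous functions on a compact set\<close>

(* C(K) with complex scalars; functions on K are represented by their extensional
   representatives. For a real operator on C(K) this is its complexification, on which the
   spectrum is defined. *)
definition cont_funs :: "'a::topological_space set \<Rightarrow> ('a \<Rightarrow> complex) set" where
  "cont_funs K = {f \<in> extensional K. continuous_on K f}"

definition sup_norm_on :: "'a set \<Rightarrow> ('a \<Rightarrow> complex) \<Rightarrow> real" where
  "sup_norm_on K f = (SUP x\<in>K. cmod (f x))"

(* z is in the spectrum iff z - T has no bounded inverse on C(K). *)
definition spectrum_on ::
    "'a::topological_space set \<Rightarrow> (('a \<Rightarrow> complex) \<Rightarrow> 'a \<Rightarrow> complex) \<Rightarrow> complex set" where
  "spectrum_on K T =
     {z. let S = (\<lambda>f. restrict (\<lambda>x. z * f x - T f x) K) in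
         \<not> (bij_betw S (cont_funs K) (cont_funs K) \<and>
            (\<exists>B. \<forall>f\<in>cont_funs K. sup_norm_on K f \<le> B * sup_norm_on K (S f)))}"

definition spectral_radius_on ::
    "'a::topological_space set \<Rightarrow> (('a \<Rightarrow> complex) \<Rightarrow> 'a \<Rightarrow> complex) \<Rightarrow> real" where
  "spectral_radius_on K T = (SUP z\<in>spectrum_on K T. cmod z)"

section \<open>The transfer operators and the critical exponent\<close>

definition sup_deriv :: "(real^'n) set \<Rightarrow> (real^'n \<Rightarrow> real^'n) \<Rightarrow> real" where
  "sup_deriv U w = (SUP x\<in>U. deriv_norm w x)"

(* Extended real, so that the infimum is infinite when no series converges. *)
definition theta :: "(real^'n) set \<Rightarrow> (nat \<Rightarrow> real^'n \<Rightarrow> real^'n) \<Rightarrow> ereal" where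
  "theta U s = Inf {ereal t | t. 0 \<le> t \<and> summable (\<lambda>i. sup_deriv U (s i) powr t)}"

definition transfer_op ::
    "(real^'n) set \<Rightarrow> (nat \<Rightarrow> real^'n \<Rightarrow> real^'n) \<Rightarrow> real \<Rightarrow>
     (real^'n \<Rightarrow> complex) \<Rightarrow> real^'n \<Rightarrow> complex" where
  "transfer_op K s t f =
     restrict (\<lambda>x. \<Sum>j. of_real (deriv_norm (s j) x powr t) * f (s j x)) K"

section \<open>Hausdorff measure\<close>

(* Outer measures, without a normalizing constant. Intended for a > 0: since 0 powr a = 0,
   the convention 0^0 = 1 that H^0 requires does not hold here. *)
definition hausdorff_premeasure :: "real \<Rightarrow> real \<Rightarrow> 'a::metric_space set \<Rightarrow> ennreal" where
  "hausdorff_premeasure a \<delta> A =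
     (INF E\<in>{E :: nat \<Rightarrow> 'a set. A \<subseteq> (\<Union>i. E i) \<and> (\<forall>i. bounded (E i) \<and> diameter (E i) \<le> \<delta>)}.
        \<Sum>i. ennreal (diameter (E i) powr a))"

definition hausdorff_measure :: "real \<Rightarrow> 'a::metric_space set \<Rightarrow> ennreal" where
  "hausdorff_measure a A = (SUP \<delta>\<in>{0<..}. hausdorff_premeasure a \<delta> A)"

section \<open>Separation conditions\<close>

definition osc_set :: "'a::topological_space set \<Rightarrow> (nat \<Rightarrow> 'a \<Rightarrow> 'a) \<Rightarrow> nat \<Rightarrow> 'a set \<Rightarrow> bool" where
  "osc_set U s n V \<longleftrightarrow>
     open V \<and> V \<noteq> {} \<and> V \<subseteq> U \<and>
     (\<forall>j<n. s j ` V \<subseteq> V) \<and>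
     (\<forall>i<n. \<forall>j<n. i \<noteq> j \<longrightarrow> s i ` V \<inter> s j ` V = {})"

definition finite_strong_open_set_condition ::
    "'a::topological_space set \<Rightarrow> 'a set \<Rightarrow> (nat \<Rightarrow> 'a \<Rightarrow> 'a) \<Rightarrow> bool" where
  "finite_strong_open_set_condition X U s \<longleftrightarrow>
     (\<forall>n\<ge>1. \<exists>V. osc_set U s n V \<and> V \<inter> limit_set X s \<noteq> {})"

end

theory Submission
  imports Defs "HOL-Library.Sublist"
begin

text \<open>
  Write \<open>K\<close> for the closure of \<open>J\<close>, \<open>S w\<close> for the composition of the maps along a finite word \<open>w\<close>,
  \<open>D w x\<close> for the product of the norms of the derivatives along \<open>w\<close>, starting at \<open>x\<close>, and \<open>\<mu>\<close> for the
  \<open>a\<close>-dimensional Hausdorff measure on \<open>K\<close>. The proof turns positivity of \<open>\<mu>\<close> into a bound on the number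
  of images of comparable size that can crowd together, and then builds the open set around a point
  where this number is largest.

  Distortion. All maps contract, also on a neighbourhood of \<open>X\<close>, so the Dini condition is summed along a
  geometric sequence of scales. Hence \<open>D w\<close> varies on \<open>X\<close> by a factor independent of \<open>w\<close>, and \<open>S w\<close> is
  Lipschitz on small balls with constant comparable to \<open>D w\<close> (\<open>D_distortion\<close>, \<open>foldr_Lipschitz\<close>).

  Spectral radius. The values of the \<open>n\<close>-th iterate of the transfer operator at the constant 1 are the
  sums of \<open>D w x powr a\<close> over words of length \<open>n\<close>. By distortion each iterate is nearly constant, and the
  exponential growth rate of the iterates is the spectral radius: larger numbers are excluded by the
  Neumann series, and the growth rate itself is a spectral value because the resolvent of the constant
  function blows up there. At spectral radius 1 the iterates stay between two positive constants
  (\<open>weight_sum_bounds\<close>). Covering \<open>J\<close> by images of small balls then shows that \<open>\<mu>\<close> is finite.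

  Disjointness. The lower limit \<open>h\<close> of the iterates is bounded, bounded away from 0, and by Fatou's lemma
  is not increased by the transfer operator. A Lipschitz estimate gives
  \<open>\<mu> (s j E) \<le> (\<integral>x\<in>E. D [j] x powr a)\<close>, and \<open>\<mu> K = \<mu> J\<close> implies that the sets \<open>s j K\<close> cover almost all of
  \<open>K\<close>. Integrating \<open>h\<close> gives
  \<open>\<integral>h \<le> (\<Sum>j. \<integral>x\<in>s j K. h x) \<le> (\<Sum>j. \<integral>x. h (s j x) * D [j] x powr a) \<le> \<integral>h < \<infinity>\<close>,
  so all of these are equalities. Thus the sets \<open>s j K\<close> overlap in null sets, and the Lipschitz estimate
  is an exact change of variables, which iterates along words (\<open>overlap_null\<close>, \<open>transformation_word\<close>).
  The exactness supplies the lower bounds for the measures of images.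

  Upper regularity. If a small closed set \<open>E\<close> had a large measure compared with the \<open>a\<close>-th power of its
  diameter, its almost disjoint images under all words of a given large length would cover a fixed
  proportion of \<open>K\<close> too cheaply. So \<open>\<mu> (cball y r)\<close> is at most a constant times \<open>r powr a\<close>
  (\<open>upper_regular\<close>).

  The open set. Fix the alphabet \<open>{..<N}\<close>. The neighbours of a word \<open>u\<close> are, roughly, the words \<open>v\<close> of
  comparable size such that \<open>S v K\<close> is close to \<open>S u K\<close>, with the relation closed under adding common
  prefixes. Upper regularity and almost disjointness bound their number, so some \<open>u\<close> has the maximal
  number. Adding a prefix \<open>w\<close> then creates no new neighbours: those of \<open>w @ u\<close> are the words \<open>w @ v\<close> with \<open>v\<close>
  a neighbour of \<open>u\<close>. Therefore \<open>S (i # w @ u)\<close> and \<open>S (j # v @ u)\<close> have images separated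
  proportionally to their size when \<open>i \<noteq> j\<close>, and for a small ball \<open>B\<close> around a point of
  \<open>S u J\<close> the union of the sets \<open>S w B\<close>, over all words \<open>w\<close> in the alphabet, is the required open set
  (\<open>disjoint_ball_images\<close>). It is open because conformal maps with nonzero derivative are open maps.
\<close>

section \<open>Hausdorff measure as a Borel measure\<close>

lemma hausdorff_premeasure_le_sum:
  assumes "A \<subseteq> (\<Union>i. E i)" "\<And>i. bounded (E i)" "\<And>i. diameter (E i) \<le> \<delta>"
  shows "hausdorff_premeasure a \<delta> A \<le> (\<Sum>i. ennreal (diameter (E i) powr a))"
  unfolding hausdorff_premeasure_def by (rule INF_lower) (use assms in auto)

lemma hausdorff_premeasure_mono:
  "A \<subseteq> B \<Longrightarrow> hausdorff_premeasure a \<delta> A \<le> hausdorff_premeasure a \<delta> B"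
  unfolding hausdorff_premeasure_def by (rule INF_superset_mono) auto

lemma hausdorff_premeasure_antimono:
  "\<delta>' \<le> \<delta> \<Longrightarrow> hausdorff_premeasure a \<delta> A \<le> hausdorff_premeasure a \<delta>' A"
  unfolding hausdorff_premeasure_def by (rule INF_superset_mono) (auto intro: order_trans)

lemma hausdorff_premeasure_empty:
  assumes "0 \<le> \<delta>" shows "hausdorff_premeasure a \<delta> {} = 0"
  using hausdorff_premeasure_le_sum[of "{}" "\<lambda>_. {}" \<delta> a] assms by simp

lemma hausdorff_premeasure_subadditive:
  fixes A :: "nat \<Rightarrow> 'a::metric_space set"
  shows "hausdorff_premeasure a \<delta> (\<Union>i. A i) \<le> (\<Sum>i. hausdorff_premeasure a \<delta> (A i))"
proof (cases "\<exists>i. hausdorff_premeasure a \<delta> (A i) = \<infinity>")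
  case True
  then obtain i where "hausdorff_premeasure a \<delta> (A i) = \<infinity>" by blast
  moreover have "hausdorff_premeasure a \<delta> (A i) \<le> (\<Sum>i. hausdorff_premeasure a \<delta> (A i))"
    using sum_le_suminf[of "\<lambda>i. hausdorff_premeasure a \<delta> (A i)" "{i}"] by simp
  ultimately show ?thesis by (simp add: top_unique)
next
  case False
  show ?thesis
  proof (rule ennreal_le_epsilon)
    fix e :: real assume e: "0 < e"
    define P where "P i E \<longleftrightarrow> A i \<subseteq> (\<Union>k. E k) \<and> (\<forall>k. bounded (E k) \<and> diameter (E k) \<le> \<delta>) \<and>
        (\<Sum>k. ennreal (diameter (E k) powr a)) \<le> hausdorff_premeasure a \<delta> (A i) + ennreal (e * (1/2)^Suc i)"
      for i and E :: "nat \<Rightarrow> 'a set"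
    have "\<exists>E. P i E" for i
    proof -
      let ?b = "hausdorff_premeasure a \<delta> (A i) + ennreal (e * (1/2)^Suc i)"
      have "0 < ennreal (e * (1/2)^Suc i)" using e by simp
      then have "hausdorff_premeasure a \<delta> (A i) < ?b"
        using False by (simp add: less_top add_pos_pos)
      then obtain E where
        "E \<in> {E :: nat \<Rightarrow> 'a set. A i \<subseteq> (\<Union>k. E k) \<and> (\<forall>k. bounded (E k) \<and> diameter (E k) \<le> \<delta>)}"
        "(\<Sum>k. ennreal (diameter (E k) powr a)) < ?b"
        by (subst (asm) (1) hausdorff_premeasure_def) (auto simp only: INF_less_iff)
      then have "P i E" unfolding P_def by auto
      then show ?thesis by blast
    qed
    then have "\<forall>i. \<exists>E. P i E" by blast
    then obtain E where "\<And>i. P i (E i)" by (auto dest: choice)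
    then have E: "A i \<subseteq> (\<Union>k. E i k)" "bounded (E i k)" "diameter (E i k) \<le> \<delta>"
        "(\<Sum>k. ennreal (diameter (E i k) powr a))
           \<le> hausdorff_premeasure a \<delta> (A i) + ennreal (e * (1/2)^Suc i)" for i k
      unfolding P_def by auto
    let ?F = "\<lambda>n. case prod_decode n of (i, k) \<Rightarrow> E i k"
    have "hausdorff_premeasure a \<delta> (\<Union>i. A i) \<le> (\<Sum>n. ennreal (diameter (?F n) powr a))"
    proof (rule hausdorff_premeasure_le_sum)
      show "(\<Union>i. A i) \<subseteq> (\<Union>n. ?F n)"
      proof
        fix x assume "x \<in> (\<Union>i. A i)"
        then obtain i k where "x \<in> E i k" using E(1) by blast
        then have "x \<in> ?F (prod_encode (i, k))" by simp
        then show "x \<in> (\<Union>n. ?F n)" by (rule UN_I[OF UNIV_I])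
      qed
    qed (simp_all add: E(2,3) split: prod.split)
    also have "\<dots> = (\<Sum>n. (\<lambda>(i, k). ennreal (diameter (E i k) powr a)) (prod_decode n))"
      by (intro suminf_cong) (auto split: prod.split)
    also have "\<dots> = (\<Sum>i. \<Sum>k. ennreal (diameter (E i k) powr a))"
      by (rule suminf_ennreal_2dimen) simp
    also have "\<dots> \<le> (\<Sum>i. hausdorff_premeasure a \<delta> (A i) + ennreal (e * (1/2)^Suc i))"
      by (intro suminf_le E) auto
    also have "\<dots> = (\<Sum>i. hausdorff_premeasure a \<delta> (A i)) + (\<Sum>i. ennreal (e * (1/2)^Suc i))"
      by (rule suminf_add[symmetric]) auto
    also have "(\<Sum>i. ennreal (e * (1/2)^Suc i)) = ennreal e"
      using sums_mult[OF power_half_series, of e] e by (intro suminf_ennreal_eq) auto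
    finally show "hausdorff_premeasure a \<delta> (\<Union>i. A i)
        \<le> (\<Sum>i. hausdorff_premeasure a \<delta> (A i)) + ennreal e" .
  qed
qed

lemma hausdorff_premeasure_le_measure:
  "0 < \<delta> \<Longrightarrow> hausdorff_premeasure a \<delta> A \<le> hausdorff_measure a A"
  unfolding hausdorff_measure_def by (rule SUP_upper) auto

lemma hausdorff_measure_leI:
  assumes "\<And>\<delta>. 0 < \<delta> \<Longrightarrow> hausdorff_premeasure a \<delta> A \<le> c"
  shows "hausdorff_measure a A \<le> c"
  unfolding hausdorff_measure_def using assms by (auto intro: SUP_least)

lemma hausdorff_measure_mono:
  "A \<subseteq> B \<Longrightarrow> hausdorff_measure a A \<le> hausdorff_measure a B"
  by (meson hausdorff_measure_leI hausdorff_premeasure_le_measure hausdorff_premeasure_mono order_trans)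

lemma hausdorff_measure_empty: "hausdorff_measure a {} = 0"
  using hausdorff_measure_leI[of a "{}" 0] by (simp add: hausdorff_premeasure_empty)

lemma hausdorff_measure_subadditive:
  "hausdorff_measure a (\<Union>i. A i) \<le> (\<Sum>i. hausdorff_measure a (A i))"
proof (rule hausdorff_measure_leI)
  fix \<delta> :: real assume "0 < \<delta>"
  have "hausdorff_premeasure a \<delta> (\<Union>i. A i) \<le> (\<Sum>i. hausdorff_premeasure a \<delta> (A i))"
    by (rule hausdorff_premeasure_subadditive)
  also have "\<dots> \<le> (\<Sum>i. hausdorff_measure a (A i))"
    by (intro suminf_le hausdorff_premeasure_le_measure \<open>0 < \<delta>\<close>) auto
  finally show "hausdorff_premeasure a \<delta> (\<Union>i. A i) \<le> (\<Sum>i. hausdorff_measure a (A i))" .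
qed

lemma binary_union: "(\<Union>i::nat. if i = 0 then A else if i = 1 then B else {}) = A \<union> B"
  by (auto split: if_splits)

lemma hausdorff_premeasure_Un:
  assumes "0 \<le> \<delta>"
  shows "hausdorff_premeasure a \<delta> (A \<union> B) \<le> hausdorff_premeasure a \<delta> A + hausdorff_premeasure a \<delta> B"
proof -
  have "(\<Sum>i::nat. hausdorff_premeasure a \<delta> (if i = 0 then A else if i = 1 then B else {}))
      = (\<Sum>i\<in>{0,1::nat}. hausdorff_premeasure a \<delta> (if i = 0 then A else if i = 1 then B else {}))"
    by (rule suminf_finite) (auto simp: hausdorff_premeasure_empty assms)
  then show ?thesis
    using hausdorff_premeasure_subadditive[of a \<delta> "\<lambda>i. if i = 0 then A else if i = 1 then B else {}"]
    unfolding binary_union by simp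
qed

lemma hausdorff_measure_Un:
  "hausdorff_measure a (A \<union> B) \<le> hausdorff_measure a A + hausdorff_measure a B"
proof (rule hausdorff_measure_leI)
  fix \<delta> :: real assume "0 < \<delta>"
  then show "hausdorff_premeasure a \<delta> (A \<union> B) \<le> hausdorff_measure a A + hausdorff_measure a B"
    by (meson add_mono hausdorff_premeasure_Un hausdorff_premeasure_le_measure less_imp_le order_trans)
qed

text \<open>A covering set of diameter below the gap between \<open>A\<close> and \<open>B\<close> meets only one of them, so a
  fine cover of the union splits into a cover of each part.\<close>

lemma hausdorff_measure_separated:
  fixes A B :: "'a::metric_space set"
  assumes "0 < d" and gap: "\<And>x y. x \<in> A \<Longrightarrow> y \<in> B \<Longrightarrow> d \<le> dist x y"
  shows "hausdorff_measure a A + hausdorff_measure a B \<le> hausdorff_measure a (A \<union> B)"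
proof -
  let ?H = "hausdorff_premeasure a"
  have fine: "?H \<delta> A + ?H \<delta> B \<le> ?H \<delta> (A \<union> B)" if \<delta>: "0 < \<delta>" "\<delta> < d" for \<delta>
    unfolding hausdorff_premeasure_def[of a \<delta> "A \<union> B"]
  proof (rule INF_greatest)
    fix E :: "nat \<Rightarrow> 'a set"
    assume "E \<in> {E. A \<union> B \<subseteq> (\<Union>i. E i) \<and> (\<forall>i. bounded (E i) \<and> diameter (E i) \<le> \<delta>)}"
    then have E: "A \<union> B \<subseteq> (\<Union>i. E i)" "\<And>i. bounded (E i)" "\<And>i. diameter (E i) \<le> \<delta>" by auto
    let ?P = "\<lambda>C i. if E i \<inter> C \<noteq> {} then E i else {}"
    have part: "?H \<delta> C \<le> (\<Sum>i. ennreal (diameter (?P C i) powr a))" if "C \<subseteq> A \<union> B" for C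
    proof (rule hausdorff_premeasure_le_sum)
      show "C \<subseteq> (\<Union>i. ?P C i)"
      proof
        fix x assume "x \<in> C"
        with that E(1) obtain i where "x \<in> E i" by blast
        with \<open>x \<in> C\<close> have "x \<in> ?P C i" by auto
        then show "x \<in> (\<Union>i. ?P C i)" by blast
      qed
    qed (use E \<delta> in auto)
    have one: "E i \<inter> A = {} \<or> E i \<inter> B = {}" for i
    proof (rule ccontr)
      assume "\<not> ?thesis"
      then obtain x y where "x \<in> E i" "x \<in> A" "y \<in> E i" "y \<in> B" by blast
      then have "d \<le> \<delta>"
        using gap[of x y] diameter_bounded_bound[OF E(2), of x i y] E(3)[of i] by linarith
      with \<delta> show False by simp
    qed
    have "?H \<delta> A + ?H \<delta> B
        \<le> (\<Sum>i. ennreal (diameter (?P A i) powr a)) + (\<Sum>i. ennreal (diameter (?P B i) powr a))"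
      by (intro add_mono part) auto
    also have "\<dots> = (\<Sum>i. ennreal (diameter (?P A i) powr a) + ennreal (diameter (?P B i) powr a))"
      by (rule suminf_add) auto
    also have "\<dots> \<le> (\<Sum>i. ennreal (diameter (E i) powr a))"
    proof (intro suminf_le)
      fix i show "ennreal (diameter (?P A i) powr a) + ennreal (diameter (?P B i) powr a)
          \<le> ennreal (diameter (E i) powr a)"
        using one[of i] by auto
    qed auto
    finally show "?H \<delta> A + ?H \<delta> B \<le> (\<Sum>i. ennreal (diameter (E i) powr a))" .
  qed
  have "hausdorff_measure a A + hausdorff_measure a B = (SUP \<delta>\<in>{0<..}. ?H \<delta> A + ?H \<delta> B)"
    unfolding hausdorff_measure_def
  proof (rule SUP_add_directed_ennreal[symmetric])
    fix i j :: real assume "i \<in> {0<..}" "j \<in> {0<..}"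
    then show "\<exists>k\<in>{0<..}. ?H i A + ?H j B \<le> ?H k A + ?H k B"
      by (intro bexI[of _ "min i j"] add_mono hausdorff_premeasure_antimono) auto
  qed
  also have "\<dots> \<le> hausdorff_measure a (A \<union> B)"
  proof (rule SUP_least)
    fix \<delta> :: real assume "\<delta> \<in> {0<..}"
    then have "?H \<delta> A + ?H \<delta> B \<le> ?H (min \<delta> (d/2)) A + ?H (min \<delta> (d/2)) B"
      by (intro add_mono hausdorff_premeasure_antimono) auto
    also have "\<dots> \<le> ?H (min \<delta> (d/2)) (A \<union> B)"
      using \<open>0 < d\<close> \<open>\<delta> \<in> {0<..}\<close> by (intro fine) auto
    also have "\<dots> \<le> hausdorff_measure a (A \<union> B)"
      using \<open>0 < d\<close> \<open>\<delta> \<in> {0<..}\<close> by (intro hausdorff_premeasure_le_measure) auto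
    finally show "?H \<delta> A + ?H \<delta> B \<le> hausdorff_measure a (A \<union> B)" .
  qed
  finally show ?thesis .
qed

text \<open>Caratheodory's criterion: slice the complement of a closed set \<open>F\<close> into rings
  \<open>R k\<close> by the distance to \<open>F\<close>. Rings of equal parity are separated, so their measures have a
  finite sum, and the tail of that sum controls the part of \<open>T - F\<close> close to \<open>F\<close>.\<close>

lemma hausdorff_measure_closed_split:
  fixes F T :: "'a::metric_space set"
  assumes "closed F"
  shows "hausdorff_measure a (T \<inter> F) + hausdorff_measure a (T - F) \<le> hausdorff_measure a T"
proof (cases "F = {} \<or> hausdorff_measure a T = \<infinity>")
  case True
  then show ?thesis by (auto simp: hausdorff_measure_empty)
next
  case False
  let ?H = "hausdorff_measure a"
  define D where "D n = {x \<in> T. 1 / real (Suc n) \<le> infdist x F}" for n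
  define R where "R n = D (Suc n) - D n" for n
  have D_sub: "D n \<subseteq> T - F" for n
    by (auto simp: D_def divide_le_0_iff)
  have R_sub: "R n \<subseteq> T" for n by (auto simp: R_def D_def)
  have R_low: "1 / real (Suc (Suc n)) \<le> infdist x F" if "x \<in> R n" for n x
    using that by (auto simp: R_def D_def)
  have R_up: "infdist x F < 1 / real (Suc n)" if "x \<in> R n" for n x
    using that by (auto simp: R_def D_def)
  have parity: "(\<Sum>k<m. ?H (R (2 * k + p))) \<le> ?H (\<Union>k<m. R (2 * k + p))" for m p
  proof (induction m)
    case 0 then show ?case by simp
  next
    case (Suc m)
    have "(\<Sum>k<Suc m. ?H (R (2 * k + p))) \<le> ?H (\<Union>k<m. R (2 * k + p)) + ?H (R (2 * m + p))"
      using Suc by (auto intro: add_mono)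
    also have "\<dots> \<le> ?H ((\<Union>k<m. R (2 * k + p)) \<union> R (2 * m + p))"
    proof (cases "m = 0")
      case True then show ?thesis by (simp add: hausdorff_measure_empty)
    next
      case False
      show ?thesis
      proof (rule hausdorff_measure_separated)
        let ?d = "1 / real (2 * m + p) - 1 / real (2 * m + p + 1)"
        show "0 < ?d" using False by (simp add: divide_strict_left_mono)
        fix x y assume "x \<in> (\<Union>k<m. R (2 * k + p))" "y \<in> R (2 * m + p)"
        then obtain k where k: "k < m" "x \<in> R (2 * k + p)" by blast
        have "1 / real (2 * m + p) \<le> 1 / real (Suc (Suc (2 * k + p)))"
          using k by (intro divide_left_mono) auto
        then have "1 / real (2 * m + p) \<le> infdist x F" using R_low[OF k(2)] by linarith
        moreover have "infdist y F < 1 / real (2 * m + p + 1)"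
          using R_up[OF \<open>y \<in> R (2 * m + p)\<close>] by simp
        moreover have "infdist x F \<le> infdist y F + dist x y" by (rule infdist_triangle)
        ultimately show "?d \<le> dist x y" by linarith
      qed
    qed
    also have "(\<Union>k<m. R (2 * k + p)) \<union> R (2 * m + p) = (\<Union>k<Suc m. R (2 * k + p))"
      by (auto simp: less_Suc_eq)
    finally show ?case .
  qed
  have "(\<Sum>k<m. ?H (R k)) \<le> ?H T + ?H T" for m
  proof -
    have "(\<Sum>k<m. ?H (R k)) \<le> (\<Sum>k<2*m. ?H (R k))"
      by (rule sum_mono2) auto
    also have "\<dots> = (\<Sum>k<m. ?H (R (2 * k + 0))) + (\<Sum>k<m. ?H (R (2 * k + 1)))"
      by (induction m) (auto simp: algebra_simps)
    also have "\<dots> \<le> ?H (\<Union>k<m. R (2 * k + 0)) + ?H (\<Union>k<m. R (2 * k + 1))"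
      by (intro add_mono parity)
    also have "\<dots> \<le> ?H T + ?H T"
      by (intro add_mono hausdorff_measure_mono) (use R_sub in blast)+
    finally show ?thesis .
  qed
  then have "(\<Sum>k. ?H (R k)) \<le> ?H T + ?H T"
    by (auto intro: suminf_le_const)
  then have fin: "(\<Sum>k. ?H (R k)) < \<infinity>"
    using False by (auto simp: less_top[symmetric] top_unique)
  have step: "?H (T \<inter> F) + ?H (T - F) \<le> ?H T + (\<Sum>k. ?H (R (k + n)))" for n
  proof -
    have "T - F \<subseteq> D n \<union> (\<Union>k. R (k + n))"
    proof
      fix x assume x: "x \<in> T - F"
      then have "0 < infdist x F"
        using False assms infdist_pos_not_in_closed by blast
      then obtain m where "inverse (real (Suc m)) < infdist x F" using reals_Archimedean by blast
      then have "x \<in> D m" using x by (auto simp: D_def inverse_eq_divide)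
      define l where "l = (LEAST l. x \<in> D l)"
      have l: "x \<in> D l" unfolding l_def by (rule LeastI) fact
      show "x \<in> D n \<union> (\<Union>k. R (k + n))"
      proof (cases "l \<le> n")
        case True
        have "1 / real (Suc n) \<le> 1 / real (Suc l)" using True by (intro divide_left_mono) auto
        with l have "x \<in> D n" by (auto simp: D_def)
        then show ?thesis by simp
      next
        case False
        then have q: "l = Suc ((l - Suc n) + n)" by simp
        define q where "q = l - Suc n"
        note q = q[folded q_def]
        have "x \<notin> D (q + n)" using not_less_Least[of "q + n" "\<lambda>l. x \<in> D l"] q l_def by auto
        then have "x \<in> R (q + n)" using l q by (auto simp: R_def)
        then show ?thesis by blast
      qed
    qed
    then have "?H (T - F) \<le> ?H (D n) + ?H (\<Union>k. R (k + n))"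
      by (meson hausdorff_measure_Un hausdorff_measure_mono order_trans)
    also have "\<dots> \<le> ?H (D n) + (\<Sum>k. ?H (R (k + n)))"
      by (intro add_mono hausdorff_measure_subadditive) simp
    finally have "?H (T \<inter> F) + ?H (T - F) \<le> (?H (T \<inter> F) + ?H (D n)) + (\<Sum>k. ?H (R (k + n)))"
      by (simp add: add.assoc add_left_mono)
    also have "?H (T \<inter> F) + ?H (D n) \<le> ?H ((T \<inter> F) \<union> D n)"
    proof (rule hausdorff_measure_separated[of "1 / real (Suc n)"])
      fix x y assume "x \<in> T \<inter> F" "y \<in> D n"
      then have "1 / real (Suc n) \<le> infdist y F" "infdist y F \<le> dist y x"
        by (auto simp: D_def intro: infdist_le)
      then show "1 / real (Suc n) \<le> dist x y" by (simp add: dist_commute)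
    qed simp
    also have "\<dots> \<le> ?H T" using D_sub by (intro hausdorff_measure_mono) auto
    finally show ?thesis by (simp add: add_right_mono)
  qed
  have "(\<lambda>n. ?H T + (\<Sum>k. ?H (R (k + n)))) \<longlonglongrightarrow> ?H T + 0"
  proof (intro tendsto_intros)
    show "(\<lambda>n. \<Sum>k. ?H (R (k + n))) \<longlonglongrightarrow> 0"
    proof -
      have eq: "ennreal (enn2real (?H (R k))) = ?H (R k)" for k
        using fin ennreal_suminf_lessD[OF fin, of k] by simp
      have sm: "summable (\<lambda>k. enn2real (?H (R k)))"
        by (rule summable_suminf_not_top) (use fin in \<open>auto simp: eq\<close>)
      have "(\<Sum>k. ?H (R (k + n))) = ennreal (\<Sum>k. enn2real (?H (R (k + n))))" for n
        using suminf_ennreal2[of "\<lambda>k. enn2real (?H (R (k + n)))"] summable_ignore_initial_segment[OF sm]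
        by (simp add: eq)
      moreover have "(\<lambda>n. ennreal (\<Sum>k. enn2real (?H (R (k + n))))) \<longlonglongrightarrow> ennreal 0"
        by (intro tendsto_ennrealI suminf_exist_split2 sm)
      ultimately show ?thesis by simp
    qed
  qed
  then show ?thesis
    using step by (intro LIMSEQ_le_const[where X="\<lambda>n. ?H T + (\<Sum>k. ?H (R (k + n)))"]) auto
qed

definition hausdorff_borel :: "real \<Rightarrow> 'a::metric_space measure" where
  "hausdorff_borel a = measure_of UNIV (sets borel) (hausdorff_measure a)"

lemma
  fixes A :: "'a::metric_space set"
  shows sets_hausdorff_borel: "sets (hausdorff_borel a :: 'a measure) = sets borel"
    and space_hausdorff_borel: "space (hausdorff_borel a) = (UNIV :: 'a set)"
    and emeasure_hausdorff_borel:
      "A \<in> sets borel \<Longrightarrow> emeasure (hausdorff_borel a) A = hausdorff_measure a A"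
proof -
  let ?H = "hausdorff_measure a" and ?L = "lambda_system UNIV (Pow UNIV) (hausdorff_measure a)"
  have "outer_measure_space (Pow (UNIV :: 'a set)) ?H"
    unfolding outer_measure_space_def positive_def increasing_def countably_subadditive_def
    by (auto simp: hausdorff_measure_empty hausdorff_measure_mono hausdorff_measure_subadditive)
  then have L: "measure_space (UNIV :: 'a set) ?L ?H"
    by (intro sigma_algebra.caratheodory_lemma sigma_algebra_Pow)
  have "closed F \<Longrightarrow> F \<in> ?L" for F :: "'a set"
  proof -
    assume F: "closed F"
    have "?H (F \<inter> T) + ?H ((UNIV - F) \<inter> T) = ?H T" for T
    proof (rule antisym)
      show "?H (F \<inter> T) + ?H ((UNIV - F) \<inter> T) \<le> ?H T"
        using hausdorff_measure_closed_split[OF F, of a T] by (simp add: Int_commute Diff_eq)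
      have "?H ((F \<inter> T) \<union> ((UNIV - F) \<inter> T)) \<le> ?H (F \<inter> T) + ?H ((UNIV - F) \<inter> T)"
        by (rule hausdorff_measure_Un)
      moreover have "(F \<inter> T) \<union> ((UNIV - F) \<inter> T) = T" by auto
      ultimately show "?H T \<le> ?H (F \<inter> T) + ?H ((UNIV - F) \<inter> T)" by simp
    qed
    then show ?thesis by (simp add: lambda_system_def)
  qed
  then have "sigma_sets (UNIV :: 'a set) (Collect closed) \<subseteq> ?L"
    using L by (intro sigma_algebra.sigma_sets_subset) (auto simp: measure_space_def)
  then have sub: "sets (borel :: 'a measure) \<subseteq> ?L"
    unfolding borel_eq_closed by simp
  have "measure_space (UNIV :: 'a set) (sets borel) ?H"
    using L sub sets.sigma_algebra_axioms[of "borel :: 'a measure"]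
    unfolding measure_space_def countably_additive_def positive_def
    by (auto intro: subset_trans)
  moreover have eq: "sigma_sets (UNIV :: 'a set) (sets borel) = sets borel"
    using sets.sigma_sets_eq[of "borel :: 'a measure"] by simp
  ultimately have ms: "measure_space (UNIV :: 'a set) (sigma_sets UNIV (sets borel)) ?H"
    by (simp only: eq)
  show "sets (hausdorff_borel a :: 'a measure) = sets borel"
    "space (hausdorff_borel a) = (UNIV :: 'a set)"
    by (simp_all add: hausdorff_borel_def eq)
  assume "A \<in> sets borel"
  then show "emeasure (hausdorff_borel a) A = ?H A"
    unfolding hausdorff_borel_def emeasure_measure_of_conv using ms by (simp add: eq)
qed

lemma le_cmult_INF_ennreal:
  fixes x :: ennreal
  assumes "0 < c" and le: "\<And>i. i \<in> I \<Longrightarrow> x \<le> ennreal c * f i"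
  shows "x \<le> ennreal c * (INF i\<in>I. f i)"
proof -
  have inv: "ennreal (1 / c) * (ennreal c * y) = y" "ennreal c * (ennreal (1 / c) * y) = y" for y
    using \<open>0 < c\<close> by (simp_all add: mult.assoc[symmetric] ennreal_mult[symmetric])
  have "ennreal (1 / c) * x \<le> (INF i\<in>I. f i)"
    using mult_left_mono[OF le, of _ "ennreal (1 / c)"] by (intro INF_greatest) (simp add: inv)
  from mult_left_mono[OF this, of "ennreal c"] show ?thesis by (simp add: inv)
qed

lemma hausdorff_measure_Lipschitz_image:
  fixes f :: "'a::metric_space \<Rightarrow> 'b::real_normed_vector"
  assumes "0 < L" "0 < a" and Lip: "\<And>x y. x \<in> E \<Longrightarrow> y \<in> E \<Longrightarrow> dist (f x) (f y) \<le> L * dist x y"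
  shows "hausdorff_measure a (f ` E) \<le> ennreal (L powr a) * hausdorff_measure a E"
proof (rule hausdorff_measure_leI)
  fix \<delta> :: real assume \<delta>: "0 < \<delta>"
  have "hausdorff_premeasure a \<delta> (f ` E) \<le> ennreal (L powr a) * hausdorff_premeasure a (\<delta> / L) E"
    unfolding hausdorff_premeasure_def[of a "\<delta> / L"]
  proof (rule le_cmult_INF_ennreal)
    fix C assume "C \<in> {C :: nat \<Rightarrow> 'a set. E \<subseteq> (\<Union>i. C i) \<and> (\<forall>i. bounded (C i) \<and> diameter (C i) \<le> \<delta> / L)}"
    then have C: "E \<subseteq> (\<Union>i. C i)" "\<And>i. bounded (C i)" "\<And>i. diameter (C i) \<le> \<delta> / L" by auto
    have d: "dist x y \<le> L * diameter (C i)" if "x \<in> f ` (C i \<inter> E)" "y \<in> f ` (C i \<inter> E)" for x y i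
    proof -
      from that obtain u v where uv: "u \<in> C i" "u \<in> E" "v \<in> C i" "v \<in> E" "x = f u" "y = f v" by auto
      have "dist x y \<le> L * dist u v" using Lip uv by simp
      also have "\<dots> \<le> L * diameter (C i)"
        using diameter_bounded_bound[OF C(2) uv(1) uv(3)] \<open>0 < L\<close> by simp
      finally show ?thesis .
    qed
    have diam: "diameter (f ` (C i \<inter> E)) \<le> L * diameter (C i)" for i
      using diameter_ge_0[OF C(2)[of i]] \<open>0 < L\<close> d[of _ i] by (intro diameter_le) (auto simp: dist_norm)
    have "hausdorff_premeasure a \<delta> (f ` E) \<le> (\<Sum>i. ennreal (diameter (f ` (C i \<inter> E)) powr a))"
    proof (rule hausdorff_premeasure_le_sum)
      show "f ` E \<subseteq> (\<Union>i. f ` (C i \<inter> E))" using C(1) by blast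
      show "bounded (f ` (C i \<inter> E))" for i
        using d unfolding bounded_two_points by blast
      show "diameter (f ` (C i \<inter> E)) \<le> \<delta>" for i
      proof -
        have "L * diameter (C i) \<le> L * (\<delta> / L)" using C(3)[of i] \<open>0 < L\<close> by (intro mult_left_mono) auto
        with diam[of i] \<open>0 < L\<close> show ?thesis by simp
      qed
    qed
    also have "\<dots> \<le> (\<Sum>i. ennreal (L powr a) * ennreal (diameter (C i) powr a))"
    proof (intro suminf_le)
      fix i
      have bd: "bounded (f ` (C i \<inter> E))" using d unfolding bounded_two_points by blast
      have "diameter (f ` (C i \<inter> E)) powr a \<le> (L * diameter (C i)) powr a"
        using \<open>0 < a\<close> diam[of i] diameter_ge_0[OF bd] by (intro powr_mono2) auto
      also have "\<dots> = L powr a * diameter (C i) powr a"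
        using \<open>0 < L\<close> diameter_ge_0[OF C(2)] by (simp add: powr_mult)
      finally show "ennreal (diameter (f ` (C i \<inter> E)) powr a)
          \<le> ennreal (L powr a) * ennreal (diameter (C i) powr a)"
        by (simp add: ennreal_mult[symmetric] ennreal_leI)
    qed auto
    also have "\<dots> = ennreal (L powr a) * (\<Sum>i. ennreal (diameter (C i) powr a))"
      by (rule ennreal_suminf_cmult)
    finally show "hausdorff_premeasure a \<delta> (f ` E)
        \<le> ennreal (L powr a) * (\<Sum>i. ennreal (diameter (C i) powr a))" .
  qed (use \<open>0 < L\<close> in simp)
  also have "\<dots> \<le> ennreal (L powr a) * hausdorff_measure a E"
    using \<delta> \<open>0 < L\<close> by (intro mult_left_mono hausdorff_premeasure_le_measure) auto
  finally show "hausdorff_premeasure a \<delta> (f ` E) \<le> ennreal (L powr a) * hausdorff_measure a E" .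
qed


lemma hausdorff_premeasure_le_diameter:
  assumes "bounded E" "diameter E \<le> \<delta>" "0 \<le> \<delta>"
  shows "hausdorff_premeasure a \<delta> E \<le> ennreal (diameter E powr a)"
proof -
  have "hausdorff_premeasure a \<delta> E \<le> (\<Sum>i::nat. ennreal (diameter (if i = 0 then E else {}) powr a))"
    by (rule hausdorff_premeasure_le_sum) (use assms in auto)
  also have "\<dots> = (\<Sum>i\<in>{0::nat}. ennreal (diameter (if i = 0 then E else {}) powr a))"
    by (rule suminf_finite) auto
  finally show ?thesis by simp
qed

lemma hausdorff_premeasure_countable_UN:
  assumes "countable I" "0 \<le> \<delta>"
  shows "hausdorff_premeasure a \<delta> (\<Union>i\<in>I. E i)
    \<le> (\<integral>\<^sup>+i. hausdorff_premeasure a \<delta> (E i) \<partial>count_space I)"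
proof -
  let ?H = "hausdorff_premeasure a \<delta>"
  define N where "N = to_nat_on I ` I"
  have bij: "bij_betw (to_nat_on I) I N"
    unfolding N_def using inj_on_to_nat_on[OF assms(1)] by (rule inj_on_imp_bij_betw)
  define E' where "E' n = (if n \<in> N then E (from_nat_into I n) else {})" for n
  have E': "E' (to_nat_on I i) = E i" if "i \<in> I" for i
    using that assms(1) by (simp add: E'_def N_def)
  have "(\<Union>i\<in>I. E i) \<subseteq> (\<Union>n. E' n)"
  proof
    fix x assume "x \<in> (\<Union>i\<in>I. E i)"
    then obtain i where "i \<in> I" "x \<in> E i" by blast
    then have "x \<in> E' (to_nat_on I i)" by (simp add: E')
    then show "x \<in> (\<Union>n. E' n)" by (rule UN_I[OF UNIV_I])
  qed
  then have "?H (\<Union>i\<in>I. E i) \<le> ?H (\<Union>n. E' n)" by (rule hausdorff_premeasure_mono)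
  also have "\<dots> \<le> (\<Sum>n. ?H (E' n))" by (rule hausdorff_premeasure_subadditive)
  also have "\<dots> = (\<integral>\<^sup>+n. ?H (E' n) \<partial>count_space UNIV)" by (simp add: nn_integral_count_space_nat)
  also have "\<dots> = (\<integral>\<^sup>+n. ?H (E' n) * indicator N n \<partial>count_space UNIV)"
    by (intro nn_integral_cong) (auto simp: E'_def hausdorff_premeasure_empty assms(2) split: split_indicator)
  also have "\<dots> = (\<integral>\<^sup>+n. ?H (E' n) \<partial>count_space N)"
    by (simp add: nn_integral_count_space_indicator)
  also have "\<dots> = (\<integral>\<^sup>+i. ?H (E' (to_nat_on I i)) \<partial>count_space I)"
    by (rule nn_integral_bij_count_space[OF bij, symmetric])
  also have "\<dots> = (\<integral>\<^sup>+i. ?H (E i) \<partial>count_space I)"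
    by (intro nn_integral_cong) (simp add: E')
  finally show ?thesis .
qed

text \<open>There are only countably many overlaps, so the sets become disjoint after removing one null set.\<close>

lemma nn_integral_emeasure_almost_disjoint:
  assumes I: "countable I" and B: "\<And>i. i \<in> I \<Longrightarrow> B i \<in> sets M"
    and null: "\<And>i j. i \<in> I \<Longrightarrow> j \<in> I \<Longrightarrow> i \<noteq> j \<Longrightarrow> emeasure M (B i \<inter> B j) = 0"
    and E: "E \<in> sets M" "\<And>i. i \<in> I \<Longrightarrow> B i \<subseteq> E"
  shows "(\<integral>\<^sup>+i. emeasure M (B i) \<partial>count_space I) \<le> emeasure M E"
proof -
  define N where "N = (\<Union>(i, j)\<in>{(i, j). i \<in> I \<and> j \<in> I \<and> i \<noteq> j}. B i \<inter> B j)"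
  have "N \<in> null_sets M"
    unfolding N_def
  proof (rule null_sets_UN')
    show "countable {(i, j). i \<in> I \<and> j \<in> I \<and> i \<noteq> j}"
      by (rule countable_subset[of _ "I \<times> I"]) (use I in auto)
  qed (use B null in auto)
  then have N: "N \<in> sets M" "emeasure M (A - N) = emeasure M A" if "A \<in> sets M" for A
    using that by (auto simp: emeasure_Diff_null_set)
  have "(\<integral>\<^sup>+i. emeasure M (B i) \<partial>count_space I) = (\<integral>\<^sup>+i. emeasure M (B i - N) \<partial>count_space I)"
    by (intro nn_integral_cong) (simp add: N(2) B)
  also have "\<dots> = emeasure M (\<Union>i\<in>I. B i - N)"
    by (rule emeasure_UN_countable[symmetric])
       (use B N(1)[OF E(1)] I in \<open>auto simp: disjoint_family_on_def N_def\<close>)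
  also have "\<dots> \<le> emeasure M E" by (rule emeasure_mono) (use E in auto)
  finally show ?thesis .
qed

lemma suminf_ennreal_eq_terms:
  fixes f g :: "nat \<Rightarrow> ennreal"
  assumes le: "\<And>n. f n \<le> g n" and sums: "suminf g \<le> suminf f" "suminf f < \<infinity>"
  shows "f n = g n"
proof -
  have "suminf g = (\<Sum>n. f n + (g n - f n))" using le by (intro suminf_cong) (simp add: add_diff_inverse_ennreal)
  also have "\<dots> = suminf f + (\<Sum>n. g n - f n)" by (rule suminf_add[symmetric]) auto
  finally have "suminf f + (\<Sum>n. g n - f n) \<le> suminf f + 0" using sums(1) by simp
  then have "suminf f = \<infinity> \<or> (\<Sum>n. g n - f n) \<le> 0" by (simp only: ennreal_add_left_cancel_le)
  then have "(\<Sum>n. g n - f n) = 0" using sums(2) by (elim disjE) simp_all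
  then have "g n - f n \<le> 0" using sum_le_suminf[of "\<lambda>n. g n - f n" "{n}"] by simp
  then show ?thesis using le[of n] by (simp add: diff_eq_0_iff_ennreal antisym)
qed

section \<open>Positive transfer operators of spectral radius one\<close>

text \<open>One value below 1 forces geometric decay along multiples of \<open>N\<close>; the finitely many residues
  modulo \<open>N\<close> only contribute a constant.\<close>

lemma summable_submultiplicative:
  fixes M :: "nat \<Rightarrow> real"
  assumes nonneg: "\<And>n. 0 \<le> M n" and sub: "\<And>m n. M (m + n) \<le> M m * M n"
    and "0 < N" "M N < 1"
  shows "summable M"
proof -
  define t where "t = root N ((M N + 1) / 2)"
  have t: "t ^ N = (M N + 1) / 2" "0 < t" "t < 1"
    using assms(3,4) nonneg[of N] by (auto simp: t_def real_root_pow_pos2 real_root_lt_1_iff add_nonneg_pos)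
  define B where "B = Max ((\<lambda>l. M l / t ^ l) ` {..<N})"
  have "M n \<le> B * t ^ n" for n
  proof (induction n rule: less_induct)
    case (less n)
    show ?case
    proof (cases "n < N")
      case True
      then have "M n / t ^ n \<le> B" unfolding B_def by (intro Max_ge) auto
      then show ?thesis using t by (simp add: field_simps)
    next
      case False
      have "M n \<le> M N * M (n - N)" using sub[of N "n - N"] False by simp
      also have "\<dots> \<le> t ^ N * (B * t ^ (n - N))"
        using less[of "n - N"] False \<open>0 < N\<close> nonneg t(1,2) \<open>M N < 1\<close> by (intro mult_mono) auto
      also have "\<dots> = B * t ^ n" using False by (simp add: power_add[symmetric] mult_ac)
      finally show ?thesis .
    qed
  qed
  then show ?thesis
    using nonneg t(2,3) by (intro summable_comparison_test'[OF summable_mult[OF summable_geometric, of t B]]) simp_all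
qed

lemma sup_norm_on_upper:
  assumes "compact K" "f \<in> cont_funs K" "x \<in> K"
  shows "cmod (f x) \<le> sup_norm_on K f"
proof -
  have "compact ((\<lambda>x. cmod (f x)) ` K)"
    using assms by (auto simp: cont_funs_def intro!: compact_continuous_image continuous_intros)
  then have "bdd_above ((\<lambda>x. cmod (f x)) ` K)"
    by (simp add: bounded_imp_bdd_above compact_imp_bounded)
  then show ?thesis unfolding sup_norm_on_def using assms by (intro cSUP_upper)
qed

lemma sup_norm_on_least:
  "K \<noteq> {} \<Longrightarrow> (\<And>x. x \<in> K \<Longrightarrow> cmod (f x) \<le> B) \<Longrightarrow> sup_norm_on K f \<le> B"
  unfolding sup_norm_on_def by (rule cSUP_least)

lemma restrict_cont_funs:
  assumes "continuous_on K f" shows "restrict f K \<in> cont_funs K"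
proof -
  have "continuous_on K (restrict f K)"
    using assms by (rule continuous_on_eq) (rule restrict_apply'[symmetric])
  then show ?thesis unfolding cont_funs_def using restrict_extensional[of f K] by blast
qed

text \<open>The iterates of the transfer operator with weights \<open>g\<close>, applied to the constant function 1.\<close>

primrec weight_sum :: "(nat \<Rightarrow> 'a \<Rightarrow> 'a) \<Rightarrow> (nat \<Rightarrow> 'a \<Rightarrow> real) \<Rightarrow> nat \<Rightarrow> 'a \<Rightarrow> real" where
  "weight_sum s g 0 x = 1"
| "weight_sum s g (Suc n) x = (\<Sum>j. g j x * weight_sum s g n (s j x))"

locale transfer_system =
  fixes K :: "'a::metric_space set" and s :: "nat \<Rightarrow> 'a \<Rightarrow> 'a"
    and g :: "nat \<Rightarrow> 'a \<Rightarrow> real" and b :: "nat \<Rightarrow> real"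
  assumes K_compact: "compact K" and K_ne: "K \<noteq> {}"
    and s_in: "x \<in> K \<Longrightarrow> s j x \<in> K" and s_cont: "continuous_on K (s j)"
    and g_pos: "x \<in> K \<Longrightarrow> 0 < g j x" and g_cont: "continuous_on K (g j)"
    and g_le: "x \<in> K \<Longrightarrow> g j x \<le> b j" and b_summable: "summable b"
begin

abbreviation G where "G \<equiv> weight_sum s g"

definition T :: "('a \<Rightarrow> complex) \<Rightarrow> 'a \<Rightarrow> complex" where
  "T f = restrict (\<lambda>x. \<Sum>j. of_real (g j x) * f (s j x)) K"

definition M :: "nat \<Rightarrow> real" where "M n = (SUP x\<in>K. G n x)"

lemma b_nonneg: "0 \<le> b j"
  using K_ne g_pos g_le by (meson all_not_in_conv less_imp_le order_trans)

lemma summable_weighted: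
  fixes h :: "'a \<Rightarrow> 'b::banach"
  assumes "\<And>x. x \<in> K \<Longrightarrow> norm (h x) \<le> B" "x \<in> K"
  shows "summable (\<lambda>j. g j x *\<^sub>R h (s j x))"
proof (rule summable_comparison_test')
  show "summable (\<lambda>j. b j * B)" by (intro summable_mult2 b_summable)
  show "norm (g j x *\<^sub>R h (s j x)) \<le> b j * B" for j
    using assms g_pos[of x j] g_le[of x j] s_in[of x j] by (auto intro!: mult_mono b_nonneg)
qed

lemma T_apply: "x \<in> K \<Longrightarrow> T f x = (\<Sum>j. g j x *\<^sub>R f (s j x))"
  by (simp add: T_def scaleR_conv_of_real)

lemma cont_funs_bound:
  "f \<in> cont_funs K \<Longrightarrow> x \<in> K \<Longrightarrow> cmod (f x) \<le> sup_norm_on K f"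
  by (rule sup_norm_on_upper[OF K_compact])

lemma T_cont_funs:
  assumes f: "f \<in> cont_funs K" shows "T f \<in> cont_funs K"
proof -
  have "uniform_limit K (\<lambda>n x. \<Sum>j<n. g j x *\<^sub>R f (s j x)) (\<lambda>x. \<Sum>j. g j x *\<^sub>R f (s j x)) sequentially"
  proof (rule Weierstrass_m_test)
    show "summable (\<lambda>j. b j * sup_norm_on K f)" by (intro summable_mult2 b_summable)
    show "norm (g j x *\<^sub>R f (s j x)) \<le> b j * sup_norm_on K f" if "x \<in> K" for j x
      using cont_funs_bound[OF f s_in] that g_pos[of x j] g_le[of x j]
      by (auto intro!: mult_mono b_nonneg)
  qed
  moreover have "continuous_on K (\<lambda>x. \<Sum>j<n. g j x *\<^sub>R f (s j x))" for n
    using f s_in by (auto simp: cont_funs_def intro!: continuous_intros g_cont s_cont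
      continuous_on_compose2[of K f K])
  ultimately have "continuous_on K (\<lambda>x. \<Sum>j. g j x *\<^sub>R f (s j x))"
    by (intro uniform_limit_theorem[rotated]) (auto intro!: always_eventually)
  then have "continuous_on K (T f)" using T_apply by (subst continuous_on_cong[OF refl]) auto
  then show ?thesis by (simp add: cont_funs_def T_def)
qed

definition unit_fun :: "'a \<Rightarrow> complex" where "unit_fun = restrict (\<lambda>_. 1) K"

lemma unit_fun_cont: "unit_fun \<in> cont_funs K"
  unfolding unit_fun_def by (intro restrict_cont_funs continuous_intros)

lemma T_pow_unit_cont: "(T ^^ n) unit_fun \<in> cont_funs K"
  by (induction n) (simp_all add: T_cont_funs unit_fun_cont)

lemma T_pow_unit: "x \<in> K \<Longrightarrow> (T ^^ n) unit_fun x = of_real (G n x)"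
proof (induction n arbitrary: x)
  case 0 then show ?case by (simp add: unit_fun_def)
next
  case (Suc n)
  have eq: "g j x *\<^sub>R (T ^^ n) unit_fun (s j x) = of_real (g j x * G n (s j x))" for j
    using Suc.IH[OF s_in[OF Suc.prems]] by (simp add: scaleR_conv_of_real)
  have "summable (\<lambda>j. complex_of_real (g j x * G n (s j x)))"
    using summable_weighted[where h="(T ^^ n) unit_fun", OF cont_funs_bound[OF T_pow_unit_cont[of n]] Suc.prems]
    unfolding eq .
  then have sm: "summable (\<lambda>j. g j x * G n (s j x))" by (simp only: summable_complex_of_real)
  have "(T ^^ Suc n) unit_fun x = (\<Sum>j. complex_of_real (g j x * G n (s j x)))"
    unfolding funpow.simps o_apply T_apply[OF Suc.prems] eq ..
  also have "\<dots> = of_real (G (Suc n) x)" by (subst suminf_of_real[OF sm, symmetric]) simp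
  finally show ?case .
qed

lemma G_continuous: "continuous_on K (G n)"
proof -
  have "continuous_on K (\<lambda>x. Re ((T ^^ n) unit_fun x))"
    using T_pow_unit_cont[of n] by (auto simp: cont_funs_def intro!: continuous_intros)
  then show ?thesis
    by (rule continuous_on_eq) (simp add: T_pow_unit)
qed

lemma G_bounded: "\<exists>B. \<forall>x\<in>K. norm (G n x) \<le> B"
  using compact_imp_bounded[OF compact_continuous_image[OF G_continuous K_compact]]
  by (auto simp: bounded_iff)

lemma G_summable: "x \<in> K \<Longrightarrow> summable (\<lambda>j. g j x * G n (s j x))"
  using G_bounded[of n] summable_weighted[of "G n"] by auto

lemma G_nonneg: "x \<in> K \<Longrightarrow> 0 \<le> G n x"
proof (induction n arbitrary: x)
  case (Suc n)
  have "0 \<le> g j x * G n (s j x)" for j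
    using Suc g_pos[of x j] s_in[of x j] by simp
  then show ?case using G_summable[OF Suc.prems, of n] by (auto intro: suminf_nonneg)
qed simp

lemma G_le_M: "x \<in> K \<Longrightarrow> G n x \<le> M n"
  unfolding M_def by (intro cSUP_upper bounded_imp_bdd_above compact_imp_bounded
    compact_continuous_image G_continuous K_compact)

lemma M_least: "(\<And>x. x \<in> K \<Longrightarrow> G n x \<le> c) \<Longrightarrow> M n \<le> c"
  unfolding M_def by (rule cSUP_least[OF K_ne])

lemma M_nonneg: "0 \<le> M n"
  using G_nonneg G_le_M K_ne by (meson all_not_in_conv order_trans)

lemma G_add_le:
  assumes "\<And>y. y \<in> K \<Longrightarrow> G n y \<le> c" "x \<in> K"
  shows "G (m + n) x \<le> c * G m x"
  using assms(2)
proof (induction m arbitrary: x)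
  case (Suc m)
  have "G (Suc m + n) x = (\<Sum>j. g j x * G (m + n) (s j x))" by simp
  also have "\<dots> \<le> (\<Sum>j. c * (g j x * G m (s j x)))"
  proof (rule suminf_le)
    fix j show "g j x * G (m + n) (s j x) \<le> c * (g j x * G m (s j x))"
      using mult_left_mono[OF Suc.IH[OF s_in[OF Suc.prems]] less_imp_le[OF g_pos[OF Suc.prems]]]
      by (simp add: mult_ac)
  qed (auto intro!: G_summable Suc.prems summable_mult)
  also have "\<dots> = c * G (Suc m) x" by (simp add: suminf_mult G_summable Suc.prems)
  finally show ?case .
qed (use assms in auto)

lemma G_add_ge:
  assumes "\<And>y. y \<in> K \<Longrightarrow> c \<le> G n y" "x \<in> K"
  shows "c * G m x \<le> G (m + n) x"
  using assms(2)
proof (induction m arbitrary: x)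
  case (Suc m)
  have "c * G (Suc m) x = (\<Sum>j. c * (g j x * G m (s j x)))" by (simp add: suminf_mult G_summable Suc.prems)
  also have "\<dots> \<le> (\<Sum>j. g j x * G (m + n) (s j x))"
  proof (rule suminf_le)
    fix j show "c * (g j x * G m (s j x)) \<le> g j x * G (m + n) (s j x)"
      using mult_left_mono[OF Suc.IH[OF s_in[OF Suc.prems]] less_imp_le[OF g_pos[OF Suc.prems]]]
      by (simp add: mult_ac)
  qed (auto intro!: G_summable Suc.prems summable_mult)
  also have "\<dots> = G (Suc m + n) x" by simp
  finally show ?case .
qed (use assms in auto)

lemma M_submult: "M (m + n) \<le> M m * M n"
proof (rule M_least)
  fix x assume x: "x \<in> K"
  have "G (m + n) x \<le> M n * G m x" by (rule G_add_le[OF G_le_M x])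
  also have "\<dots> \<le> M n * M m" by (intro mult_left_mono G_le_M x M_nonneg)
  finally show "G (m + n) x \<le> M m * M n" by (simp add: mult.commute)
qed

text \<open>Iterating the equation \<open>z f = T f + k\<close> bounds \<open>f\<close> by the partial sums of the Neumann series
  plus a remainder.\<close>

lemma resolvent_iterate_bound:
  assumes f: "f \<in> cont_funs K" and k: "\<And>x. x \<in> K \<Longrightarrow> cmod (z * f x - T f x) \<le> B"
    and z: "z \<noteq> 0" and x: "x \<in> K"
  shows "cmod (f x) \<le> G n x * sup_norm_on K f / cmod z ^ n + (\<Sum>i<n. G i x / cmod z ^ Suc i) * B"
  using x
proof (induction n arbitrary: x)
  case 0 then show ?case using cont_funs_bound[OF f] by simp
next
  case (Suc n)
  let ?N = "sup_norm_on K f" and ?z = "cmod z"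
  have "?z * cmod (f x) = cmod (T f x + (z * f x - T f x))" by (simp add: norm_mult)
  also have "\<dots> \<le> cmod (T f x) + B" by (intro norm_triangle_le add_left_mono k Suc.prems)
  also have "cmod (T f x) \<le> (\<Sum>j. g j x * cmod (f (s j x)))"
  proof -
    have "summable (\<lambda>j. g j x *\<^sub>R cmod (f (s j x)))"
      by (rule summable_weighted[of "\<lambda>x. cmod (f x)" ?N]) (auto intro: cont_funs_bound f Suc.prems)
    then have "summable (\<lambda>j. norm (g j x *\<^sub>R f (s j x)))"
      using g_pos[OF Suc.prems] by (simp add: less_imp_le)
    from summable_norm[OF this] show ?thesis
      using g_pos[OF Suc.prems] Suc.prems by (simp add: T_apply less_imp_le)
  qed
  also have "\<dots> \<le> (\<Sum>j. g j x * G n (s j x) * (?N / ?z ^ n) + (\<Sum>i<n. g j x * G i (s j x) * (B / ?z ^ Suc i)))"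
  proof (rule suminf_le)
    fix j
    have "g j x * cmod (f (s j x))
        \<le> g j x * (G n (s j x) * ?N / ?z ^ n + (\<Sum>i<n. G i (s j x) / ?z ^ Suc i) * B)"
      by (intro mult_left_mono Suc.IH s_in Suc.prems less_imp_le g_pos)
    then show "g j x * cmod (f (s j x)) \<le> g j x * G n (s j x) * (?N / ?z ^ n)
        + (\<Sum>i<n. g j x * G i (s j x) * (B / ?z ^ Suc i))"
      by (simp add: algebra_simps sum_distrib_left sum_distrib_right)
  next
    show "summable (\<lambda>j. g j x * cmod (f (s j x)))"
      using summable_weighted[of "\<lambda>x. cmod (f x)" ?N] cont_funs_bound f Suc.prems by simp
  qed (intro summable_add summable_sum summable_mult2 G_summable Suc.prems)
  also have "\<dots> = G (Suc n) x * (?N / ?z ^ n) + (\<Sum>i<n. G (Suc i) x * (B / ?z ^ Suc i))"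
  proof -
    have sm: "summable (\<lambda>j. g j x * G i (s j x) * c)" for i c
      by (intro summable_mult2 G_summable Suc.prems)
    have eq: "(\<Sum>j. g j x * G i (s j x) * c) = G (Suc i) x * c" for i c
      using suminf_mult2[OF G_summable[OF Suc.prems, of i], of c] by simp
    show ?thesis
      by (subst suminf_add[symmetric]) (auto intro!: sm summable_sum simp only: eq suminf_sum[OF sm])
  qed
  finally have "?z * cmod (f x) \<le> G (Suc n) x * (?N / ?z ^ n) + (\<Sum>i<n. G (Suc i) x * (B / ?z ^ Suc i)) + B"
    by simp
  then have "cmod (f x) \<le> (G (Suc n) x * (?N / ?z ^ n) + (\<Sum>i<n. G (Suc i) x * (B / ?z ^ Suc i)) + B) / ?z"
    using z by (simp add: field_simps)
  also have "\<dots> = G (Suc n) x * ?N / ?z ^ Suc n + (\<Sum>i<Suc n. G i x / ?z ^ Suc i) * B"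
    using z by (subst sum.lessThan_Suc_shift)
      (simp add: add_divide_distrib sum_divide_distrib sum_distrib_right sum_distrib_left algebra_simps)
  finally show ?case .
qed





text \<open>The Neumann series for the solution of \<open>z f = T f + k\<close>, produced by iterating
  \<open>f \<mapsto> (k + T f) / z\<close> from 0. Consecutive iterates differ by at most a multiple of \<open>M n / q ^ n\<close>, so they
  converge uniformly.\<close>

lemma resolvent_surj:
  assumes sum: "summable (\<lambda>n. M n / q ^ n)" and q: "0 < q" "q \<le> cmod z" and k: "k \<in> cont_funs K"
  shows "\<exists>f\<in>cont_funs K. \<forall>x\<in>K. z * f x - T f x = k x"
proof -
  have z: "z \<noteq> 0" using q by auto
  have le: "M n / cmod z ^ n \<le> M n / q ^ n" for n
    using q by (intro divide_left_mono power_mono mult_pos_pos zero_less_power M_nonneg) auto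
  define \<Phi> where "\<Phi> f = restrict (\<lambda>x. (k x + T f x) / z) K" for f
  define R where "R n = (\<Phi> ^^ n) (restrict (\<lambda>_. 0) K)" for n
  have R_Suc: "R (Suc n) x = (k x + T (R n) x) / z" if "x \<in> K" for n x
    using that by (simp add: R_def \<Phi>_def)
  have R0: "R 0 x = 0" if "x \<in> K" for x using that by (simp add: R_def)
  have R_cont: "R n \<in> cont_funs K" for n
  proof (induction n)
    case 0
    show ?case unfolding R_def funpow_0 by (intro restrict_cont_funs continuous_intros)
  next
    case (Suc n)
    have "continuous_on K (\<lambda>x. (k x + T (R n) x) / z)"
      using k T_cont_funs[OF Suc] z by (auto simp: cont_funs_def intro!: continuous_intros)
    then show ?case using restrict_cont_funs[of K "\<lambda>x. (k x + T (R n) x) / z"]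
      by (simp add: R_def \<Phi>_def del: restrict_apply)
  qed
  have T_diff: "cmod (T f x - T h x) \<le> (\<Sum>j. g j x * u (s j x))"
    if f: "f \<in> cont_funs K" and h: "h \<in> cont_funs K" and x: "x \<in> K"
      and u: "\<And>y. y \<in> K \<Longrightarrow> cmod (f y - h y) \<le> u y" and sm: "summable (\<lambda>j. g j x * u (s j x))" for f h x u
  proof -
    have eq: "T f x - T h x = (\<Sum>j. g j x *\<^sub>R (f (s j x) - h (s j x)))"
      unfolding T_apply[OF x] scaleR_diff_right
      by (rule suminf_diff[OF summable_weighted[OF cont_funs_bound[OF f] x] summable_weighted[OF cont_funs_bound[OF h] x]])
    have le: "norm (g j x *\<^sub>R (f (s j x) - h (s j x))) \<le> g j x * u (s j x)" for j
      using u[OF s_in[OF x]] g_pos[OF x, of j] by simp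
    have sn: "summable (\<lambda>j. norm (g j x *\<^sub>R (f (s j x) - h (s j x))))"
      by (rule summable_comparison_test'[OF sm, of 0]) (use le in simp)
    show ?thesis unfolding eq
      by (rule order_trans[OF summable_norm[OF sn] suminf_le[OF le sn sm]])
  qed
  let ?N = "sup_norm_on K k"
  have step: "cmod (R (Suc n) x - R n x) \<le> G n x * (?N / cmod z ^ Suc n)" if "x \<in> K" for n x
    using that
  proof (induction n arbitrary: x)
    case 0
    have "T (R 0) x = 0" using 0 s_in by (simp add: T_apply R0)
    then show ?case using cont_funs_bound[OF k 0] z 0
      by (simp add: R_Suc R0 norm_divide divide_right_mono)
  next
    case (Suc n)
    have "cmod (T (R (Suc n)) x - T (R n) x) \<le> (\<Sum>j. g j x * (G n (s j x) * (?N / cmod z ^ Suc n)))"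
      using Suc.IH summable_mult2[OF G_summable[OF Suc.prems, of n], of "?N / cmod z ^ Suc n"]
      by (intro T_diff R_cont Suc.prems) (auto simp: mult_ac)
    also have "\<dots> = G (Suc n) x * (?N / cmod z ^ Suc n)"
      by (simp only: weight_sum.simps suminf_mult2[OF G_summable[OF Suc.prems]] mult.assoc)
    finally have "cmod (T (R (Suc n)) x - T (R n) x) / cmod z \<le> G (Suc n) x * (?N / cmod z ^ Suc n) / cmod z"
      by (rule divide_right_mono) simp
    moreover have "R (Suc (Suc n)) x - R (Suc n) x = (T (R (Suc n)) x - T (R n) x) / z"
      using Suc.prems by (simp only: R_Suc) (simp add: diff_divide_distrib add_divide_distrib)
    ultimately show ?case by (simp add: norm_divide mult_ac del: weight_sum.simps)
  qed
  have N0: "0 \<le> ?N"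
    using cont_funs_bound[OF k] K_ne by (meson all_not_in_conv norm_ge_zero order_trans)
  have maj: "summable (\<lambda>n. M n / q ^ n * (?N / cmod z))" by (intro summable_mult2 sum)
  have step': "cmod (R (Suc n) x - R n x) \<le> M n / q ^ n * (?N / cmod z)" if x: "x \<in> K" for n x
  proof -
    have "G n x * (?N / cmod z ^ Suc n) \<le> M n * (?N / cmod z ^ Suc n)"
      using G_le_M[OF x] N0 by (intro mult_right_mono) auto
    also have "\<dots> = M n / cmod z ^ n * (?N / cmod z)" by (simp add: mult_ac)
    also have "\<dots> \<le> M n / q ^ n * (?N / cmod z)"
      by (intro mult_right_mono le) (simp add: N0)
    finally show ?thesis using step[OF x, of n] by linarith
  qed
  define F where "F x = (\<Sum>n. R (Suc n) x - R n x)" for x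
  have "uniform_limit K (\<lambda>n x. \<Sum>i<n. R (Suc i) x - R i x) F sequentially"
    unfolding F_def by (rule Weierstrass_m_test[OF step' maj])
  moreover have tele: "(\<Sum>i<n. R (Suc i) x - R i x) = R n x" if "x \<in> K" for n x
    using sum_lessThan_telescope[of "\<lambda>n. R n x" n] R0[OF that] by simp
  ultimately have lim: "uniform_limit K R F sequentially"
    using uniform_limit_cong'[where f="\<lambda>n x. \<Sum>i<n. R (Suc i) x - R i x" and g=R and h=F and i=F] by blast
  define f where "f = restrict F K"
  have "continuous_on K F"
    using lim R_cont by (intro uniform_limit_theorem[OF _ lim]) (auto simp: cont_funs_def)
  then have f: "f \<in> cont_funs K"
    unfolding f_def by (rule restrict_cont_funs)
  have "z * f x - T f x = k x" if x: "x \<in> K" for x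
  proof -
    have "(\<lambda>n. T (R n) x) \<longlonglongrightarrow> T f x"
    proof (rule LIMSEQ_I)
      fix e :: real assume "0 < e"
      define d where "d = e / (M 1 + 1)"
      have "0 < d" using \<open>0 < e\<close> M_nonneg[of 1] by (simp add: d_def)
      then obtain N where N: "\<And>n y. N \<le> n \<Longrightarrow> y \<in> K \<Longrightarrow> dist (R n y) (F y) < d"
        using lim unfolding uniform_limit_sequentially_iff by blast
      have "norm (T (R n) x - T f x) < e" if "N \<le> n" for n
      proof -
        have sm: "summable (\<lambda>j. g j x * d)"
          using G_summable[OF x, of 0] by (intro summable_mult2) simp
        have "norm (T (R n) x - T f x) \<le> (\<Sum>j. g j x * d)"
          using N[OF that] sm by (intro T_diff R_cont f x) (auto simp: f_def dist_norm less_imp_le)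
        also have "\<dots> = G 1 x * d" using G_summable[OF x, of 0] by (simp add: suminf_mult2)
        also have "\<dots> \<le> M 1 * d" using \<open>0 < d\<close> G_le_M[OF x, of 1] by (intro mult_right_mono) auto
        also have "\<dots> < e" using \<open>0 < e\<close> M_nonneg[of 1] by (simp add: d_def field_simps)
        finally show ?thesis .
      qed
      then show "\<exists>N. \<forall>n\<ge>N. norm (T (R n) x - T f x) < e" by blast
    qed
    then have "(\<lambda>n. (k x + T (R n) x) / z) \<longlonglongrightarrow> (k x + T f x) / z"
      using z by (intro tendsto_intros)
    moreover have "(\<lambda>n. R (Suc n) x) \<longlonglongrightarrow> f x"
      using tendsto_uniform_limitI[OF lim x] x by (intro LIMSEQ_Suc) (simp add: f_def)
    ultimately have "f x = (k x + T f x) / z"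
      unfolding R_Suc[OF x] by (rule LIMSEQ_unique[rotated])
    then show ?thesis using z by (simp add: field_simps)
  qed
  with f show ?thesis by blast
qed

lemma M_tail_zero:
  assumes "summable (\<lambda>n. M n / q ^ n)" shows "(\<lambda>n. M n / q ^ n * c) \<longlonglongrightarrow> 0"
  using tendsto_mult_right[OF summable_LIMSEQ_zero[OF assms], of c] by (simp add: mult.commute)

lemma not_in_spectrum:
  assumes sum: "summable (\<lambda>n. M n / q ^ n)" and q: "0 < q" "q \<le> cmod z"
  shows "z \<notin> spectrum_on K T"
proof -
  have z: "z \<noteq> 0" using q by auto
  define S where "S f = restrict (\<lambda>x. z * f x - T f x) K" for f
  define B where "B = (\<Sum>n. M n / q ^ n) / cmod z"
  have S_cont: "S f \<in> cont_funs K" if f: "f \<in> cont_funs K" for f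
  proof -
    have "continuous_on K (\<lambda>x. z * f x - T f x)"
      using f T_cont_funs[OF f] by (auto simp: cont_funs_def intro!: continuous_intros)
    then show ?thesis unfolding S_def by (rule restrict_cont_funs)
  qed
  have Gz: "G n x / cmod z ^ n \<le> M n / q ^ n" if "x \<in> K" for n x
    using that q by (intro frac_le G_le_M G_nonneg M_nonneg power_mono) auto
  have bound: "cmod (f x) \<le> B * D"
    if f: "f \<in> cont_funs K" and D: "\<And>y. y \<in> K \<Longrightarrow> cmod (z * f y - T f y) \<le> D" and x: "x \<in> K" for f D x
  proof -
    have D0: "0 \<le> D" by (rule order_trans[OF norm_ge_zero D[OF x]])
    have N0: "0 \<le> sup_norm_on K f" by (rule order_trans[OF norm_ge_zero cont_funs_bound[OF f x]])
    have le: "cmod (f x) \<le> M n / q ^ n * sup_norm_on K f + B * D" for n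
    proof -
      have "cmod (f x) \<le> G n x / cmod z ^ n * sup_norm_on K f + (\<Sum>i<n. G i x / cmod z ^ i) / cmod z * D"
        using resolvent_iterate_bound[OF f D z x, of n] by (simp add: sum_divide_distrib mult_ac)
      also have "\<dots> \<le> M n / q ^ n * sup_norm_on K f + (\<Sum>i<n. M i / q ^ i) / cmod z * D"
        by (intro add_mono mult_right_mono divide_right_mono sum_mono Gz x N0 D0) auto
      also have "(\<Sum>i<n. M i / q ^ i) / cmod z * D \<le> B * D"
        unfolding B_def using q M_nonneg
        by (intro mult_right_mono divide_right_mono sum_le_suminf sum D0) auto
      finally show ?thesis by simp
    qed
    have "(\<lambda>n. M n / q ^ n * sup_norm_on K f + B * D) \<longlonglongrightarrow> 0 + B * D"
      by (intro tendsto_add M_tail_zero sum tendsto_const)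
    then show ?thesis using le by (intro LIMSEQ_le_const) auto
  qed
  have "sup_norm_on K f \<le> B * sup_norm_on K (S f)" if f: "f \<in> cont_funs K" for f
    using cont_funs_bound[OF S_cont[OF f]] by (intro sup_norm_on_least K_ne bound f) (simp add: S_def)
  moreover have "bij_betw S (cont_funs K) (cont_funs K)"
    unfolding bij_betw_def
  proof
    show "inj_on S (cont_funs K)"
    proof
      fix f h assume f: "f \<in> cont_funs K" and h: "h \<in> cont_funs K" and eq: "S f = S h"
      define u where "u = restrict (\<lambda>x. f x - h x) K"
      have "continuous_on K (\<lambda>x. f x - h x)"
        using f h by (auto simp: cont_funs_def intro!: continuous_intros)
      then have u: "u \<in> cont_funs K" unfolding u_def by (rule restrict_cont_funs)
      have Tu: "T u x = T f x - T h x" if x: "x \<in> K" for x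
      proof -
        have "T f x - T h x = (\<Sum>j. g j x *\<^sub>R (f (s j x) - h (s j x)))"
          unfolding T_apply[OF x] scaleR_diff_right
          by (rule suminf_diff[OF summable_weighted[OF cont_funs_bound[OF f] x]
                summable_weighted[OF cont_funs_bound[OF h] x]])
        then show ?thesis using x s_in by (simp add: T_apply u_def)
      qed
      have "cmod (z * u x - T u x) \<le> 0" if x: "x \<in> K" for x
        using fun_cong[OF eq, of x] x by (simp add: S_def Tu) (simp add: u_def algebra_simps)
      from bound[OF u this] have "f x = h x" if "x \<in> K" for x
        using that by (simp add: u_def)
      then show "f = h" using f h unfolding cont_funs_def by (intro extensionalityI[of f K h]) blast+
    qed
    show "S ` cont_funs K = cont_funs K"
    proof
      show "cont_funs K \<subseteq> S ` cont_funs K"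
      proof
        fix k assume k: "k \<in> cont_funs K"
        from resolvent_surj[OF sum q k] obtain f where "f \<in> cont_funs K" "\<forall>x\<in>K. z * f x - T f x = k x" by blast
        have "S f = k"
        proof (rule extensionalityI[of _ K])
          show "S f \<in> extensional K" "k \<in> extensional K" using k by (simp_all add: S_def cont_funs_def)
          show "S f x = k x" if "x \<in> K" for x
            using that \<open>\<forall>x\<in>K. z * f x - T f x = k x\<close> by (simp add: S_def)
        qed
        then show "k \<in> S ` cont_funs K" using \<open>f \<in> cont_funs K\<close> by blast
      qed
    qed (use S_cont in blast)
  qed
  ultimately have "bij_betw S (cont_funs K) (cont_funs K) \<and>
      (\<exists>B. \<forall>f\<in>cont_funs K. sup_norm_on K f \<le> B * sup_norm_on K (S f))" by blast
  then show ?thesis unfolding spectrum_on_def Let_def S_def[abs_def] by simp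
qed

lemma summable_M_above:
  assumes "1 \<le> n" "0 < q" "M n < q ^ n"
  shows "summable (\<lambda>k. M k / q ^ k)"
proof (rule summable_submultiplicative)
  fix m n show "M (m + n) / q ^ (m + n) \<le> M m / q ^ m * (M n / q ^ n)"
    using M_submult[of m n] assms(2) by (simp add: power_add divide_right_mono)
qed (use assms M_nonneg in auto)

text \<open>The infimum of \<open>root n (M n)\<close> over \<open>n \<ge> 1\<close>, which by submultiplicativity is the exponential growth
  rate of the iterates.\<close>

definition r :: real where "r = Inf {q. 0 < q \<and> (\<exists>n\<ge>1. M n < q ^ n)}"

lemma r_nonneg: "0 \<le> r"
  and summable_above_r: "r < q \<Longrightarrow> summable (\<lambda>k. M k / q ^ k)"
  and r_power_le: "r ^ n \<le> M n"
proof -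
  let ?Q = "{q. 0 < q \<and> (\<exists>n\<ge>1. M n < q ^ n)}"
  have "M 1 < (M 1 + 1) ^ 1" by simp
  then have ne: "M 1 + 1 \<in> ?Q" using M_nonneg[of 1] by (auto intro!: exI[of _ "1::nat"])
  have bdd: "bdd_below ?Q" by (rule bdd_belowI[of _ 0]) auto
  show r0: "0 \<le> r" unfolding r_def using ne by (intro cInf_greatest) auto
  show "summable (\<lambda>k. M k / q ^ k)" if "r < q"
  proof -
    have "\<exists>p\<in>?Q. p < q" using that ne unfolding r_def by (intro cInf_lessD) auto
    then obtain p n where p: "0 < p" "1 \<le> n" "M n < p ^ n" "p < q" by blast
    then have "p ^ n \<le> q ^ n" by (intro power_mono) auto
    with p have "0 < q" "M n < q ^ n" by linarith+
    then show ?thesis by (rule summable_M_above[OF p(2)])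
  qed
  show "r ^ n \<le> M n"
  proof (cases "n = 0")
    case True
    have "M 0 = 1" unfolding M_def using K_ne by simp
    with True show ?thesis by simp
  next
    case False
    show ?thesis
    proof (rule ccontr)
      assume "\<not> ?thesis"
      then have lt: "M n < r ^ n" by simp
      define q where "q = root n ((M n + r ^ n) / 2)"
      have q: "q ^ n = (M n + r ^ n) / 2" "0 < q"
        using lt False M_nonneg[of n] by (auto simp: q_def real_root_pow_pos2)
      then have "q \<in> ?Q" using lt False by (auto intro!: exI[of _ n])
      then have "r \<le> q" unfolding r_def using bdd by (rule cInf_lower)
      then have "r ^ n \<le> q ^ n" using r0 by (rule power_mono)
      with q lt show False by simp
    qed
  qed
qed

text \<open>At a positive real \<open>q\<close> the partial sums of the Neumann series of the constant 1 can be followed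
  exactly, which gives a lower bound for the resolvent and not only an upper one.\<close>

lemma resolvent_expansion:
  assumes f: "f \<in> cont_funs K" and eq: "\<And>x. x \<in> K \<Longrightarrow> of_real q * f x - T f x = 1"
    and q: "0 < q" and x: "x \<in> K"
  shows "cmod (f x - of_real (\<Sum>i<n. G i x / q ^ Suc i)) \<le> G n x * (sup_norm_on K f / q ^ n)"
  using x
proof (induction n arbitrary: x)
  case 0 then show ?case using cont_funs_bound[OF f] by simp
next
  case (Suc n)
  note x = Suc.prems
  let ?P = "\<lambda>y. \<Sum>i<n. G i y / q ^ Suc i"
  have sm: "summable (\<lambda>j. g j x * G i (s j x) / c)" for i c
    by (intro summable_divide G_summable x)
  have P_eq: "g j x *\<^sub>R complex_of_real (?P (s j x)) = of_real (\<Sum>i<n. g j x * G i (s j x) / q ^ Suc i)" for j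
    by (simp add: scaleR_conv_of_real sum_distrib_left)
  have sP: "summable (\<lambda>j. \<Sum>i<n. g j x * G i (s j x) / q ^ Suc i)" by (intro summable_sum sm)
  have sP': "summable (\<lambda>j. g j x *\<^sub>R complex_of_real (?P (s j x)))"
    unfolding P_eq by (intro summable_of_real sP)
  have sf: "summable (\<lambda>j. g j x *\<^sub>R f (s j x))" by (rule summable_weighted[OF cont_funs_bound[OF f] x])
  have "(\<Sum>j. g j x *\<^sub>R complex_of_real (?P (s j x)))
      = of_real (\<Sum>j. \<Sum>i<n. g j x * G i (s j x) / q ^ Suc i)"
    unfolding P_eq by (rule suminf_of_real[OF sP, symmetric])
  also have "(\<Sum>j. \<Sum>i<n. g j x * G i (s j x) / q ^ Suc i) = (\<Sum>i<n. G (Suc i) x / q ^ Suc i)"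
    using suminf_divide[OF G_summable[OF x]] by (subst suminf_sum[OF sm]) simp
  finally have TP: "(\<Sum>j. g j x *\<^sub>R complex_of_real (?P (s j x))) = of_real (\<Sum>i<n. G (Suc i) x / q ^ Suc i)" .
  have "(\<Sum>i<Suc n. G i x / q ^ Suc i) = (1 + (\<Sum>i<n. G (Suc i) x / q ^ Suc i)) / q"
    by (simp only: sum.lessThan_Suc_shift add_divide_distrib sum_divide_distrib)
       (simp add: mult_ac del: weight_sum.simps(2))
  moreover have "f x = (1 + T f x) / of_real q" using eq[OF x] q by (simp add: field_simps)
  ultimately have "f x - of_real (\<Sum>i<Suc n. G i x / q ^ Suc i)
      = (T f x - of_real (\<Sum>i<n. G (Suc i) x / q ^ Suc i)) / of_real q"
    by (simp only: of_real_divide of_real_add of_real_1) (simp add: diff_divide_distrib add_divide_distrib)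
  also have "T f x - of_real (\<Sum>i<n. G (Suc i) x / q ^ Suc i)
      = (\<Sum>j. g j x *\<^sub>R (f (s j x) - of_real (?P (s j x))))"
    unfolding T_apply[OF x] TP[symmetric] scaleR_diff_right by (rule suminf_diff[OF sf sP'])
  finally have *: "cmod (f x - of_real (\<Sum>i<Suc n. G i x / q ^ Suc i))
      = cmod (\<Sum>j. g j x *\<^sub>R (f (s j x) - of_real (?P (s j x)))) / q"
    using q by (simp add: norm_divide)
  let ?u = "\<lambda>j. g j x * G n (s j x) * (sup_norm_on K f / q ^ n)"
  have le: "norm (g j x *\<^sub>R (f (s j x) - of_real (?P (s j x)))) \<le> ?u j" for j
    using mult_left_mono[OF Suc.IH[OF s_in[OF x, of j]] less_imp_le[OF g_pos[OF x, of j]]] g_pos[OF x, of j]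
    by (simp add: mult.assoc del: of_real_sum)
  have su: "summable ?u" by (intro summable_mult2 G_summable x)
  have sn: "summable (\<lambda>j. norm (g j x *\<^sub>R (f (s j x) - of_real (?P (s j x)))))"
    by (rule summable_comparison_test'[OF su, of 0]) (use le in simp)
  have "cmod (\<Sum>j. g j x *\<^sub>R (f (s j x) - of_real (?P (s j x)))) \<le> suminf ?u"
    by (rule order_trans[OF summable_norm[OF sn] suminf_le[OF le sn su]])
  also have "suminf ?u = G (Suc n) x * (sup_norm_on K f / q ^ n)"
    by (simp only: weight_sum.simps suminf_mult2[OF G_summable[OF x]])
  finally have "cmod (f x - of_real (\<Sum>i<Suc n. G i x / q ^ Suc i)) \<le> G (Suc n) x * (sup_norm_on K f / q ^ n) / q"
    unfolding * using q by (intro divide_right_mono) auto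
  then show ?case by (simp add: mult_ac del: weight_sum.simps sum.lessThan_Suc)
qed

end

locale distorted_transfer_system = transfer_system K s g b
  for K :: "'a::metric_space set" and s g b +
  fixes C :: real
  assumes distortion: "x \<in> K \<Longrightarrow> y \<in> K \<Longrightarrow> weight_sum s g n x \<le> C * weight_sum s g n y"
begin

lemma C_pos: "0 < C"
proof -
  obtain x where x: "x \<in> K" using K_ne by blast
  show ?thesis using distortion[OF x x, of 0] by simp
qed

lemma M_le_C_G: "x \<in> K \<Longrightarrow> M n \<le> C * G n x"
  by (intro M_least distortion)

text \<open>The growth rate \<open>r\<close> of the iterates belongs to the spectrum: the resolvents at \<open>q > r\<close>, applied
  to the constant function 1, dominate a multiple of the geometric series with sum \<open>1 / (q - r)\<close>, by
  positivity and bounded distortion, so they blow up as \<open>q\<close> decreases to \<open>r\<close>.\<close>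

lemma r_in_spectrum: "of_real r \<in> spectrum_on K T"
proof (rule ccontr)
  define S where "S f = restrict (\<lambda>x. of_real r * f x - T f x) K" for f
  assume "\<not> ?thesis"
  then obtain B0 where B0: "\<And>f. f \<in> cont_funs K \<Longrightarrow> sup_norm_on K f \<le> B0 * sup_norm_on K (S f)"
    unfolding spectrum_on_def Let_def S_def[abs_def] by auto
  define B where "B = max B0 1"
  have B: "0 < B" by (simp add: B_def)
  define q where "q = r + 1 / (2 * B) * min 1 (1 / (2 * C))"
  have q: "r < q" "0 < q" "(q - r) * B \<le> 1/2" "2 * B * C * (q - r) \<le> 1/2"
  proof -
    have "0 < 1 / (2 * B) * min 1 (1 / (2 * C))" using B C_pos by simp
    then show "r < q" "0 < q" using r_nonneg by (auto simp: q_def)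
    have "(q - r) * B = min 1 (1 / (2 * C)) / 2" using B by (simp add: q_def)
    then show "(q - r) * B \<le> 1/2" by simp
    have "2 * B * C * (q - r) = C * min 1 (1 / (2 * C))" using B by (simp add: q_def)
    also have "\<dots> \<le> C * (1 / (2 * C))" using C_pos by (intro mult_left_mono) auto
    finally show "2 * B * C * (q - r) \<le> 1/2" using C_pos by simp
  qed
  obtain f where f: "f \<in> cont_funs K" and "\<forall>x\<in>K. of_real q * f x - T f x = unit_fun x"
    using resolvent_surj[OF summable_above_r[OF q(1)] q(2) _ unit_fun_cont, of "of_real q"] q(2) by auto
  then have eq: "\<And>x. x \<in> K \<Longrightarrow> of_real q * f x - T f x = 1" by (simp add: unit_fun_def)
  obtain x0 where x0: "x0 \<in> K" using K_ne by blast
  let ?N = "sup_norm_on K f"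
  have N0: "0 \<le> ?N" by (rule order_trans[OF norm_ge_zero cont_funs_bound[OF f x0]])
  have "sup_norm_on K (S f) \<le> 1 + (q - r) * ?N"
  proof (rule sup_norm_on_least[OF K_ne])
    fix x assume x: "x \<in> K"
    have "S f x = 1 - of_real (q - r) * f x"
      using eq[OF x] x by (simp add: S_def algebra_simps)
    also have "cmod \<dots> \<le> 1 + (q - r) * cmod (f x)"
      using q(1) by (intro order_trans[OF norm_triangle_ineq4]) (simp add: norm_mult del: of_real_diff)
    also have "\<dots> \<le> 1 + (q - r) * ?N"
      using q(1) cont_funs_bound[OF f x] by (intro add_left_mono mult_left_mono) auto
    finally show "cmod (S f x) \<le> 1 + (q - r) * ?N" .
  qed
  then have "B0 * sup_norm_on K (S f) \<le> B * (1 + (q - r) * ?N)"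
  proof -
    assume le: "sup_norm_on K (S f) \<le> 1 + (q - r) * ?N"
    have "0 \<le> sup_norm_on K (S f)"
    proof -
      have "continuous_on K (\<lambda>x. of_real r * f x - T f x)"
        using f T_cont_funs[OF f] by (auto simp: cont_funs_def intro!: continuous_intros)
      then have "S f \<in> cont_funs K" unfolding S_def by (rule restrict_cont_funs)
      from cont_funs_bound[OF this x0] show ?thesis by (rule order_trans[OF norm_ge_zero])
    qed
    then show ?thesis using le B by (intro mult_mono) (auto simp: B_def)
  qed
  then have "?N \<le> B + ((q - r) * B) * ?N" using B0[OF f] by (simp add: algebra_simps)
  also have "((q - r) * B) * ?N \<le> 1/2 * ?N" using q(3) N0 by (rule mult_right_mono)
  finally have N: "?N \<le> 2 * B" by simp
  have part: "(\<Sum>i<n. r ^ i / q ^ Suc i) / C \<le> 2 * B + M n / q ^ n * ?N" for n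
  proof -
    have "(\<Sum>i<n. r ^ i / q ^ Suc i) / C = (\<Sum>i<n. (r ^ i / C) / q ^ Suc i)"
      by (simp add: sum_divide_distrib mult.commute)
    also have "\<dots> \<le> (\<Sum>i<n. G i x0 / q ^ Suc i)"
    proof (intro sum_mono divide_right_mono)
      fix i
      have "r ^ i \<le> C * G i x0" using r_power_le[of i] M_le_C_G[OF x0, of i] by linarith
      then show "r ^ i / C \<le> G i x0" using C_pos by (simp add: field_simps)
    qed (use q in auto)
    also have "\<dots> = cmod (of_real (\<Sum>i<n. G i x0 / q ^ Suc i))"
      unfolding norm_of_real using q(2) by (intro abs_of_nonneg[symmetric] sum_nonneg divide_nonneg_nonneg G_nonneg x0) auto
    also have "\<dots> \<le> cmod (f x0) + cmod (f x0 - of_real (\<Sum>i<n. G i x0 / q ^ Suc i))"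
      using norm_triangle_sub[of "of_real (\<Sum>i<n. G i x0 / q ^ Suc i)" "f x0"] by (simp add: norm_minus_commute)
    also have "\<dots> \<le> 2 * B + M n / q ^ n * ?N"
    proof (rule add_mono)
      show "cmod (f x0) \<le> 2 * B" using cont_funs_bound[OF f x0] N by linarith
      have "cmod (f x0 - of_real (\<Sum>i<n. G i x0 / q ^ Suc i)) \<le> G n x0 * (?N / q ^ n)"
        by (rule resolvent_expansion[OF f eq q(2) x0])
      also have "\<dots> \<le> M n * (?N / q ^ n)"
        using q(2) N0 by (intro mult_right_mono G_le_M x0) auto
      finally show "cmod (f x0 - of_real (\<Sum>i<n. G i x0 / q ^ Suc i)) \<le> M n / q ^ n * ?N" by simp
    qed
    finally show ?thesis .
  qed
  have "(\<lambda>n. (\<Sum>i<n. r ^ i / q ^ Suc i)) \<longlonglongrightarrow> 1 / (q - r)"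
  proof -
    have "(\<lambda>i. (r / q) ^ i) sums (1 / (1 - r / q))"
      using q r_nonneg by (intro geometric_sums) auto
    then have "(\<lambda>i. (r / q) ^ i / q) sums (1 / (1 - r / q) / q)" by (rule sums_divide)
    moreover have "(r / q) ^ i / q = r ^ i / q ^ Suc i" for i by (simp add: power_divide mult.commute)
    moreover have "1 / (1 - r / q) / q = 1 / (q - r)" using q(1,2) by (simp add: field_simps)
    ultimately have "(\<lambda>i. r ^ i / q ^ Suc i) sums (1 / (q - r))" by simp
    then show ?thesis by (simp add: sums_def)
  qed
  then have "(\<lambda>n. (\<Sum>i<n. r ^ i / q ^ Suc i) / C) \<longlonglongrightarrow> 1 / (q - r) / C"
    using C_pos by (intro tendsto_divide tendsto_const) auto
  moreover have "(\<lambda>n. 2 * B + M n / q ^ n * ?N) \<longlonglongrightarrow> 2 * B + 0"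
    by (intro tendsto_add tendsto_const M_tail_zero summable_above_r q)
  ultimately have "1 / (q - r) / C \<le> 2 * B + 0"
    using part by (intro LIMSEQ_le[of "\<lambda>n. (\<Sum>i<n. r ^ i / q ^ Suc i) / C"]) auto
  then have "1 \<le> 2 * B * C * (q - r)" using q C_pos by (simp add: field_simps)
  with q(4) show False by linarith
qed

lemma spectral_radius_eq_r: "spectral_radius_on K T = r"
  unfolding spectral_radius_on_def
proof (rule cSup_eq_maximum)
  show "r \<in> cmod ` spectrum_on K T"
    using r_in_spectrum r_nonneg by (intro image_eqI[of _ _ "of_real r"]) auto
  fix y assume "y \<in> cmod ` spectrum_on K T"
  then obtain z where z: "z \<in> spectrum_on K T" "y = cmod z" by blast
  show "y \<le> r"
  proof (rule ccontr)
    assume "\<not> y \<le> r"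
    then have "r < cmod z" "0 < cmod z" using z r_nonneg by auto
    from not_in_spectrum[OF summable_above_r[OF this(1)] this(2) order_refl] show False using z by blast
  qed
qed

text \<open>At spectral radius 1 the iterates neither grow nor decay: a value above \<open>C\<close> or below
  \<open>1 / C\<close> would, by distortion, push all values of that iterate to one side of 1 and force
  exponential behaviour.\<close>

lemma weight_sum_bounds:
  assumes "spectral_radius_on K T = 1" and x: "x \<in> K"
  shows "G n x \<le> C" and "1 / C \<le> G n x"
proof -
  have r: "r = 1" using spectral_radius_eq_r assms by simp
  show "1 / C \<le> G n x"
    using r_power_le[of n] M_le_C_G[OF x, of n] C_pos by (simp add: r field_simps)
  show "G n x \<le> C"
  proof (rule ccontr)
    assume "\<not> G n x \<le> C"
    define c where "c = G n x / C"
    have c: "1 < c" using \<open>\<not> G n x \<le> C\<close> C_pos by (simp add: c_def)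
    have low: "c \<le> G n y" if "y \<in> K" for y
      using distortion[OF x that, of n] C_pos by (simp add: c_def field_simps)
    have n: "1 \<le> n" using low[OF x] c by (cases n) auto
    have pow: "c ^ k \<le> G (k * n) y" if "y \<in> K" for k y
      using that
    proof (induction k arbitrary: y)
      case (Suc k)
      have "c ^ k * G n y \<le> G (n + k * n) y" by (rule G_add_ge[OF Suc.IH Suc.prems])
      moreover have "c ^ k * c \<le> c ^ k * G n y" using c by (intro mult_left_mono low Suc.prems) auto
      ultimately show ?case by (simp add: mult.commute)
    qed simp
    define q where "q = root n c"
    have q: "q ^ n = c" "1 < q" using c n by (auto simp: q_def real_root_pow_pos2)
    have "(\<lambda>m. M m / q ^ m) \<longlonglongrightarrow> 0"
      using q r by (intro summable_LIMSEQ_zero summable_above_r) auto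
    from order_tendstoD(2)[OF this zero_less_one] obtain N where N: "\<And>m. N \<le> m \<Longrightarrow> M m / q ^ m < 1"
      unfolding eventually_sequentially by blast
    have "q ^ (N * n) = c ^ N" unfolding q(1)[symmetric] by (simp add: power_mult[symmetric] mult.commute)
    moreover have "c ^ N \<le> M (N * n)" using pow[OF x, of N] G_le_M[OF x, of "N * n"] by linarith
    moreover have "N \<le> N * n" using n by simp
    ultimately show False using N[of "N * n"] c by (simp add: divide_less_eq)
  qed
qed

end

section \<open>Bounded distortion\<close>

text \<open>The derivative of \<open>foldr s w\<close> at \<open>x\<close> by the chain rule, with \<open>d j\<close> in the place of the norm of the
  derivative of \<open>s j\<close>.\<close>

primrec word_weight :: "('i \<Rightarrow> 'a \<Rightarrow> 'a) \<Rightarrow> ('i \<Rightarrow> 'a \<Rightarrow> real) \<Rightarrow> 'i list \<Rightarrow> 'a \<Rightarrow> real" where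
  "word_weight s d [] x = 1"
| "word_weight s d (j # w) x = d j (foldr s w x) * word_weight s d w x"

text \<open>Two kinds of contraction are recorded: a global one on \<open>X\<close>, whose points may lie in different
  components of \<open>U\<close>, and a local one on balls around points of \<open>X\<close>, where the derivative controls
  distances by convexity. The powers of \<open>\<rho>\<close> in the Dini estimate start at \<open>\<rho> ^ 1\<close>, because the modulus may be
  infinite at scale 1; this is harmless since distances in \<open>X\<close> are at most \<open>\<rho>\<close>.\<close>

locale distortion_system =
  fixes X U :: "'a::euclidean_space set" and s :: "nat \<Rightarrow> 'a \<Rightarrow> 'a" and d :: "nat \<Rightarrow> 'a \<Rightarrow> real"
    and \<rho> \<delta> :: real and \<alpha> :: "nat \<Rightarrow> real"
  assumes X_compact: "compact X"
    and s_X: "x \<in> X \<Longrightarrow> s j x \<in> X" and s_inj: "inj_on (s j) X"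
    and ball_U: "x \<in> X \<Longrightarrow> ball x \<delta> \<subseteq> U"
    and \<delta>_pos: "0 < \<delta>" and \<delta>_le: "\<delta> \<le> \<rho>" and \<rho>_less: "\<rho> < 1"
    and contraction: "x \<in> X \<Longrightarrow> y \<in> X \<Longrightarrow> dist (s j x) (s j y) \<le> \<rho> * dist x y"
    and X_diam: "x \<in> X \<Longrightarrow> y \<in> X \<Longrightarrow> dist x y \<le> \<rho>"
    and local_Lipschitz: "x \<in> X \<Longrightarrow> r \<le> \<delta> \<Longrightarrow> (\<And>y. y \<in> ball x r \<Longrightarrow> d j y \<le> c) \<Longrightarrow>
        y \<in> ball x r \<Longrightarrow> z \<in> ball x r \<Longrightarrow> dist (s j y) (s j z) \<le> c * dist y z"
    and d_pos: "x \<in> U \<Longrightarrow> 0 < d j x" and d_le: "x \<in> U \<Longrightarrow> d j x \<le> \<rho>"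
    and \<alpha>_nonneg: "0 \<le> \<alpha> k" and \<alpha>_summable: "summable \<alpha>"
    and Dini: "x \<in> U \<Longrightarrow> y \<in> U \<Longrightarrow> dist x y \<le> \<rho> ^ Suc k \<Longrightarrow> \<bar>ln (d j x) - ln (d j y)\<bar> \<le> \<alpha> k"
begin

abbreviation D where "D \<equiv> word_weight s d"

definition C1 :: real where "C1 = exp (suminf \<alpha>)"

lemma \<rho>_pos: "0 < \<rho>" using \<delta>_pos \<delta>_le by simp

lemma X_U: "X \<subseteq> U" using ball_U \<delta>_pos by fastforce

lemma C1_ge: "exp (\<Sum>k<n. \<alpha> k) \<le> C1"
  unfolding C1_def by (simp add: sum_le_suminf \<alpha>_summable \<alpha>_nonneg)

lemma C1_ge_1: "1 \<le> C1" using C1_ge[of 0] by simp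

lemma foldr_in_X: "x \<in> X \<Longrightarrow> foldr s w x \<in> X"
  by (induction w) (auto intro: s_X)

lemma foldr_inj: "inj_on (foldr s w) X"
proof (induction w)
  case (Cons j w)
  show ?case
  proof (rule inj_onI)
    fix x y assume xy: "x \<in> X" "y \<in> X" "foldr s (j # w) x = foldr s (j # w) y"
    have "foldr s w x = foldr s w y"
      by (rule inj_onD[OF s_inj[of j]]) (use xy foldr_in_X in simp_all)
    then show "x = y" by (rule inj_onD[OF Cons.IH]) fact+
  qed
qed simp

lemma foldr_contraction:
  "x \<in> X \<Longrightarrow> y \<in> X \<Longrightarrow> dist (foldr s w x) (foldr s w y) \<le> \<rho> ^ length w * dist x y"
proof (induction w)
  case (Cons j w)
  have "dist (foldr s (j # w) x) (foldr s (j # w) y) \<le> \<rho> * dist (foldr s w x) (foldr s w y)"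
    using contraction foldr_in_X Cons.prems by simp
  also have "\<dots> \<le> \<rho> * (\<rho> ^ length w * dist x y)"
    using Cons \<rho>_pos by (intro mult_left_mono) auto
  finally show ?case by (simp add: mult_ac)
qed simp

lemma foldr_dist:
  assumes "x \<in> X" "y \<in> X" shows "dist (foldr s w x) (foldr s w y) \<le> \<rho> ^ Suc (length w)"
proof -
  have "\<rho> ^ length w * dist x y \<le> \<rho> ^ length w * \<rho>"
    using \<rho>_pos by (intro mult_left_mono X_diam assms) auto
  then show ?thesis using foldr_contraction[OF assms, of w] by (simp only: power_Suc2)
qed

lemma foldr_continuous: "continuous_on X (foldr s w)"
proof (rule continuous_onI)
  fix x and e :: real assume "x \<in> X" "0 < e"
  have "dist (foldr s w y) (foldr s w x) \<le> e" if "y \<in> X" "dist y x < e" for y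
  proof -
    have "\<rho> ^ length w * dist y x \<le> 1 * dist y x"
      using \<rho>_pos \<rho>_less by (intro mult_right_mono power_le_one) auto
    then show ?thesis using foldr_contraction[OF that(1) \<open>x \<in> X\<close>, of w] that(2) by linarith
  qed
  then show "\<exists>d>0. \<forall>x'\<in>X. dist x' x < d \<longrightarrow> dist (foldr s w x') (foldr s w x) \<le> e"
    using \<open>0 < e\<close> by blast
qed

lemma s_continuous: "continuous_on X (s j)"
  using foldr_continuous[of "[j]"] by simp

lemma D_pos: "x \<in> X \<Longrightarrow> 0 < D w x"
  by (induction w) (use X_U foldr_in_X d_pos in \<open>auto simp: subset_iff\<close>)

lemma D_le: "x \<in> X \<Longrightarrow> D w x \<le> \<rho> ^ length w"
proof (induction w)
  case (Cons j w)
  have "foldr s w x \<in> U" using X_U foldr_in_X[OF Cons.prems] by blast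
  then have "d j (foldr s w x) * D w x \<le> \<rho> * \<rho> ^ length w"
    using D_pos[OF Cons.prems, of w] \<rho>_pos by (intro mult_mono d_le Cons) auto
  then show ?case by simp
qed simp

lemma D_append: "D (v @ w) x = D v (foldr s w x) * D w x"
  by (induction v) auto

lemma d_ratio:
  assumes "x \<in> U" "y \<in> U" "dist x y \<le> \<rho> ^ Suc k"
  shows "d j x \<le> exp (\<alpha> k) * d j y"
proof -
  have "ln (d j x) \<le> \<alpha> k + ln (d j y)" using Dini[OF assms, of j] by linarith
  then have "exp (ln (d j x)) \<le> exp (\<alpha> k + ln (d j y))" by simp
  then show ?thesis using d_pos assms by (simp add: exp_add)
qed

lemma D_distortion_sum:
  "x \<in> X \<Longrightarrow> y \<in> X \<Longrightarrow> D w x \<le> exp (\<Sum>k<length w. \<alpha> k) * D w y"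
proof (induction w)
  case (Cons j w)
  have "foldr s w x \<in> U" "foldr s w y \<in> U" using X_U foldr_in_X Cons.prems by blast+
  then have "d j (foldr s w x) \<le> exp (\<alpha> (length w)) * d j (foldr s w y)" "0 < d j (foldr s w x)"
    using foldr_dist[OF Cons.prems, of w] by (auto intro!: d_ratio d_pos)
  then have "d j (foldr s w x) * D w x
      \<le> (exp (\<alpha> (length w)) * d j (foldr s w y)) * (exp (\<Sum>k<length w. \<alpha> k) * D w y)"
    using Cons D_pos[OF Cons.prems(1), of w] by (intro mult_mono) auto
  then show ?case by (simp add: exp_add mult_ac)
qed simp

lemma D_distortion: "x \<in> X \<Longrightarrow> y \<in> X \<Longrightarrow> D w x \<le> C1 * D w y"
  using D_distortion_sum[of x y w] mult_right_mono[OF C1_ge[of "length w"], of "D w y"] D_pos[of y w]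
  by linarith

text \<open>On a ball around a point of \<open>X\<close> the composition along a word is Lipschitz with its derivative
  at the centre as constant, up to \<open>C1\<close>: the image of the ball after \<open>k\<close> letters has radius at most
  \<open>\<rho> ^ k * \<delta>\<close>, so the \<open>k\<close>-th letter contributes an error factor \<open>exp (\<alpha> k)\<close>.\<close>

lemma foldr_ball_aux:
  assumes x: "x \<in> X"
  shows "y \<in> ball x \<delta> \<Longrightarrow> foldr s w y \<in> ball (foldr s w x) (\<rho> ^ length w * \<delta>)"
    and "y \<in> ball x \<delta> \<Longrightarrow> z \<in> ball x \<delta> \<Longrightarrow>
      dist (foldr s w y) (foldr s w z) \<le> exp (\<Sum>k<length w. \<alpha> k) * D w x * dist y z"
proof (induction w arbitrary: y z)
  case Nil
  { case 1 then show ?case by simp }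
  { case 2 then show ?case by simp }
next
  case (Cons j w)
  let ?p = "foldr s w x" and ?r = "\<rho> ^ length w * \<delta>"
  have p: "?p \<in> X" by (rule foldr_in_X[OF x])
  have "\<rho> ^ length w \<le> 1" using \<rho>_pos \<rho>_less by (intro power_le_one) auto
  then have r\<delta>: "?r \<le> \<delta>" using \<delta>_pos by simp
  have r: "?r \<le> \<rho> ^ Suc (length w)"
    using \<delta>_le \<rho>_pos by (simp add: mult.commute[of \<rho>] mult_left_mono)
  have r0: "0 < ?r" using \<rho>_pos \<delta>_pos by simp
  have sub: "ball ?p ?r \<subseteq> U" using ball_U[OF p] subset_ball[OF r\<delta>] by blast
  { case 1
    have "dist (s j ?p) (s j (foldr s w y)) \<le> \<rho> * dist ?p (foldr s w y)"
      using Cons.IH(1)[OF 1] r0 sub d_le by (intro local_Lipschitz[OF p r\<delta>]) auto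
    also have "\<dots> < \<rho> * ?r" using Cons.IH(1)[OF 1] \<rho>_pos by simp
    finally show ?case by (simp add: mult_ac) }
  { case 2
    have "dist (s j (foldr s w y)) (s j (foldr s w z))
        \<le> (exp (\<alpha> (length w)) * d j ?p) * dist (foldr s w y) (foldr s w z)"
    proof (rule local_Lipschitz[OF p r\<delta>])
      fix u assume "u \<in> ball ?p ?r"
      then show "d j u \<le> exp (\<alpha> (length w)) * d j ?p"
        using sub X_U p r by (intro d_ratio) (auto simp: dist_commute)
    next
      show "foldr s w y \<in> ball ?p ?r" "foldr s w z \<in> ball ?p ?r" using 2 by (simp_all only: Cons.IH(1))
    qed
    also have "\<dots> \<le> (exp (\<alpha> (length w)) * d j ?p) * (exp (\<Sum>k<length w. \<alpha> k) * D w x * dist y z)"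
      using d_pos[of ?p j] X_U p by (intro mult_left_mono[OF Cons.IH(2)[OF 2]]) auto
    finally show ?case by (simp add: exp_add mult_ac) }
qed

lemma foldr_ball:
  assumes "x \<in> X" "y \<in> ball x \<delta>" shows "foldr s w y \<in> ball (foldr s w x) \<delta>"
proof -
  have "\<rho> ^ length w * \<delta> \<le> \<delta>" using \<rho>_pos \<rho>_less \<delta>_pos by (simp add: power_le_one)
  then show ?thesis using foldr_ball_aux(1)[OF assms, of w] subset_ball by blast
qed

lemma foldr_Lipschitz:
  assumes "x \<in> X" "y \<in> ball x \<delta>" "z \<in> ball x \<delta>"
  shows "dist (foldr s w y) (foldr s w z) \<le> C1 * D w x * dist y z"
proof -
  have "exp (\<Sum>k<length w. \<alpha> k) * (D w x * dist y z) \<le> C1 * (D w x * dist y z)"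
    using D_pos[OF assms(1), of w] by (intro mult_right_mono C1_ge) auto
  then show ?thesis using foldr_ball_aux(2)[OF assms, of w] by (simp add: mult.assoc)
qed

text \<open>The same estimate for the sums of the \<open>a\<close>-th powers over all words of a given length. The first
  letter applied is the outermost summation, so the hypothesis on the distance improves by one
  power of \<open>\<rho>\<close> with each step of the induction.\<close>

lemma weight_sum_distortion:
  assumes a: "0 < a" and K: "K \<subseteq> X" "\<And>x j. x \<in> K \<Longrightarrow> s j x \<in> K"
    and summ: "\<And>x n. x \<in> K \<Longrightarrow> summable (\<lambda>j. d j x powr a * weight_sum s (\<lambda>j x. d j x powr a) n (s j x))"
    and nonneg: "\<And>x n. x \<in> K \<Longrightarrow> 0 \<le> weight_sum s (\<lambda>j x. d j x powr a) n x"
    and "x \<in> K" "y \<in> K"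
  shows "weight_sum s (\<lambda>j x. d j x powr a) n x \<le> C1 powr a * weight_sum s (\<lambda>j x. d j x powr a) n y"
proof -
  let ?G = "weight_sum s (\<lambda>j x. d j x powr a)"
  have main: "?G n x \<le> exp (a * (\<Sum>i<n. \<alpha> (k + i))) * ?G n y"
    if "x \<in> K" "y \<in> K" "dist x y \<le> \<rho> ^ Suc k" for n k x y
    using that
  proof (induction n arbitrary: x y k)
    case (Suc n)
    let ?e = "exp (a * (\<Sum>i<n. \<alpha> (Suc k + i)))"
    have "?G (Suc n) x \<le> (\<Sum>j. exp (a * \<alpha> k) * ?e * (d j y powr a * ?G n (s j y)))"
      unfolding weight_sum.simps
    proof (rule suminf_le)
      fix j
      have xy: "x \<in> X" "y \<in> X" using Suc.prems K by auto
      then have U: "x \<in> U" "y \<in> U" using X_U by auto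
      have "d j x powr a \<le> (exp (\<alpha> k) * d j y) powr a"
        using d_ratio[OF U Suc.prems(3)] d_pos[OF U(1), of j] a by (intro powr_mono2) auto
      also have "\<dots> = exp (a * \<alpha> k) * d j y powr a"
        using d_pos[OF U(2), of j] by (simp add: powr_mult exp_powr_real mult.commute)
      finally have 1: "d j x powr a \<le> exp (a * \<alpha> k) * d j y powr a" .
      have "dist (s j x) (s j y) \<le> \<rho> * \<rho> ^ Suc k"
        using contraction[OF xy, of j] Suc.prems(3) \<rho>_pos
        by (meson less_imp_le mult_left_mono order_trans)
      then have 2: "?G n (s j x) \<le> ?e * ?G n (s j y)"
        by (intro Suc.IH K(2) Suc.prems) simp
      have "d j x powr a * ?G n (s j x) \<le> (exp (a * \<alpha> k) * d j y powr a) * (?e * ?G n (s j y))"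
        using 1 2 nonneg[OF K(2)[OF Suc.prems(1)]] by (intro mult_mono) auto
      then show "d j x powr a * ?G n (s j x) \<le> exp (a * \<alpha> k) * ?e * (d j y powr a * ?G n (s j y))"
        by (simp add: mult_ac)
    qed (intro summable_mult summ Suc.prems)+
    also have "\<dots> = exp (a * \<alpha> k) * ?e * ?G (Suc n) y"
      by (simp add: suminf_mult summ Suc.prems)
    also have "exp (a * \<alpha> k) * ?e = exp (a * (\<Sum>i<Suc n. \<alpha> (k + i)))"
      by (simp only: sum.lessThan_Suc_shift) (simp add: exp_add[symmetric] distrib_left)
    finally show ?case .
  qed simp
  have "x \<in> X" "y \<in> X" using assms(6,7) K(1) by blast+
  then have "dist x y \<le> \<rho> ^ Suc 0" by (simp add: X_diam)
  from main[OF \<open>x \<in> K\<close> \<open>y \<in> K\<close> this]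
  have "?G n x \<le> exp (a * (\<Sum>i<n. \<alpha> i)) * ?G n y" by simp
  also have "exp (a * (\<Sum>i<n. \<alpha> i)) \<le> C1 powr a"
    using a sum_le_suminf[OF \<alpha>_summable, of "{..<n}"] \<alpha>_nonneg
    by (simp add: C1_def exp_powr_real mult.commute)
  finally show ?thesis using nonneg[OF \<open>y \<in> K\<close>, of n] by (simp add: mult_right_mono)
qed

end

section \<open>Hausdorff measure on the closure of the limit set\<close>

lemma cmult_liminf_le:
  fixes f :: "nat \<Rightarrow> ennreal"
  shows "c * liminf f \<le> liminf (\<lambda>n. c * f n)"
proof -
  have "c * liminf f = (SUP n. c * (INF m\<in>{n..}. f m))"
    by (simp add: liminf_SUP_INF SUP_mult_left_ennreal)
  also have "\<dots> \<le> (SUP n. INF m\<in>{n..}. c * f m)"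
    by (intro SUP_mono' INF_greatest mult_left_mono INF_lower) auto
  finally show ?thesis by (simp add: liminf_SUP_INF)
qed

lemma le_of_le_exp_mult:
  fixes y z :: ennreal
  assumes "e \<longlonglongrightarrow> (0::real)" "\<And>k. y \<le> ennreal (exp (e k)) * z"
  shows "y \<le> z"
proof -
  have "(\<lambda>k. ennreal (exp (e k))) \<longlonglongrightarrow> ennreal (exp 0)"
    by (rule tendsto_ennrealI[OF tendsto_exp[OF assms(1)]])
  then have "(\<lambda>k. ennreal (exp (e k)) * z) \<longlonglongrightarrow> ennreal (exp 0) * z"
    by (rule tendsto_mult_ennreal[OF _ tendsto_const]) simp
  then have "y \<le> ennreal (exp 0) * z"
    by (rule LIMSEQ_le_const) (use assms(2) in blast)
  then show ?thesis by simp
qed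

text \<open>The summable majorant \<open>b\<close> of the weights expresses that \<open>a\<close> exceeds the critical exponent.\<close>

locale hausdorff_system = distortion_system X U s d \<rho> \<delta> \<alpha>
  for X U :: "'a::euclidean_space set" and s d \<rho> \<delta> \<alpha> +
  fixes a :: real and J K :: "'a set" and b :: "nat \<Rightarrow> real"
  assumes a_pos: "0 < a" and K_def: "K = closure J" and J_ne: "J \<noteq> {}" and J_X: "J \<subseteq> X"
    and s_J: "x \<in> J \<Longrightarrow> s j x \<in> J" and J_sub: "J \<subseteq> (\<Union>j. s j ` J)"
    and d_cont: "continuous_on X (d j)"
    and d_dominated: "x \<in> U \<Longrightarrow> d j x powr a \<le> b j" and b_summable: "summable b"
    and radius: "spectral_radius_on K (\<lambda>f. restrict (\<lambda>x. \<Sum>j. of_real (d j x powr a) * f (s j x)) K) = 1"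
    and H_J: "hausdorff_measure a J = hausdorff_measure a K"
    and H_pos: "0 < hausdorff_measure a K"
begin

abbreviation g where "g \<equiv> \<lambda>j x. d j x powr a"
abbreviation G where "G \<equiv> weight_sum s g"

definition C :: real where "C = C1 powr a"

lemma C_pos: "0 < C" using C1_ge_1 by (simp add: C_def)

lemma K_X: "K \<subseteq> X"
  unfolding K_def using J_X X_compact by (simp add: closure_minimal compact_imp_closed)

lemma J_K: "J \<subseteq> K" unfolding K_def by (rule closure_subset)

lemma K_compact: "compact K"
  using X_compact K_X by (metis K_def closed_closure compact_Int_closed inf.absorb_iff2)

lemma K_closed: "closed K" by (simp add: K_def)

lemma s_K: "x \<in> K \<Longrightarrow> s j x \<in> K"
proof -
  have "continuous_on (closure J) (s j)"
    using s_continuous K_X unfolding K_def by (rule continuous_on_subset)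
  moreover have "s j ` J \<subseteq> closure J" using s_J J_K by (auto simp: K_def)
  ultimately have "s j ` closure J \<subseteq> closure J" by (intro image_closure_subset) auto
  then show "x \<in> K \<Longrightarrow> s j x \<in> K" by (auto simp: K_def)
qed

lemma d_pos_X: "x \<in> X \<Longrightarrow> 0 < d j x" using X_U d_pos by blast

lemma d_pos_K: "x \<in> K \<Longrightarrow> 0 < d j x" using K_X d_pos_X by blast

sublocale transfer: transfer_system K s g b
proof
  show "continuous_on K (s j)" for j by (rule continuous_on_subset[OF s_continuous K_X])
  show "continuous_on K (\<lambda>x. d j x powr a)" for j
    by (intro continuous_intros continuous_on_subset[OF d_cont K_X]) (metis d_pos_K less_irrefl)
  show "0 < d j x powr a" if "x \<in> K" for x j using d_pos_K[OF that, of j] by simp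
  show "d j x powr a \<le> b j" if "x \<in> K" for x j using that d_dominated K_X X_U by blast
qed (use K_compact J_ne J_K s_K b_summable in auto)

sublocale transfer: distorted_transfer_system K s g b C
  by unfold_locales
    (unfold C_def, rule weight_sum_distortion[OF a_pos K_X s_K transfer.G_summable transfer.G_nonneg])

lemma G_upper: "x \<in> K \<Longrightarrow> G n x \<le> C" and G_lower: "x \<in> K \<Longrightarrow> 1 / C \<le> G n x"
  using transfer.weight_sum_bounds[unfolded transfer.T_def[abs_def], OF radius] by auto

lemma foldr_in_K: "x \<in> K \<Longrightarrow> foldr s w x \<in> K"
  by (induction w) (auto intro: s_K)

lemma foldr_in_J: "x \<in> J \<Longrightarrow> foldr s w x \<in> J"
  by (induction w) (auto intro: s_J)

lemma D_continuous: "continuous_on X (D w)"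
proof (induction w)
  case (Cons j w)
  have "continuous_on X (\<lambda>x. d j (foldr s w x))"
    by (rule continuous_on_compose2[OF d_cont foldr_continuous]) (use foldr_in_X in auto)
  then show ?case using Cons by (auto intro: continuous_intros)
qed auto

lemma G_Suc_ennreal:
  assumes "x \<in> K"
  shows "(\<Sum>j. ennreal (g j x) * ennreal (G n (s j x))) = ennreal (G (Suc n) x)"
proof -
  have "(\<Sum>j. ennreal (g j x) * ennreal (G n (s j x))) = (\<Sum>j. ennreal (g j x * G n (s j x)))"
    by (intro suminf_cong ennreal_mult[symmetric] transfer.G_nonneg s_K assms) simp
  also have "\<dots> = ennreal (\<Sum>j. g j x * G n (s j x))"
    by (intro suminf_ennreal2 transfer.G_summable mult_nonneg_nonneg transfer.G_nonneg s_K assms) simp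
  finally show ?thesis by (simp only: weight_sum.simps)
qed

text \<open>The recursion of \<open>weight_sum\<close> splits off the map that is applied first, which is the last letter of
  the word.\<close>

lemma sum_words_eq:
  assumes "x \<in> K"
  shows "(\<integral>\<^sup>+w. ennreal (D w x powr a) \<partial>count_space {w. length w = n}) = ennreal (G n x)"
  using assms
proof (induction n arbitrary: x)
  case 0
  have "{w :: nat list. length w = 0} = {[]}" by auto
  then show ?case by (simp add: nn_integral_count_space_finite)
next
  case (Suc n)
  let ?h = "\<lambda>p :: nat \<times> nat list. ennreal (D (snd p @ [fst p]) x powr a) * indicator {w. length w = n} (snd p)"
  let ?P = "{p :: nat \<times> nat list. length (snd p) = n}"
  have bij: "bij_betw (\<lambda>p. snd p @ [fst p]) ?P {w. length w = Suc n}"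
  proof (rule bij_betw_byWitness[where f' = "\<lambda>w. (last w, butlast w)"])
    show "\<forall>w\<in>{w. length w = Suc n}. snd (last w, butlast w) @ [fst (last w, butlast w)] = w"
      by (auto intro: append_butlast_last_id)
  qed auto
  have x: "x \<in> X" "\<And>j. s j x \<in> X" using Suc.prems K_X s_K by auto
  have "ennreal (G (Suc n) x) = (\<integral>\<^sup>+j. ennreal (g j x) * ennreal (G n (s j x)) \<partial>count_space UNIV)"
    unfolding nn_integral_count_space_nat by (rule G_Suc_ennreal[OF Suc.prems, symmetric])
  also have "\<dots> = (\<integral>\<^sup>+j. \<integral>\<^sup>+w. ?h (j, w) \<partial>count_space UNIV \<partial>count_space UNIV)"
  proof (rule nn_integral_cong)
    fix j :: nat
    have "ennreal (g j x) * ennreal (G n (s j x))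
        = (\<integral>\<^sup>+w. ennreal (g j x) * ennreal (D w (s j x) powr a) \<partial>count_space {w. length w = n})"
      by (simp add: Suc.IH[OF s_K[OF Suc.prems], symmetric] nn_integral_cmult)
    also have "\<dots> = (\<integral>\<^sup>+w. ennreal (D (w @ [j]) x powr a) \<partial>count_space {w. length w = n})"
      using D_pos[OF x(2)[of j]] d_pos_X[OF x(1), of j]
      by (intro nn_integral_cong) (simp add: D_append powr_mult ennreal_mult[symmetric] mult.commute less_imp_le)
    finally show "ennreal (g j x) * ennreal (G n (s j x)) = (\<integral>\<^sup>+w. ?h (j, w) \<partial>count_space UNIV)"
      by (simp add: nn_integral_count_space_indicator)
  qed
  also have "\<dots> = (\<integral>\<^sup>+p. ?h p \<partial>count_space UNIV)"
    by (rule nn_integral_fst_count_space)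
  also have "\<dots> = (\<integral>\<^sup>+p. ennreal (D (snd p @ [fst p]) x powr a) \<partial>count_space ?P)"
    by (subst nn_integral_count_space_indicator) (auto intro!: nn_integral_cong split: split_indicator)
  also have "\<dots> = (\<integral>\<^sup>+w. ennreal (D w x powr a) \<partial>count_space {w. length w = Suc n})"
    by (rule nn_integral_bij_count_space[OF bij])
  finally show ?case by simp
qed

subsection \<open>Covers by images of small sets\<close>

text \<open>Images under all words of length \<open>n\<close> of a set of small diameter form covers that are fine for
  large \<open>n\<close>, while the sum of the \<open>a\<close>-th powers of their diameters stays bounded with \<open>n\<close>.\<close>

lemma premeasure_word_images:
  assumes x: "x \<in> K" and E: "E \<subseteq> ball x \<delta>" and \<eta>: "0 < \<eta>"
  shows "\<forall>\<^sub>F n in sequentially. hausdorff_premeasure a \<eta> (\<Union>w\<in>{w. length w = n}. foldr s w ` E)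
    \<le> ennreal ((C1 * diameter E) powr a * C)"
proof -
  have xX: "x \<in> X" using x K_X by blast
  have bE: "bounded E" using E bounded_subset bounded_ball by blast
  have dE: "0 \<le> diameter E" by (rule diameter_ge_0[OF bE])
  have dist_le: "dist (foldr s w y) (foldr s w z) \<le> C1 * D w x * diameter E" if "y \<in> E" "z \<in> E" for w y z
  proof -
    have "dist (foldr s w y) (foldr s w z) \<le> C1 * D w x * dist y z"
      using that E xX by (intro foldr_Lipschitz) auto
    also have "\<dots> \<le> C1 * D w x * diameter E"
      using C1_ge_1 D_pos[OF xX, of w] diameter_bounded_bound[OF bE that] by (intro mult_left_mono) auto
    finally show ?thesis .
  qed
  have diam: "diameter (foldr s w ` E) \<le> C1 * D w x * diameter E" for w
  proof (rule diameter_le)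
    show "foldr s w ` E \<noteq> {} \<or> 0 \<le> C1 * D w x * diameter E"
      using C1_ge_1 D_pos[OF xX, of w] dE by simp
  qed (use dist_le in \<open>auto simp: dist_norm\<close>)
  have bd: "bounded (foldr s w ` E)" for w
    using dist_le unfolding bounded_two_points by blast
  have "(\<lambda>n. C1 * \<rho> ^ n * diameter E) \<longlonglongrightarrow> C1 * 0 * diameter E"
    using \<rho>_pos \<rho>_less by (intro tendsto_intros LIMSEQ_power_zero) auto
  then have "\<forall>\<^sub>F n in sequentially. C1 * \<rho> ^ n * diameter E < \<eta>"
    using \<eta> by (intro order_tendstoD) auto
  then show ?thesis
  proof (rule eventually_mono)
    fix n assume n: "C1 * \<rho> ^ n * diameter E < \<eta>"
    let ?W = "{w :: nat list. length w = n}"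
    have "hausdorff_premeasure a \<eta> (\<Union>w\<in>?W. foldr s w ` E)
        \<le> (\<integral>\<^sup>+w. hausdorff_premeasure a \<eta> (foldr s w ` E) \<partial>count_space ?W)"
      using \<eta> by (intro hausdorff_premeasure_countable_UN) auto
    also have "\<dots> \<le> (\<integral>\<^sup>+w. ennreal ((C1 * diameter E) powr a) * ennreal (D w x powr a) \<partial>count_space ?W)"
    proof (rule nn_integral_mono)
      fix w assume "w \<in> space (count_space ?W)"
      then have w: "length w = n" by simp
      have "C1 * D w x * diameter E \<le> C1 * \<rho> ^ n * diameter E"
        using D_le[OF xX, of w] w C1_ge_1 dE by (intro mult_right_mono mult_left_mono) auto
      then have "diameter (foldr s w ` E) \<le> \<eta>" using diam[of w] n by linarith
      then have "hausdorff_premeasure a \<eta> (foldr s w ` E) \<le> ennreal (diameter (foldr s w ` E) powr a)"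
        using bd \<eta> by (intro hausdorff_premeasure_le_diameter) auto
      also have "\<dots> \<le> ennreal ((C1 * D w x * diameter E) powr a)"
        using a_pos diam[of w] diameter_ge_0[OF bd] by (intro ennreal_leI powr_mono2) auto
      also have "\<dots> = ennreal ((C1 * diameter E) powr a * D w x powr a)"
        using C1_ge_1 D_pos[OF xX, of w] dE by (simp add: powr_mult mult_ac)
      finally show "hausdorff_premeasure a \<eta> (foldr s w ` E)
          \<le> ennreal ((C1 * diameter E) powr a) * ennreal (D w x powr a)"
        by (simp add: ennreal_mult)
    qed
    also have "\<dots> = ennreal ((C1 * diameter E) powr a) * ennreal (G n x)"
      by (simp add: nn_integral_cmult sum_words_eq[OF x])
    also have "\<dots> \<le> ennreal ((C1 * diameter E) powr a * C)"
      using G_upper[OF x, of n] transfer.G_nonneg[OF x]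
      by (simp add: ennreal_mult[symmetric] ennreal_leI mult_left_mono)
    finally show "hausdorff_premeasure a \<eta> (\<Union>w\<in>?W. foldr s w ` E) \<le> ennreal ((C1 * diameter E) powr a * C)" .
  qed
qed

lemma J_words: "J \<subseteq> (\<Union>w\<in>{w. length w = n}. foldr s w ` J)"
proof (induction n)
  case (Suc n)
  show ?case
  proof
    fix x assume "x \<in> J"
    then obtain j y where y: "y \<in> J" "x = s j y" using J_sub by blast
    then obtain w z where "length w = n" "z \<in> J" "y = foldr s w z" using Suc by blast
    then have "length (j # w) = Suc n" "x = foldr s (j # w) z" "z \<in> J" using y by auto
    then show "x \<in> (\<Union>w\<in>{w. length w = Suc n}. foldr s w ` J)" by blast
  qed
qed (auto intro: UN_I[of "[]"])

lemma finite_centres: "\<exists>F. finite F \<and> F \<subseteq> J \<and> K \<subseteq> (\<Union>c\<in>F. ball c \<delta>)"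
proof -
  have "K \<subseteq> (\<Union>c\<in>J. ball c \<delta>)"
  proof
    fix x assume "x \<in> K"
    then obtain c where "c \<in> J" "dist c x < \<delta>"
      using \<delta>_pos unfolding K_def closure_approachable by blast
    then show "x \<in> (\<Union>c\<in>J. ball c \<delta>)" by auto
  qed
  then obtain F where "F \<subseteq> J" "finite F" "K \<subseteq> (\<Union>c\<in>F. ball c \<delta>)"
    by (rule compactE_image[OF K_compact open_ball])
  then show ?thesis by blast
qed

text \<open>Covers of \<open>J\<close> by the images of finitely many small balls, under all words of a large length; the
  equality of the measures of \<open>J\<close> and \<open>K\<close> transfers the bound to \<open>K\<close>.\<close>

lemma H_finite: "hausdorff_measure a K < \<infinity>"
proof -
  obtain F where F: "finite F" "F \<subseteq> J" "K \<subseteq> (\<Union>c\<in>F. ball c \<delta>)" using finite_centres by blast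
  let ?E = "\<lambda>c. J \<inter> ball c \<delta>"
  let ?B = "\<Sum>c\<in>F. ennreal ((C1 * diameter (?E c)) powr a * C)"
  have "hausdorff_measure a J \<le> ?B"
  proof (rule hausdorff_measure_leI)
    fix \<eta> :: real assume \<eta>: "0 < \<eta>"
    let ?A = "\<lambda>n c. \<Union>w\<in>{w. length w = n}. foldr s w ` ?E c"
    have "\<forall>\<^sub>F n in sequentially. \<forall>c\<in>F. hausdorff_premeasure a \<eta> (?A n c) \<le> ennreal ((C1 * diameter (?E c)) powr a * C)"
      using F J_K by (intro eventually_ball_finite ballI premeasure_word_images \<eta>) auto
    then obtain n where n: "\<And>c. c \<in> F \<Longrightarrow> hausdorff_premeasure a \<eta> (?A n c) \<le> ennreal ((C1 * diameter (?E c)) powr a * C)"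
      unfolding eventually_sequentially by blast
    have "J \<subseteq> (\<Union>c\<in>F. ?A n c)"
    proof
      fix x assume "x \<in> J"
      then obtain w y where w: "length w = n" "y \<in> J" "x = foldr s w y" using J_words by blast
      then obtain c where "c \<in> F" "y \<in> ball c \<delta>" using F(3) J_K by blast
      with w show "x \<in> (\<Union>c\<in>F. ?A n c)" by blast
    qed
    then have "hausdorff_premeasure a \<eta> J \<le> hausdorff_premeasure a \<eta> (\<Union>c\<in>F. ?A n c)"
      by (rule hausdorff_premeasure_mono)
    also have "\<dots> \<le> (\<Sum>c\<in>F. hausdorff_premeasure a \<eta> (?A n c))"
      using hausdorff_premeasure_countable_UN[of F \<eta> a "?A n"] F(1) \<eta>
      by (simp add: countable_finite nn_integral_count_space_finite)
    also have "\<dots> \<le> ?B" by (intro sum_mono n)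
    finally show "hausdorff_premeasure a \<eta> J \<le> ?B" .
  qed
  also have "?B < \<infinity>" using F(1) by (auto simp: less_top[symmetric])
  finally show ?thesis by (simp add: H_J)
qed

subsection \<open>The measure and its transformation under the maps\<close>

definition M :: "'a measure" where "M = restrict_space (hausdorff_borel a) K"

lemma space_M: "space M = K"
  by (simp add: M_def space_restrict_space space_hausdorff_borel)

lemma sets_M_eq: "sets M = sets (restrict_space borel K)"
  unfolding M_def by (rule sets_restrict_space_cong) (rule sets_hausdorff_borel)

lemma sets_M_iff: "A \<in> sets M \<longleftrightarrow> A \<in> sets borel \<and> A \<subseteq> K"
  unfolding sets_M_eq using K_closed by (auto simp: sets_restrict_space_iff)

lemma emeasure_M: "A \<in> sets M \<Longrightarrow> emeasure M A = hausdorff_measure a A"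
  unfolding M_def using K_closed
  by (subst emeasure_restrict_space)
     (auto simp: sets_hausdorff_borel space_hausdorff_borel sets_M_iff[unfolded M_def] emeasure_hausdorff_borel)

lemma K_sets: "K \<in> sets M" using space_M sets.top by metis

lemma closed_sets_M: "closed A \<Longrightarrow> A \<subseteq> K \<Longrightarrow> A \<in> sets M" by (simp add: sets_M_iff)

lemma M_K_finite: "emeasure M K < \<infinity>" using H_finite by (simp add: emeasure_M K_sets)

lemma M_K_pos: "0 < emeasure M K" using H_pos by (simp add: emeasure_M K_sets)

sublocale M: finite_measure M
  by standard (use M_K_finite in \<open>simp add: space_M\<close>)

lemma measurable_continuous: "continuous_on K f \<Longrightarrow> f \<in> borel_measurable M"
  for f :: "'a \<Rightarrow> 'b::topological_space"
  unfolding measurable_cong_sets[OF sets_M_eq refl] by (rule borel_measurable_continuous_on_restrict)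

lemma measurable_foldr [measurable]: "foldr s w \<in> M \<rightarrow>\<^sub>M M"
proof -
  have "foldr s w \<in> M \<rightarrow>\<^sub>M restrict_space borel K"
    using measurable_continuous[OF continuous_on_subset[OF foldr_continuous K_X]] foldr_in_K
    by (intro measurable_restrict_space2) (auto simp: space_M)
  then show ?thesis by (simp add: measurable_cong_sets[OF refl sets_M_eq])
qed

lemma measurable_s [measurable]: "s j \<in> M \<rightarrow>\<^sub>M M"
  using measurable_foldr[of "[j]"] by simp

lemma measurable_D [measurable]: "D w \<in> borel_measurable M"
  by (rule measurable_continuous[OF continuous_on_subset[OF D_continuous K_X]])

lemma measurable_d [measurable]: "d j \<in> borel_measurable M"
  by (rule measurable_continuous[OF continuous_on_subset[OF d_cont K_X]])

lemma measurable_G [measurable]: "G n \<in> borel_measurable M"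
  by (rule measurable_continuous[OF transfer.G_continuous])

lemma closed_image: "closed E \<Longrightarrow> E \<subseteq> K \<Longrightarrow> closed (foldr s w ` E)"
  using compact_continuous_image[OF continuous_on_subset[OF foldr_continuous[of w]], of E] K_X
    compact_Int_closed[OF K_compact, of E]
  by (metis compact_imp_closed dual_order.trans inf.absorb_iff2)

lemma image_sets_M: "closed E \<Longrightarrow> E \<subseteq> K \<Longrightarrow> foldr s w ` E \<in> sets M"
  using closed_image foldr_in_K by (intro closed_sets_M) auto

lemma s_image_sets_M: "s j ` K \<in> sets M"
  using image_sets_M[OF K_closed order_refl, of "[j]"] by simp

text \<open>The first-level images of \<open>K\<close> cover \<open>J\<close>, which has the full finite measure of \<open>K\<close>.\<close>

lemma AE_covered: "AE x in M. \<exists>j. x \<in> s j ` K"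
proof -
  let ?V = "\<Union>j. s j ` K"
  have V: "?V \<in> sets M" using s_image_sets_M by auto
  have "emeasure M K \<le> emeasure M ?V"
    using hausdorff_measure_mono[of J ?V a] J_sub J_K H_J
    by (fastforce simp: emeasure_M K_sets V)
  then have "emeasure M (K - ?V) = 0"
    using V s_K M_K_finite by (subst emeasure_Diff) (auto simp: K_sets diff_eq_0_iff_ennreal)
  then have "K - ?V \<in> null_sets M" using V K_sets by auto
  then show ?thesis by (rule AE_I') (auto simp: space_M)
qed

text \<open>On a ball of radius comparable to \<open>\<rho> ^ k\<close> the weight is constant up to the factor \<open>exp (\<alpha> k)\<close>. The
  factor occurs twice: in the Lipschitz constant, and when the centre is replaced by the points of
  \<open>E\<close>.\<close>

lemma H_image_small:
  assumes E: "E \<in> sets M" "E \<subseteq> ball x (\<rho> ^ Suc k * \<delta>)" and x: "x \<in> K"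
  shows "hausdorff_measure a (s j ` E)
    \<le> ennreal (exp (2 * a * \<alpha> k)) * (\<integral>\<^sup>+y\<in>E. ennreal (g j y) \<partial>M)"
proof -
  note [measurable] = E(1)
  have xX: "x \<in> X" and xU: "x \<in> U" using x K_X X_U by auto
  let ?r = "\<rho> ^ Suc k * \<delta>"
  have r\<delta>: "?r \<le> \<delta>" using \<rho>_pos \<rho>_less \<delta>_pos power_le_one[of \<rho> "Suc k"] by (simp del: power_Suc)
  have r: "?r \<le> \<rho> ^ Suc k" using \<rho>_pos \<rho>_less \<delta>_le by (simp add: mult_left_le)
  have U: "y \<in> U" "dist x y \<le> \<rho> ^ Suc k" if "y \<in> ball x ?r" for y
  proof -
    have "y \<in> ball x \<delta>" using that subset_ball[OF r\<delta>] by blast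
    then show "y \<in> U" using ball_U[OF xX] by blast
    show "dist x y \<le> \<rho> ^ Suc k" using that r by (simp del: power_Suc)
  qed
  let ?L = "exp (\<alpha> k) * d j x"
  have L: "0 < ?L" using d_pos[OF xU] by simp
  have "hausdorff_measure a (s j ` E) \<le> ennreal (?L powr a) * hausdorff_measure a E"
  proof (rule hausdorff_measure_Lipschitz_image[OF L a_pos])
    fix y z assume "y \<in> E" "z \<in> E"
    then show "dist (s j y) (s j z) \<le> ?L * dist y z"
      using E(2) U xU by (intro local_Lipschitz[OF xX r\<delta>] d_ratio) (auto simp: dist_commute)
  qed
  also have "\<dots> = (\<integral>\<^sup>+y\<in>E. ennreal (?L powr a) \<partial>M)"
    using E(1) by (simp add: emeasure_M nn_integral_cmult_indicator)
  also have "\<dots> \<le> (\<integral>\<^sup>+y. ennreal (exp (2 * a * \<alpha> k)) * (ennreal (g j y) * indicator E y) \<partial>M)"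
  proof (rule nn_integral_mono)
    fix y assume "y \<in> space M"
    show "ennreal (?L powr a) * indicator E y \<le> ennreal (exp (2 * a * \<alpha> k)) * (ennreal (g j y) * indicator E y)"
    proof (cases "y \<in> E")
      case True
      then have yU: "y \<in> U" "dist x y \<le> \<rho> ^ Suc k" using E(2) U by auto
      have "?L \<le> exp (2 * \<alpha> k) * d j y"
        using mult_left_mono[OF d_ratio[OF xU yU], of "exp (\<alpha> k)" j]
        by (simp add: mult.assoc[symmetric] exp_add[symmetric])
      then have "?L powr a \<le> (exp (2 * \<alpha> k) * d j y) powr a"
        using L a_pos by (intro powr_mono2) auto
      also have "\<dots> = exp (2 * a * \<alpha> k) * g j y"
        using d_pos[OF yU(1), of j] by (simp add: powr_mult exp_powr_real mult_ac)
      finally show ?thesis using True by (simp add: ennreal_mult[symmetric] ennreal_leI)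
    qed simp
  qed
  also have "\<dots> = ennreal (exp (2 * a * \<alpha> k)) * (\<integral>\<^sup>+y\<in>E. ennreal (g j y) \<partial>M)"
    using E(1) by (intro nn_integral_cmult) measurable
  finally show ?thesis .
qed

text \<open>Decomposing \<open>E\<close> into finitely many pieces in balls of radius \<open>\<rho> ^ Suc k * \<delta>\<close> and letting \<open>k\<close> tend to
  infinity removes the error factor.\<close>

lemma H_image_le:
  assumes E: "E \<in> sets M"
  shows "hausdorff_measure a (s j ` E) \<le> (\<integral>\<^sup>+y\<in>E. ennreal (g j y) \<partial>M)"
proof -
  let ?I = "\<lambda>E. \<integral>\<^sup>+y\<in>E. ennreal (g j y) \<partial>M"
  have step: "hausdorff_measure a (s j ` E) \<le> ennreal (exp (2 * a * \<alpha> k)) * ?I E" for k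
  proof -
    let ?B = "\<lambda>x. ball x (\<rho> ^ Suc k * \<delta>)" and ?c = "ennreal (exp (2 * a * \<alpha> k))"
    have "K \<subseteq> (\<Union>x\<in>K. ?B x)" using \<rho>_pos \<delta>_pos by auto
    then obtain F where F: "F \<subseteq> K" "finite F" "K \<subseteq> (\<Union>x\<in>F. ?B x)"
      by (rule compactE_image[OF K_compact open_ball])
    have "hausdorff_measure a (s j ` (E \<inter> (\<Union>x\<in>F. ?B x))) \<le> ?c * ?I (E \<inter> (\<Union>x\<in>F. ?B x))"
      using F(2,1)
    proof (induction F)
      case empty then show ?case by (simp add: hausdorff_measure_empty)
    next
      case (insert x F)
      define V W where "V = E \<inter> (\<Union>x\<in>F. ?B x)" and "W = (E \<inter> ?B x) - (\<Union>x\<in>F. ?B x)"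
      have "(\<Union>x\<in>F. ?B x) \<in> sets borel" "?B x \<in> sets borel" by (intro borel_open; auto)+
      then have sets [measurable]: "V \<in> sets M" "W \<in> sets M"
        using E by (auto simp: sets_M_iff V_def W_def intro!: sets.Int sets.Diff)
      have eq: "E \<inter> (\<Union>x\<in>insert x F. ?B x) = V \<union> W" "V \<inter> W = {}" by (auto simp: V_def W_def)
      have "hausdorff_measure a (s j ` (V \<union> W)) \<le> hausdorff_measure a (s j ` V) + hausdorff_measure a (s j ` W)"
        unfolding image_Un by (rule hausdorff_measure_Un)
      also have "\<dots> \<le> ?c * ?I V + ?c * ?I W"
      proof (rule add_mono)
        show "hausdorff_measure a (s j ` V) \<le> ?c * ?I V" using insert unfolding V_def by blast
        show "hausdorff_measure a (s j ` W) \<le> ?c * ?I W"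
          using insert.prems by (intro H_image_small[of _ x] sets) (auto simp: W_def)
      qed
      also have "\<dots> = ?c * (?I V + ?I W)" by (rule distrib_left[symmetric])
      also have "?I V + ?I W = (\<integral>\<^sup>+y. ennreal (g j y) * indicator V y + ennreal (g j y) * indicator W y \<partial>M)"
        by (intro nn_integral_add[symmetric]) measurable
      also have "\<dots> = ?I (V \<union> W)"
        using eq(2) by (intro nn_integral_cong) (auto split: split_indicator)
      finally show ?case unfolding eq(1) .
    qed
    moreover have "E \<subseteq> K" using E by (simp add: sets_M_iff)
    then have "E \<inter> (\<Union>x\<in>F. ?B x) = E" using F(3) by (intro Int_absorb2) (rule order_trans)
    ultimately show ?thesis by (simp only:)
  qed
  have "(\<lambda>k. 2 * a * \<alpha> k) \<longlonglongrightarrow> 0"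
    by (rule tendsto_mult_right_zero[OF summable_LIMSEQ_zero[OF \<alpha>_summable]])
  then show ?thesis by (rule le_of_le_exp_mult) (rule step)
qed

subsection \<open>Almost disjoint images and change of variables\<close>

text \<open>Pulling \<open>P j\<close> back along \<open>s j\<close> gives the measures of images under \<open>s j\<close>, while \<open>Q j\<close> corresponds to
  integrating the weight. The estimate \<open>P j \<le> Q j\<close> is the Lipschitz bound for images; that it is an
  equality is the exact change of variables.\<close>

definition P :: "nat \<Rightarrow> 'a measure" where "P j = density M (indicator (s j ` K))"
definition Q :: "nat \<Rightarrow> 'a measure" where "Q j = distr (density M (\<lambda>x. ennreal (g j x))) M (s j)"

lemma sets_P [measurable_cong, simp]: "sets (P j) = sets M"
  and sets_Q [measurable_cong, simp]: "sets (Q j) = sets M"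
  and space_P [simp]: "space (P j) = K" and space_Q [simp]: "space (Q j) = K"
  by (simp_all add: P_def Q_def space_M)

lemma nn_integral_P:
  assumes "f \<in> borel_measurable M"
  shows "(\<integral>\<^sup>+x. f x \<partial>P j) = (\<integral>\<^sup>+x. f x * indicator (s j ` K) x \<partial>M)"
  unfolding P_def using assms s_image_sets_M
  by (subst nn_integral_density) (auto simp: mult.commute)

lemma nn_integral_Q:
  assumes [measurable]: "f \<in> borel_measurable M"
  shows "(\<integral>\<^sup>+x. f x \<partial>Q j) = (\<integral>\<^sup>+x. ennreal (g j x) * f (s j x) \<partial>M)"
  unfolding Q_def by (subst nn_integral_distr) (simp_all add: nn_integral_density)

lemma P_le_Q: "P j \<le> Q j"
proof (subst le_measure)
  show "\<forall>B\<in>sets (P j). emeasure (P j) B \<le> emeasure (Q j) B"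
  proof
    fix B assume "B \<in> sets (P j)"
    then have B [measurable]: "B \<in> sets M" by simp
    let ?E = "s j -` B \<inter> space M"
    have E: "?E \<in> sets M" by measurable
    have "emeasure (P j) B = (\<integral>\<^sup>+x. indicator B x \<partial>P j)" by simp
    also have "\<dots> = (\<integral>\<^sup>+x. indicator (s j ` K \<inter> B) x \<partial>M)"
      by (subst nn_integral_P) (auto intro!: nn_integral_cong split: split_indicator)
    also have "\<dots> = hausdorff_measure a (s j ` K \<inter> B)"
      using s_image_sets_M[of j] by (simp add: emeasure_M)
    also have "s j ` K \<inter> B = s j ` ?E" by (auto simp: space_M)
    also have "hausdorff_measure a (s j ` ?E) \<le> (\<integral>\<^sup>+x\<in>?E. ennreal (g j x) \<partial>M)"
      by (rule H_image_le[OF E])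
    also have "\<dots> = (\<integral>\<^sup>+x. ennreal (g j x) * indicator B (s j x) \<partial>M)"
      by (intro nn_integral_cong) (auto split: split_indicator)
    also have "\<dots> = (\<integral>\<^sup>+x. indicator B x \<partial>Q j)" by (subst nn_integral_Q) auto
    also have "\<dots> = emeasure (Q j) B" by simp
    finally show "emeasure (P j) B \<le> emeasure (Q j) B" .
  qed
qed simp

text \<open>A substitute for a positive eigenfunction of the transfer operator: by Fatou's lemma, the operator
  does not increase the lower limit of its iterates at the constant 1.\<close>

definition h :: "'a \<Rightarrow> ennreal" where "h x = liminf (\<lambda>n. ennreal (G n x))"

lemma measurable_h [measurable]: "h \<in> borel_measurable M"
  unfolding h_def by measurable

lemma h_lower: "x \<in> K \<Longrightarrow> ennreal (1 / C) \<le> h x"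
  unfolding h_def by (intro Liminf_bounded always_eventually allI ennreal_leI G_lower)

lemma h_upper: "x \<in> K \<Longrightarrow> h x \<le> ennreal C"
proof -
  assume x: "x \<in> K"
  have "h x \<le> limsup (\<lambda>n. ennreal (G n x))" unfolding h_def by (rule Liminf_le_Limsup) simp
  also have "\<dots> \<le> ennreal C" by (intro Limsup_bounded always_eventually allI ennreal_leI G_upper x)
  finally show ?thesis .
qed

lemma h_superharmonic:
  assumes x: "x \<in> K" shows "(\<Sum>j. ennreal (g j x) * h (s j x)) \<le> h x"
proof -
  have "(\<Sum>j. ennreal (g j x) * h (s j x)) = (\<integral>\<^sup>+j. ennreal (g j x) * h (s j x) \<partial>count_space UNIV)"
    by (simp add: nn_integral_count_space_nat)
  also have "\<dots> \<le> (\<integral>\<^sup>+j. liminf (\<lambda>n. ennreal (g j x) * ennreal (G n (s j x))) \<partial>count_space UNIV)"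
    unfolding h_def by (intro nn_integral_mono cmult_liminf_le)
  also have "\<dots> \<le> liminf (\<lambda>n. \<integral>\<^sup>+j. ennreal (g j x) * ennreal (G n (s j x)) \<partial>count_space UNIV)"
    by (rule nn_integral_liminf) simp
  also have "(\<lambda>n. \<integral>\<^sup>+j. ennreal (g j x) * ennreal (G n (s j x)) \<partial>count_space UNIV) = (\<lambda>n. ennreal (G (n + 1) x))"
  proof
    fix n
    show "(\<integral>\<^sup>+j. ennreal (g j x) * ennreal (G n (s j x)) \<partial>count_space UNIV) = ennreal (G (n + 1) x)"
      unfolding nn_integral_count_space_nat Suc_eq_plus1[symmetric] by (rule G_Suc_ennreal[OF x])
  qed
  also have "liminf (\<lambda>n. ennreal (G (n + 1) x)) = h x"
    unfolding h_def by (rule liminf_shift)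
  finally show ?thesis .
qed

lemma h_integral_finite: "(\<integral>\<^sup>+x. h x \<partial>M) < \<infinity>"
proof -
  have "(\<integral>\<^sup>+x. h x \<partial>M) \<le> (\<integral>\<^sup>+x. ennreal C \<partial>M)"
    by (intro nn_integral_mono h_upper) (simp add: space_M)
  also have "\<dots> < \<infinity>" using M_K_finite by (simp add: space_M ennreal_mult_less_top)
  finally show ?thesis .
qed

lemma sum_Q_le: "(\<Sum>j. \<integral>\<^sup>+x. h x \<partial>Q j) \<le> (\<integral>\<^sup>+x. h x \<partial>M)"
proof -
  have "(\<Sum>j. \<integral>\<^sup>+x. h x \<partial>Q j) = (\<integral>\<^sup>+x. (\<Sum>j. ennreal (g j x) * h (s j x)) \<partial>M)"
    by (simp add: nn_integral_Q nn_integral_suminf)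
  also have "\<dots> \<le> (\<integral>\<^sup>+x. h x \<partial>M)"
    by (intro nn_integral_mono h_superharmonic) (simp add: space_M)
  finally show ?thesis .
qed

lemma sum_P_eq: "(\<Sum>j. \<integral>\<^sup>+x. h x \<partial>P j) = (\<integral>\<^sup>+x. (\<Sum>j. h x * indicator (s j ` K) x) \<partial>M)"
proof -
  note [measurable] = s_image_sets_M
  show ?thesis unfolding nn_integral_P[OF measurable_h]
    by (intro nn_integral_suminf[symmetric]) measurable
qed

lemma sum_P_le: "(\<Sum>j. \<integral>\<^sup>+x. h x \<partial>P j) \<le> (\<Sum>j. \<integral>\<^sup>+x. h x \<partial>Q j)"
  by (intro suminf_le nn_integral_mono_measure P_le_Q) auto

text \<open>Almost every point lies in some \<open>s j ` K\<close> and so is counted at least once in the sum; the points of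
  \<open>Z\<close> are counted at least twice.\<close>

lemma sum_P_ge:
  assumes "Z \<in> sets M" and Z: "\<And>x. x \<in> Z \<Longrightarrow> \<exists>i j. i \<noteq> j \<and> x \<in> s i ` K \<and> x \<in> s j ` K"
  shows "(\<integral>\<^sup>+x. h x \<partial>M) + (\<integral>\<^sup>+x\<in>Z. h x \<partial>M) \<le> (\<Sum>j. \<integral>\<^sup>+x. h x \<partial>P j)"
proof -
  note [measurable] = assms(1)
  have "(\<integral>\<^sup>+x. h x \<partial>M) + (\<integral>\<^sup>+x\<in>Z. h x \<partial>M) = (\<integral>\<^sup>+x. h x + h x * indicator Z x \<partial>M)"
    by (intro nn_integral_add[symmetric]) measurable
  also have "\<dots> \<le> (\<integral>\<^sup>+x. (\<Sum>j. h x * indicator (s j ` K) x) \<partial>M)"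
  proof (rule nn_integral_mono_AE)
    show "AE x in M. h x + h x * indicator Z x \<le> (\<Sum>j. h x * indicator (s j ` K) x)"
      using AE_covered
    proof eventually_elim
      case (elim x)
      show ?case
      proof (cases "x \<in> Z")
        case True
        then obtain i j where "i \<noteq> j" "x \<in> s i ` K" "x \<in> s j ` K" using Z by blast
        then have "h x + h x * indicator Z x = (\<Sum>l\<in>{i, j}. h x * indicator (s l ` K) x)"
          using True by (subst sum.insert) simp_all
        also have "\<dots> \<le> (\<Sum>l. h x * indicator (s l ` K) x)" by (rule sum_le_suminf) auto
        finally show ?thesis .
      next
        case False
        from elim obtain j where "x \<in> s j ` K" by blast
        then show ?thesis
          using False sum_le_suminf[of "\<lambda>j. h x * indicator (s j ` K) x" "{j}"] by simp
      qed
    qed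
  qed
  finally show ?thesis unfolding sum_P_eq .
qed

lemma sum_P: "(\<Sum>j. \<integral>\<^sup>+x. h x \<partial>P j) = (\<integral>\<^sup>+x. h x \<partial>M)"
proof (rule antisym)
  show "(\<Sum>j. \<integral>\<^sup>+x. h x \<partial>P j) \<le> (\<integral>\<^sup>+x. h x \<partial>M)" using sum_P_le sum_Q_le by (rule order_trans)
  show "(\<integral>\<^sup>+x. h x \<partial>M) \<le> (\<Sum>j. \<integral>\<^sup>+x. h x \<partial>P j)" using sum_P_ge[of "{}"] by simp
qed

lemma integral_P_eq_Q: "(\<integral>\<^sup>+x. h x \<partial>P j) = (\<integral>\<^sup>+x. h x \<partial>Q j)"
  using sum_P sum_Q_le h_integral_finite
  by (intro suminf_ennreal_eq_terms[where f="\<lambda>j. \<integral>\<^sup>+x. h x \<partial>P j"] nn_integral_mono_measure P_le_Q) auto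

text \<open>The total mass leaves no room for points that are counted twice.\<close>

lemma overlap_null:
  assumes "i \<noteq> j" shows "emeasure M (s i ` K \<inter> s j ` K) = 0"
proof -
  let ?Z = "s i ` K \<inter> s j ` K" and ?I = "\<integral>\<^sup>+x. h x \<partial>M"
  have Z: "?Z \<in> sets M" using s_image_sets_M by auto
  have "?I + (\<integral>\<^sup>+x\<in>?Z. h x \<partial>M) \<le> ?I + 0"
    using sum_P_ge[OF Z] assms by (auto simp: sum_P)
  then have "?I = \<infinity> \<or> (\<integral>\<^sup>+x\<in>?Z. h x \<partial>M) \<le> 0" by (simp only: ennreal_add_left_cancel_le)
  then have zero: "(\<integral>\<^sup>+x\<in>?Z. h x \<partial>M) \<le> 0" using h_integral_finite by (elim disjE) simp_all
  have "ennreal (1 / C) * emeasure M ?Z = (\<integral>\<^sup>+x\<in>?Z. ennreal (1 / C) \<partial>M)"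
    using Z by (simp add: nn_integral_cmult_indicator)
  also have "\<dots> \<le> (\<integral>\<^sup>+x\<in>?Z. h x \<partial>M)"
    by (intro nn_integral_mono mult_right_mono h_lower) (simp_all add: space_M)
  finally have "ennreal (1 / C) * emeasure M ?Z = 0" using zero by simp
  then show ?thesis using C_pos by simp
qed

text \<open>The measures \<open>P j\<close> and \<open>Q j\<close> weighted with \<open>h\<close> are ordered and have the same finite total mass, so
  they are equal; since \<open>h\<close> is finite and nonzero the weight can be divided out.\<close>

lemma transformation_letter:
  assumes f [measurable]: "f \<in> borel_measurable M"
  shows "(\<integral>\<^sup>+x. f x * indicator (s j ` K) x \<partial>M) = (\<integral>\<^sup>+x. ennreal (g j x) * f (s j x) \<partial>M)"
proof -
  have eq: "density (P j) h = density (Q j) h"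
  proof (rule measure_eqI)
    fix B assume "B \<in> sets (density (P j) h)"
    then have B [measurable]: "B \<in> sets M" by simp
    let ?I = "\<lambda>N B. \<integral>\<^sup>+x\<in>B. h x \<partial>N"
    have split: "?I N B + ?I N (K - B) = (\<integral>\<^sup>+x. h x \<partial>N)" if [measurable_cong]: "sets N = sets M" for N
    proof -
      have [measurable]: "K \<in> sets M" by (rule K_sets)
      have "space N = K" using that space_M sets_eq_imp_space_eq by metis
      then show ?thesis
        by (subst nn_integral_add[symmetric]) (auto intro!: nn_integral_cong split: split_indicator)
    qed
    have le: "?I (P j) B \<le> ?I (Q j) B" "?I (P j) (K - B) \<le> ?I (Q j) (K - B)"
      by (intro nn_integral_mono_measure P_le_Q; simp)+
    have "?I (Q j) B + ?I (P j) (K - B) \<le> ?I (Q j) B + ?I (Q j) (K - B)" by (intro add_left_mono le)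
    also have "\<dots> = ?I (P j) B + ?I (P j) (K - B)" by (simp add: split integral_P_eq_Q)
    finally have "?I (P j) (K - B) + ?I (Q j) B \<le> ?I (P j) (K - B) + ?I (P j) B" by (simp add: add.commute)
    then have disj: "?I (P j) (K - B) = \<infinity> \<or> ?I (Q j) B \<le> ?I (P j) B" by (simp only: ennreal_add_left_cancel_le)
    have "?I (P j) (K - B) \<le> (\<integral>\<^sup>+x. h x \<partial>P j)"
      by (intro nn_integral_mono) (auto split: split_indicator)
    also have "\<dots> \<le> (\<Sum>j. \<integral>\<^sup>+x. h x \<partial>P j)"
      using sum_le_suminf[of "\<lambda>j. \<integral>\<^sup>+x. h x \<partial>P j" "{j}"] by simp
    also have "\<dots> < \<infinity>" by (simp only: sum_P h_integral_finite)
    finally have "?I (Q j) B \<le> ?I (P j) B" using disj by (elim disjE) simp_all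
    then have "?I (P j) B = ?I (Q j) B" using le(1) by (rule antisym[rotated])
    then show "emeasure (density (P j) h) B = emeasure (density (Q j) h) B"
      by (simp add: emeasure_density)
  qed simp
  have undo: "(\<integral>\<^sup>+x. f x \<partial>N) = (\<integral>\<^sup>+x. f x / h x \<partial>density N h)" if [measurable_cong]: "sets N = sets M" for N
  proof -
    have sp: "space N = K" using that space_M sets_eq_imp_space_eq by metis
    have "(\<integral>\<^sup>+x. f x / h x \<partial>density N h) = (\<integral>\<^sup>+x. h x * (f x / h x) \<partial>N)"
      by (rule nn_integral_density) measurable
    also have "\<dots> = (\<integral>\<^sup>+x. f x \<partial>N)"
    proof (rule nn_integral_cong)
      fix x assume "x \<in> space N"
      then have "ennreal (1 / C) \<le> h x" "h x \<le> ennreal C" using h_lower h_upper sp by auto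
      then have "h x \<noteq> 0" "h x \<noteq> \<infinity>" using C_pos by (auto simp: top_unique)
      then have "f x * h x / h x = f x" by (intro ennreal_mult_divide_eq) simp_all
      then show "h x * (f x / h x) = f x" by (simp only: ennreal_times_divide mult.commute)
    qed
    finally show ?thesis ..
  qed
  have "(\<integral>\<^sup>+x. f x \<partial>P j) = (\<integral>\<^sup>+x. f x \<partial>Q j)"
    unfolding undo[OF sets_P] undo[OF sets_Q] eq ..
  then show ?thesis unfolding nn_integral_P[OF f] nn_integral_Q[OF f] .
qed

lemma image_Cons_iff:
  assumes "x \<in> K" shows "s j x \<in> foldr s (j # w) ` K \<longleftrightarrow> x \<in> foldr s w ` K"
proof
  assume "s j x \<in> foldr s (j # w) ` K"
  then obtain y where y: "y \<in> K" "s j x = s j (foldr s w y)" by auto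
  then have "x = foldr s w y"
    using inj_onD[OF s_inj y(2)] assms foldr_in_K[OF y(1), of w] K_X by blast
  with y(1) show "x \<in> foldr s w ` K" by blast
qed auto

text \<open>Iteration of the change of variables needs integrals of functions and not only measures of sets,
  because the weight of the outer letters becomes part of the integrand for the inner ones.\<close>

lemma transformation_word:
  assumes "f \<in> borel_measurable M"
  shows "(\<integral>\<^sup>+x. f x * indicator (foldr s w ` K) x \<partial>M)
    = (\<integral>\<^sup>+x. ennreal (D w x powr a) * f (foldr s w x) \<partial>M)"
  using assms
proof (induction w arbitrary: f)
  case Nil
  show ?case by (auto intro!: nn_integral_cong simp: space_M)
next
  case (Cons j w)
  note [measurable] = Cons.prems
  have im [measurable]: "foldr s v ` K \<in> sets M" for v by (rule image_sets_M[OF K_closed order_refl])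
  have "(\<integral>\<^sup>+x. f x * indicator (foldr s (j # w) ` K) x \<partial>M)
      = (\<integral>\<^sup>+x. (f x * indicator (foldr s (j # w) ` K) x) * indicator (s j ` K) x \<partial>M)"
    using foldr_in_K by (intro nn_integral_cong) (auto split: split_indicator)
  also have "\<dots> = (\<integral>\<^sup>+x. ennreal (g j x) * (f (s j x) * indicator (foldr s (j # w) ` K) (s j x)) \<partial>M)"
    using im[of "j # w"] by (intro transformation_letter) (simp del: foldr.simps)
  also have "\<dots> = (\<integral>\<^sup>+x. (ennreal (g j x) * f (s j x)) * indicator (foldr s w ` K) x \<partial>M)"
    using image_Cons_iff[of _ j w]
    by (intro nn_integral_cong) (auto simp: space_M mult.assoc simp del: foldr.simps split: split_indicator)
  also have "\<dots> = (\<integral>\<^sup>+x. ennreal (D w x powr a) * (ennreal (g j (foldr s w x)) * f (s j (foldr s w x))) \<partial>M)"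
    by (rule Cons.IH) measurable
  also have "\<dots> = (\<integral>\<^sup>+x. ennreal (D (j # w) x powr a) * f (foldr s (j # w) x) \<partial>M)"
  proof (rule nn_integral_cong)
    fix x assume "x \<in> space M"
    then have "x \<in> X" using K_X by (auto simp: space_M)
    then have "0 < D w x" "0 < d j (foldr s w x)" using D_pos d_pos_X foldr_in_X by auto
    then show "ennreal (D w x powr a) * (ennreal (g j (foldr s w x)) * f (s j (foldr s w x)))
        = ennreal (D (j # w) x powr a) * f (foldr s (j # w) x)"
      by (simp add: powr_mult ennreal_mult mult_ac)
  qed
  finally show ?case .
qed

lemma measure_word_image:
  assumes E: "closed E" "E \<subseteq> K"
  shows "emeasure M (foldr s w ` E) = (\<integral>\<^sup>+x\<in>E. ennreal (D w x powr a) \<partial>M)"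
proof -
  have im: "foldr s w ` E \<in> sets M" by (rule image_sets_M[OF E])
  have iff: "foldr s w x \<in> foldr s w ` E \<longleftrightarrow> x \<in> E" if "x \<in> K" for x
    using inj_on_image_mem_iff[OF foldr_inj[of w], of x E] that E(2) K_X by blast
  have "emeasure M (foldr s w ` E) = (\<integral>\<^sup>+x. indicator (foldr s w ` E) x \<partial>M)" using im by simp
  also have "\<dots> = (\<integral>\<^sup>+x. indicator (foldr s w ` E) x * indicator (foldr s w ` K) x \<partial>M)"
    using E(2) by (intro nn_integral_cong) (auto split: split_indicator)
  also have "\<dots> = (\<integral>\<^sup>+x. ennreal (D w x powr a) * indicator (foldr s w ` E) (foldr s w x) \<partial>M)"
    using im by (intro transformation_word) simp
  also have "\<dots> = (\<integral>\<^sup>+x\<in>E. ennreal (D w x powr a) \<partial>M)"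
    using iff by (intro nn_integral_cong) (simp add: space_M indicator_def)
  finally show ?thesis .
qed

lemma measure_word_image_ge:
  assumes E: "closed E" "E \<subseteq> K" and x: "x \<in> X"
  shows "ennreal ((D w x / C1) powr a) * emeasure M E \<le> emeasure M (foldr s w ` E)"
proof -
  have "ennreal ((D w x / C1) powr a) * emeasure M E = (\<integral>\<^sup>+y\<in>E. ennreal ((D w x / C1) powr a) \<partial>M)"
    using closed_sets_M[OF E] by (simp add: nn_integral_cmult_indicator)
  also have "\<dots> \<le> (\<integral>\<^sup>+y\<in>E. ennreal (D w y powr a) \<partial>M)"
  proof (intro nn_integral_mono mult_right_mono ennreal_leI powr_mono2)
    fix y assume "y \<in> space M"
    then have "D w x \<le> C1 * D w y" using K_X x by (intro D_distortion) (auto simp: space_M)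
    then show "D w x / C1 \<le> D w y" using C1_ge_1 by (simp add: field_simps)
  qed (use a_pos C1_ge_1 D_pos[OF x, of w] in auto)
  finally show ?thesis by (simp add: measure_word_image[OF E])
qed

text \<open>After the longest common prefix the two words continue with different letters, and the change of
  variables along the prefix maps the null overlap of these letters to a null set.\<close>

lemma parallel_null:
  assumes "w \<parallel> v" shows "emeasure M (foldr s w ` K \<inter> foldr s v ` K) = 0"
proof -
  obtain p i w' j v' where eq: "i \<noteq> j" "w = p @ i # w'" "v = p @ j # v'"
    using parallel_decomp[OF assms] by blast
  let ?Z = "s i ` K \<inter> s j ` K"
  have Z: "closed ?Z" "?Z \<subseteq> K"
    using closed_image[OF K_closed order_refl, of "[i]"] closed_image[OF K_closed order_refl, of "[j]"] s_K
    by auto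
  have "foldr s w ` K \<inter> foldr s v ` K \<subseteq> foldr s p ` ?Z"
  proof
    fix y assume y: "y \<in> foldr s w ` K \<inter> foldr s v ` K"
    then obtain u u' where u: "u \<in> K" "u' \<in> K" "y = foldr s p (s i (foldr s w' u))" "y = foldr s p (s j (foldr s v' u'))"
      by (auto simp: eq)
    have same: "s i (foldr s w' u) = s j (foldr s v' u')"
    proof (rule inj_onD[OF foldr_inj[of p]])
      show "foldr s p (s i (foldr s w' u)) = foldr s p (s j (foldr s v' u'))"
        using u(3,4) by (rule subst)
      show "s i (foldr s w' u) \<in> X" "s j (foldr s v' u') \<in> X"
        by (intro subsetD[OF K_X] s_K foldr_in_K u)+
    qed
    have "s i (foldr s w' u) \<in> s i ` K" "s j (foldr s v' u') \<in> s j ` K"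
      by (intro imageI foldr_in_K u)+
    then have "s i (foldr s w' u) \<in> ?Z" unfolding same by blast
    then show "y \<in> foldr s p ` ?Z" unfolding u(3) by (rule imageI)
  qed
  then have "emeasure M (foldr s w ` K \<inter> foldr s v ` K) \<le> emeasure M (foldr s p ` ?Z)"
    by (intro emeasure_mono image_sets_M Z)
  also have "\<dots> = (\<integral>\<^sup>+x\<in>?Z. ennreal (D p x powr a) \<partial>M)" by (rule measure_word_image[OF Z])
  also have "\<dots> = 0"
    using overlap_null[OF eq(1)] closed_sets_M[OF Z] by (intro nn_integral_null_set) auto
  finally show ?thesis by simp
qed

subsection \<open>Upper regularity\<close>

text \<open>If a small set \<open>E\<close> had too large a measure compared with its diameter, then
  replacing a proportional part of \<open>K\<close> by the images of \<open>E\<close> under all words of a large length would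
  give cheaper covers of \<open>K\<close> than its Hausdorff measure allows.\<close>

lemma measure_small_le:
  assumes E: "closed E" "E \<subseteq> K" "E \<subseteq> ball x \<delta>" and x: "x \<in> K"
  shows "ennreal (1 / C) * emeasure M E \<le> ennreal ((C1 * diameter E) powr a * C)"
proof -
  let ?q = "ennreal ((C1 * diameter E) powr a * C)" and ?e = "ennreal (1 / C) * emeasure M E"
  define A where "A n = (\<Union>w\<in>{w. length w = n}. foldr s w ` E)" for n
  have E_sets [measurable]: "E \<in> sets M" by (rule closed_sets_M[OF E(1,2)])
  have im: "foldr s w ` E \<in> sets M" for w by (rule image_sets_M[OF E(1,2)])
  have A: "A n \<in> sets M" for n unfolding A_def by (intro sets.countable_UN'') (auto intro: im)
  have A_ge: "?e \<le> emeasure M (A n)" for n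
  proof -
    let ?W = "{w :: nat list. length w = n}"
    have "?e = (\<integral>\<^sup>+x\<in>E. ennreal (1 / C) \<partial>M)" by (simp add: nn_integral_cmult_indicator)
    also have "\<dots> \<le> (\<integral>\<^sup>+x. ennreal (G n x) * indicator E x \<partial>M)"
      by (intro nn_integral_mono mult_right_mono ennreal_leI G_lower) (auto simp: space_M)
    also have "\<dots> = (\<integral>\<^sup>+x. (\<integral>\<^sup>+w. ennreal (D w x powr a) * indicator E x \<partial>count_space ?W) \<partial>M)"
      by (intro nn_integral_cong) (simp add: nn_integral_multc sum_words_eq space_M)
    also have "\<dots> = (\<integral>\<^sup>+w. (\<integral>\<^sup>+x. ennreal (D w x powr a) * indicator E x \<partial>M) \<partial>count_space ?W)"
      by (rule nn_integral_count_space_nn_integral) auto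
    also have "\<dots> = (\<integral>\<^sup>+w. emeasure M (foldr s w ` E) \<partial>count_space ?W)"
      by (simp add: measure_word_image[OF E(1,2)])
    also have "\<dots> \<le> emeasure M (A n)"
    proof (rule nn_integral_emeasure_almost_disjoint)
      fix w v :: "nat list" assume "w \<in> ?W" "v \<in> ?W" "w \<noteq> v"
      then have "w \<parallel> v" by (auto simp: prefix_def intro!: parallelI)
      then have "emeasure M (foldr s w ` K \<inter> foldr s v ` K) = 0" by (rule parallel_null)
      moreover have "emeasure M (foldr s w ` E \<inter> foldr s v ` E) \<le> emeasure M (foldr s w ` K \<inter> foldr s v ` K)"
        using E(2) image_sets_M[OF K_closed order_refl] by (intro emeasure_mono) auto
      ultimately show "emeasure M (foldr s w ` E \<inter> foldr s v ` E) = 0" by simp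
    qed (use im A in \<open>auto simp: A_def\<close>)
    finally show ?thesis .
  qed
  have fin: "?e \<noteq> \<infinity>" using M.emeasure_finite[of E] by (simp add: ennreal_mult_eq_top_iff)
  have "hausdorff_measure a K \<le> (?q + emeasure M K) - ?e"
  proof (rule hausdorff_measure_leI)
    fix \<eta> :: real assume \<eta>: "0 < \<eta>"
    obtain n where n: "hausdorff_premeasure a \<eta> (A n) \<le> ?q"
      using premeasure_word_images[OF x E(3) \<eta>] unfolding eventually_sequentially A_def by blast
    have AK: "A n \<subseteq> K" using A[of n] sets_M_iff by blast
    have "hausdorff_premeasure a \<eta> K \<le> hausdorff_premeasure a \<eta> (A n \<union> (K - A n))"
      by (intro hausdorff_premeasure_mono) auto
    also have "\<dots> \<le> hausdorff_premeasure a \<eta> (A n) + hausdorff_premeasure a \<eta> (K - A n)"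
      using \<eta> by (intro hausdorff_premeasure_Un) auto
    also have "\<dots> \<le> ?q + emeasure M (K - A n)"
      using A K_sets \<eta> by (intro add_mono n) (auto simp: emeasure_M intro!: hausdorff_premeasure_le_measure)
    finally have "hausdorff_premeasure a \<eta> K + ?e \<le> ?q + emeasure M (K - A n) + emeasure M (A n)"
      using A_ge by (rule add_mono)
    also have "\<dots> = ?q + emeasure M K"
    proof -
      have "(K - A n) \<inter> A n = {}" "(K - A n) \<union> A n = K" using AK by blast+
      then show ?thesis
        using plus_emeasure[of "K - A n" M "A n"] A[of n] K_sets by (simp add: add.assoc)
    qed
    finally show "hausdorff_premeasure a \<eta> K \<le> (?q + emeasure M K) - ?e"
      using fin by (simp add: ennreal_le_minus_iff add.commute)
  qed
  then have le: "emeasure M K \<le> (?q + emeasure M K) - ?e" by (simp only: emeasure_M[OF K_sets])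
  then have "0 < (?q + emeasure M K) - ?e" using M_K_pos by (rule less_le_trans[rotated])
  then have "?e \<le> ?q + emeasure M K" 
  proof (rule contrapos_pp)
    assume "\<not> ?e \<le> ?q + emeasure M K"
    then have lt: "?q + emeasure M K < ?e" by (simp only: not_le)
    from less_le_trans[OF lt top_greatest] have "?q + emeasure M K < top" .
    then have "(?q + emeasure M K) - ?e = 0" by (rule diff_eq_0_ennreal[OF _ less_imp_le[OF lt]])
    then show "\<not> 0 < (?q + emeasure M K) - ?e" by (simp only: less_irrefl not_False_eq_True)
  qed
  from diff_add_cancel_ennreal[OF this] add_right_mono[OF le, of ?e]
  have "emeasure M K + ?e \<le> emeasure M K + ?q" by (simp only: add.commute)
  then have "emeasure M K = \<infinity> \<or> ?e \<le> ?q" by (simp only: ennreal_add_left_cancel_le)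
  then show ?thesis using M_K_finite by (elim disjE) simp_all
qed

text \<open>Balls of radius less than \<open>\<delta> / 2\<close> that meet \<open>K\<close> are small enough for the previous estimate; for the
  others the total measure of \<open>K\<close> is the bound.\<close>

lemma upper_regular: "\<exists>B>0. \<forall>y r. 0 < r \<longrightarrow> emeasure M (K \<inter> cball y r) \<le> ennreal (B * r powr a)"
proof -
  obtain m where m: "emeasure M K = ennreal m" "0 \<le> m"
    using M_K_finite by (cases "emeasure M K") auto
  define B where "B = (C1 * 2) powr a * C * C + m / (\<delta> / 2) powr a"
  have B1: "(C1 * 2) powr a * C * C \<le> B" "0 \<le> (C1 * 2) powr a * C * C" and B2: "m / (\<delta> / 2) powr a \<le> B"
    using C_pos m \<delta>_pos by (auto simp: B_def)
  have "0 < (C1 * 2) powr a * C * C" using C_pos C1_ge_1 by simp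
  then have "0 < B" using B1 by linarith
  moreover have "emeasure M (K \<inter> cball y r) \<le> ennreal (B * r powr a)" if r: "0 < r" for y r
  proof (cases "2 * r < \<delta>")
    case True
    let ?E = "K \<inter> cball y r"
    show ?thesis
    proof (cases "?E = {}")
      case False
      then obtain x where x: "x \<in> ?E" by blast
      have cl: "closed ?E" using K_closed by auto
      have E: "?E \<subseteq> ball x \<delta>"
      proof
        fix z assume "z \<in> ?E"
        then show "z \<in> ball x \<delta>" using x True dist_triangle[of x z y] by (auto simp: dist_commute)
      qed
      have "diameter ?E \<le> diameter (cball y r)" by (intro diameter_subset) auto
      then have dE: "diameter ?E \<le> 2 * r" using r by simp
      have d0: "0 \<le> diameter ?E" by (intro diameter_ge_0 bounded_Int) auto
      have "ennreal (1 / C) * emeasure M ?E \<le> ennreal ((C1 * diameter ?E) powr a * C)"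
        using measure_small_le[OF cl _ E] x by auto
      then have "ennreal C * (ennreal (1 / C) * emeasure M ?E) \<le> ennreal C * ennreal ((C1 * diameter ?E) powr a * C)"
        by (rule mult_left_mono) simp
      then have "emeasure M ?E \<le> ennreal (C * ((C1 * diameter ?E) powr a * C))"
        using C_pos by (simp add: mult.assoc[symmetric] ennreal_mult[symmetric])
      also have "\<dots> \<le> ennreal (B * r powr a)"
      proof (rule ennreal_leI)
        have "(C1 * diameter ?E) powr a \<le> (C1 * (2 * r)) powr a"
          using a_pos C1_ge_1 dE d0 by (intro powr_mono2 mult_left_mono) auto
        also have "\<dots> = (C1 * 2) powr a * r powr a"
          using C1_ge_1 r by (simp add: powr_mult[symmetric] mult.assoc)
        finally have "C * ((C1 * diameter ?E) powr a * C) \<le> C * ((C1 * 2) powr a * r powr a * C)"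
          using C_pos by (intro mult_left_mono mult_right_mono) auto
        also have "\<dots> = ((C1 * 2) powr a * C * C) * r powr a" by (simp add: mult_ac)
        also have "\<dots> \<le> B * r powr a" by (intro mult_right_mono B1) simp
        finally show "C * ((C1 * diameter ?E) powr a * C) \<le> B * r powr a" .
      qed
      finally show ?thesis .
    qed simp
  next
    case False
    have "emeasure M (K \<inter> cball y r) \<le> emeasure M K" by (intro emeasure_mono K_sets) auto
    also have "\<dots> \<le> ennreal (B * r powr a)"
      unfolding m
    proof (rule ennreal_leI)
      have "(\<delta> / 2) powr a \<le> r powr a" using False a_pos \<delta>_pos by (intro powr_mono2) auto
      then have "m / (\<delta> / 2) powr a * (\<delta> / 2) powr a \<le> B * r powr a"
        using B2 m \<open>0 < B\<close> by (intro mult_mono) auto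
      then show "m \<le> B * r powr a" using \<delta>_pos by simp
    qed
    finally show ?thesis .
  qed
  ultimately show ?thesis by blast
qed

end

section \<open>Words over a finite alphabet and a maximal neighbourhood\<close>

locale finite_alphabet = hausdorff_system X U s d \<rho> \<delta> \<alpha> a J K b
  for X U :: "'a::euclidean_space set" and s d \<rho> \<delta> \<alpha> a J K b +
  fixes N :: nat and x0 :: 'a and \<kappa> :: real
  assumes x0_J: "x0 \<in> J" and \<kappa>_pos: "0 < \<kappa>" and \<kappa>_le_1: "\<kappa> \<le> 1"
    and \<kappa>_le: "j < N \<Longrightarrow> x \<in> X \<Longrightarrow> \<kappa> \<le> d j x"
begin

abbreviation A where "A \<equiv> lists {..<N}"

definition size_at :: "nat list \<Rightarrow> real" where "size_at w = D w x0"

lemma x0_X: "x0 \<in> X" and x0_K: "x0 \<in> K" using x0_J J_X J_K by auto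

lemma size_at_pos: "0 < size_at w" unfolding size_at_def by (rule D_pos[OF x0_X])

lemma size_at_le: "size_at w \<le> \<rho> ^ length w" unfolding size_at_def by (rule D_le[OF x0_X])

lemma size_at_le_1: "size_at w \<le> 1"
  using size_at_le[of w] power_le_one[of \<rho> "length w"] \<rho>_pos \<rho>_less by linarith

lemma size_at_append: "size_at (p @ v) = D p (foldr s v x0) * size_at v"
  by (simp add: size_at_def D_append)

lemma D_le_size_at: "x \<in> X \<Longrightarrow> D w x \<le> C1 * size_at w"
  unfolding size_at_def by (rule D_distortion[OF _ x0_X])

lemma size_at_le_D: "x \<in> X \<Longrightarrow> size_at w \<le> C1 * D w x"
  unfolding size_at_def by (rule D_distortion[OF x0_X])

lemma \<kappa>_power_le: "w \<in> A \<Longrightarrow> x \<in> X \<Longrightarrow> \<kappa> ^ length w \<le> D w x"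
proof (induction w)
  case (Cons j w)
  have "\<kappa> * \<kappa> ^ length w \<le> d j (foldr s w x) * D w x"
    using Cons \<kappa>_pos d_pos_X foldr_in_X by (intro mult_mono \<kappa>_le) (auto intro: less_imp_le)
  then show ?case by simp
qed simp

text \<open>Without connectedness, the Lipschitz estimate along a word is only local. Over a finite
  alphabet it still bounds the diameter of the image of all of \<open>X\<close>: a bounded number of letters
  makes \<open>X\<close> small enough, at the cost of a bounded factor.\<close>

lemma diameter_image:
  "\<exists>L\<ge>1. \<forall>w\<in>A. \<forall>x\<in>X. \<forall>y\<in>X. dist (foldr s w x) (foldr s w y) \<le> L * size_at w"
proof -
  obtain n where n: "\<rho> ^ n < \<delta>" using real_arch_pow_inv[OF \<delta>_pos \<rho>_less] by blast
  define L where "L = C1 * C1 / \<kappa> ^ n"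
  have k: "0 < \<kappa> ^ n" "\<kappa> ^ n \<le> 1" using \<kappa>_pos \<kappa>_le_1 by (auto intro: power_le_one)
  have CC: "1 \<le> C1 * C1" using C1_ge_1 mult_mono[of 1 C1 1 C1] by simp
  have L: "1 \<le> L" "1 / \<kappa> ^ n \<le> L" using k CC by (auto simp: L_def field_simps intro: order_trans)
  have "dist (foldr s w x) (foldr s w y) \<le> L * size_at w" if w: "w \<in> A" and xy: "x \<in> X" "y \<in> X" for w x y
  proof (cases "length w < n")
    case True
    have "dist (foldr s w x) (foldr s w y) \<le> 1"
      using foldr_dist[OF xy, of w] power_le_one[of \<rho> "Suc (length w)"] \<rho>_pos \<rho>_less by linarith
    moreover have "\<kappa> ^ n \<le> \<kappa> ^ length w" using True \<kappa>_pos \<kappa>_le_1 by (intro power_decreasing) auto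
    then have "\<kappa> ^ n \<le> size_at w" using \<kappa>_power_le[OF w x0_X] by (simp add: size_at_def)
    then have "1 \<le> 1 / \<kappa> ^ n * size_at w" using k by (simp add: field_simps)
    moreover have "1 / \<kappa> ^ n * size_at w \<le> L * size_at w"
      using L size_at_pos[of w] by (intro mult_right_mono) auto
    ultimately show ?thesis by linarith
  next
    case False
    define w1 w2 where "w1 = take (length w - n) w" and "w2 = drop (length w - n) w"
    have w12: "w = w1 @ w2" "length w2 = n" using False by (auto simp: w1_def w2_def)
    then have A2: "w2 \<in> A" using w by auto
    let ?x = "foldr s w2 x" and ?y = "foldr s w2 y"
    have X: "?x \<in> X" "?y \<in> X" using xy foldr_in_X by auto
    have "dist ?x ?y \<le> \<rho> * \<rho> ^ n" using foldr_dist[OF xy, of w2] w12 by simp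
    also have "\<dots> \<le> \<rho> ^ n" using \<rho>_pos \<rho>_less by (intro mult_left_le_one_le) auto
    finally have small: "dist ?x ?y < \<delta>" using n by linarith
    then have d1: "dist ?x ?y \<le> 1" using \<delta>_le \<rho>_less by linarith
    have "dist (foldr s w1 ?x) (foldr s w1 ?y) \<le> C1 * D w1 ?x * dist ?x ?y"
      using small \<delta>_pos by (intro foldr_Lipschitz X) auto
    also have "\<dots> \<le> C1 * D w1 ?x * 1"
      using C1_ge_1 D_pos[OF X(1), of w1] d1 by (intro mult_left_mono) auto
    also have "D w1 ?x \<le> C1 * size_at w / \<kappa> ^ n"
    proof -
      have "D w1 ?x * \<kappa> ^ n \<le> D w1 ?x * D w2 x"
        using \<kappa>_power_le[OF A2 xy(1)] D_pos[OF X(1), of w1] w12 by (intro mult_left_mono) auto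
      also have "\<dots> = D w x" by (simp add: w12 D_append)
      also have "\<dots> \<le> C1 * size_at w" by (rule D_le_size_at[OF xy(1)])
      finally show ?thesis using k by (simp add: field_simps)
    qed
    finally have "dist (foldr s w1 ?x) (foldr s w1 ?y) \<le> C1 * (C1 * size_at w / \<kappa> ^ n) * 1"
      using C1_ge_1 by (simp add: mult_left_mono)
    then show ?thesis by (simp add: w12 L_def mult_ac)
  qed
  with L show ?thesis by blast
qed

text \<open>Appending one letter to a word shrinks its size by at most this factor.\<close>

definition c1 :: real where "c1 = \<kappa> / C1"

lemma c1_pos: "0 < c1" using \<kappa>_pos C1_ge_1 by (simp add: c1_def)

definition adjacent :: "nat list \<Rightarrow> nat list \<Rightarrow> bool" where
  "adjacent u v \<longleftrightarrow> c1 * size_at u \<le> size_at v \<and> size_at v \<le> size_at u \<and>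
     (\<exists>y\<in>K. \<exists>z\<in>K. dist (foldr s u y) (foldr s v z) \<le> \<delta> / 2 * size_at u)"

text \<open>The closure of adjacency under common prefixes. Distortion would spoil the constants in
  adjacency at every prefix; taking the closure makes the relation invariant, and only one factor
  of distortion enters its metric consequences.\<close>

definition neighbours :: "nat list \<Rightarrow> nat list set" where
  "neighbours u = {v \<in> A. \<exists>p u' v'. u = p @ u' \<and> v = p @ v' \<and> adjacent u' v'}"

lemma neighbours_prefix: "p \<in> A \<Longrightarrow> v \<in> neighbours u \<Longrightarrow> p @ v \<in> neighbours (p @ u)"
proof -
  assume p: "p \<in> A" and "v \<in> neighbours u"
  then obtain q u' v' where "v \<in> A" "u = q @ u'" "v = q @ v'" "adjacent u' v'"
    unfolding neighbours_def by blast
  then have "p @ v \<in> A" "p @ u = (p @ q) @ u'" "p @ v = (p @ q) @ v'" "adjacent u' v'"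
    using p by auto
  then show ?thesis unfolding neighbours_def by blast
qed

lemma adjacent_neighbours: "v \<in> A \<Longrightarrow> adjacent u v \<Longrightarrow> v \<in> neighbours u"
  unfolding neighbours_def by (metis (mono_tags, lifting) append_Nil mem_Collect_eq)

lemma neighbours_size:
  assumes "v \<in> neighbours u"
  shows "size_at v \<le> C1 * size_at u" and "c1 / C1 * size_at u \<le> size_at v"
proof -
  obtain p u' v' where uv: "u = p @ u'" "v = p @ v'" "adjacent u' v'"
    using assms unfolding neighbours_def by blast
  let ?Du = "D p (foldr s u' x0)" and ?Dv = "D p (foldr s v' x0)"
  have X: "foldr s u' x0 \<in> X" "foldr s v' x0 \<in> X" using foldr_in_X x0_X by auto
  have D: "?Dv \<le> C1 * ?Du" "?Du \<le> C1 * ?Dv" by (rule D_distortion[OF X(2,1)], rule D_distortion[OF X])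
  have adj: "c1 * size_at u' \<le> size_at v'" "size_at v' \<le> size_at u'" using uv(3) by (auto simp: adjacent_def)
  have pos: "0 < ?Du" "0 < ?Dv" using D_pos X by auto
  have "?Dv * size_at v' \<le> (C1 * ?Du) * size_at u'"
    using D adj pos size_at_pos[of v'] C1_ge_1 by (intro mult_mono) auto
  then show "size_at v \<le> C1 * size_at u" by (simp add: uv size_at_append mult_ac)
  have "?Du * (c1 * size_at u') \<le> (C1 * ?Dv) * size_at v'"
    using D adj pos size_at_pos[of u'] c1_pos C1_ge_1 by (intro mult_mono) auto
  then have "c1 * size_at u \<le> C1 * size_at v" by (simp add: uv size_at_append mult_ac)
  then show "c1 / C1 * size_at u \<le> size_at v" using C1_ge_1 by (simp add: field_simps)
qed

lemma neighbours_close: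
  "\<exists>R>0. \<forall>u\<in>A. \<forall>v\<in>neighbours u. foldr s v ` K \<subseteq> cball (foldr s u x0) (R * size_at u)"
proof -
  obtain L where L: "1 \<le> L" "\<And>w x y. w \<in> A \<Longrightarrow> x \<in> X \<Longrightarrow> y \<in> X \<Longrightarrow> dist (foldr s w x) (foldr s w y) \<le> L * size_at w"
    using diameter_image by blast
  define R where "R = L * C1 + C1 * C1 + L"
  have CC: "1 \<le> C1 * C1" using C1_ge_1 mult_mono[of 1 C1 1 C1] by simp
  have "0 < R" unfolding R_def using L(1) C1_ge_1 CC by (intro add_pos_pos mult_pos_pos) auto
  moreover have "dist (foldr s u x0) (foldr s v t) \<le> R * size_at u"
    if u: "u \<in> A" and v: "v \<in> neighbours u" and t: "t \<in> K" for u v t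
  proof -
    have vA: "v \<in> A" using v by (simp add: neighbours_def)
    obtain p u' v' where uv: "u = p @ u'" "v = p @ v'" "adjacent u' v'"
      using v unfolding neighbours_def by blast
    then obtain y z where yz: "y \<in> K" "z \<in> K" "dist (foldr s u' y) (foldr s v' z) \<le> \<delta> / 2 * size_at u'"
      unfolding adjacent_def by blast
    have X: "y \<in> X" "z \<in> X" "t \<in> X" using yz t K_X by auto
    let ?y = "foldr s u' y" and ?z = "foldr s v' z"
    have yX: "?y \<in> X" by (rule foldr_in_X[OF X(1)])
    have "\<delta> / 2 * size_at u' \<le> \<delta> / 2 * 1" using \<delta>_pos by (intro mult_left_mono size_at_le_1) auto
    then have "dist ?y ?z < \<delta>" using yz(3) \<delta>_pos by linarith
    then have "dist (foldr s p ?y) (foldr s p ?z) \<le> C1 * D p ?y * dist ?y ?z"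
      using \<delta>_pos by (intro foldr_Lipschitz yX) auto
    also have "\<dots> \<le> C1 * (C1 * D p (foldr s u' x0)) * (1 * size_at u')"
    proof (rule mult_mono)
      show "C1 * D p ?y \<le> C1 * (C1 * D p (foldr s u' x0))"
        using C1_ge_1 yX foldr_in_X[OF x0_X] by (intro mult_left_mono D_distortion) auto
      have "\<delta> / 2 * size_at u' \<le> 1 * size_at u'"
        using size_at_pos[of u'] \<delta>_le \<rho>_less by (intro mult_right_mono) auto
      then show "dist ?y ?z \<le> 1 * size_at u'" using yz(3) by linarith
      show "0 \<le> C1 * (C1 * D p (foldr s u' x0))"
        using C1_ge_1 D_pos[OF foldr_in_X[OF x0_X], of p u'] by simp
    qed simp
    finally have 1: "dist (foldr s u y) (foldr s v z) \<le> C1 * C1 * size_at u"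
      by (simp add: uv size_at_append mult_ac)
    have 2: "dist (foldr s u x0) (foldr s u y) \<le> L * size_at u" by (intro L u x0_X X)
    have "dist (foldr s v z) (foldr s v t) \<le> L * size_at v" by (intro L vA X)
    also have "\<dots> \<le> L * (C1 * size_at u)" using L(1) by (intro mult_left_mono neighbours_size v) auto
    finally have 3: "dist (foldr s v z) (foldr s v t) \<le> L * C1 * size_at u" by (simp add: mult.assoc)
    have "dist (foldr s u x0) (foldr s v t)
        \<le> dist (foldr s u x0) (foldr s u y) + dist (foldr s u y) (foldr s v z) + dist (foldr s v z) (foldr s v t)"
      using dist_triangle[of "foldr s u x0" "foldr s v t" "foldr s u y"]
        dist_triangle[of "foldr s u y" "foldr s v t" "foldr s v z"] by linarith
    then show ?thesis using 1 2 3 by (simp add: R_def distrib_right)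
  qed
  then have "\<forall>u\<in>A. \<forall>v\<in>neighbours u. foldr s v ` K \<subseteq> cball (foldr s u x0) (R * size_at u)"
    by (intro ballI image_subsetI) (simp only: mem_cball)
  ultimately show ?thesis by blast
qed

text \<open>Pairwise incomparable neighbours of \<open>u\<close> have almost disjoint images of comparable measure in a
  ball of comparable radius, so upper regularity bounds their number.\<close>

lemma antichain_bound:
  obtains q where "\<And>u F. u \<in> A \<Longrightarrow> F \<subseteq> neighbours u \<Longrightarrow> finite F \<Longrightarrow>
    (\<And>v w. v \<in> F \<Longrightarrow> w \<in> F \<Longrightarrow> v \<noteq> w \<Longrightarrow> v \<parallel> w) \<Longrightarrow> real (card F) \<le> q"
proof -
  obtain R where R: "0 < R" "\<And>u v. u \<in> A \<Longrightarrow> v \<in> neighbours u \<Longrightarrow> foldr s v ` K \<subseteq> cball (foldr s u x0) (R * size_at u)"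
    using neighbours_close by blast
  obtain B where B: "0 < B" "\<And>y r. 0 < r \<Longrightarrow> emeasure M (K \<inter> cball y r) \<le> ennreal (B * r powr a)"
    using upper_regular by blast
  obtain m where m: "emeasure M K = ennreal m" "0 < m"
    using M_K_finite M_K_pos by (cases "emeasure M K") auto
  let ?c = "(c1 / C1 / C1) powr a * m"
  have c_pos: "0 < ?c" using c1_pos C1_ge_1 m by simp
  have "real (card F) \<le> B * R powr a / ?c"
    if u: "u \<in> A" and F: "F \<subseteq> neighbours u" "finite F" and par: "\<And>v w. v \<in> F \<Longrightarrow> w \<in> F \<Longrightarrow> v \<noteq> w \<Longrightarrow> v \<parallel> w"
    for u F
  proof -
    let ?t = "size_at u"
    let ?E = "K \<inter> cball (foldr s u x0) (R * ?t)"
    have im: "foldr s v ` K \<in> sets M" for v by (rule image_sets_M[OF K_closed order_refl])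
    have each: "ennreal (?c * ?t powr a) \<le> emeasure M (foldr s v ` K)" if "v \<in> F" for v
    proof -
      have "c1 / C1 * ?t \<le> D v x0" using neighbours_size(2) F that unfolding size_at_def by blast
      then have "(c1 / C1 * ?t) / C1 \<le> D v x0 / C1" using C1_ge_1 by (intro divide_right_mono) auto
      then have "(c1 / C1 * ?t / C1) powr a \<le> (D v x0 / C1) powr a"
        using a_pos c1_pos C1_ge_1 size_at_pos[of u] by (intro powr_mono2) auto
      moreover have "(c1 / C1 * ?t / C1) powr a = (c1 / C1 / C1) powr a * ?t powr a"
        using c1_pos C1_ge_1 size_at_pos[of u] by (simp add: powr_mult[symmetric])
      ultimately have "?c * ?t powr a \<le> (D v x0 / C1) powr a * m"
        using m by (simp add: mult_right_mono mult_ac)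
      then have "ennreal (?c * ?t powr a) \<le> ennreal ((D v x0 / C1) powr a) * emeasure M K"
        using m by (simp add: ennreal_mult[symmetric] ennreal_leI)
      also have "\<dots> \<le> emeasure M (foldr s v ` K)"
        by (rule measure_word_image_ge[OF K_closed order_refl x0_X])
      finally show ?thesis .
    qed
    have "ennreal (real (card F) * (?c * ?t powr a)) = (\<Sum>v\<in>F. ennreal (?c * ?t powr a))"
      using c_pos by (simp add: ennreal_of_nat_eq_real_of_nat ennreal_mult)
    also have "\<dots> \<le> (\<Sum>v\<in>F. emeasure M (foldr s v ` K))" by (intro sum_mono each)
    also have "\<dots> = (\<integral>\<^sup>+v. emeasure M (foldr s v ` K) \<partial>count_space F)"
      using F(2) by (simp add: nn_integral_count_space_finite)
    also have "\<dots> \<le> emeasure M ?E"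
    proof (rule nn_integral_emeasure_almost_disjoint)
      show "?E \<in> sets M" using K_closed by (intro closed_sets_M) auto
      show "foldr s v ` K \<subseteq> ?E" if "v \<in> F" for v
        using R(2)[OF u] F that foldr_in_K by blast
    qed (use F im par parallel_null in \<open>auto simp: countable_finite\<close>)
    also have "\<dots> \<le> ennreal (B * (R * ?t) powr a)"
      using R(1) size_at_pos[of u] by (intro B) simp
    finally have "real (card F) * (?c * ?t powr a) \<le> B * (R * ?t) powr a"
      using B(1) by (subst (asm) ennreal_le_iff) auto
    also have "\<dots> = B * R powr a * ?t powr a"
      using R(1) size_at_pos[of u] by (simp add: powr_mult mult.assoc)
    finally have "(real (card F) * ?c) * ?t powr a \<le> (B * R powr a) * ?t powr a"
      by (simp only: mult.assoc)
    then have "real (card F) * ?c \<le> B * R powr a"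
      by (rule mult_right_le_imp_le) (use size_at_pos[of u] in simp)
    then show ?thesis using c_pos by (simp add: pos_le_divide_eq)
  qed
  then show thesis by (rule that)
qed

text \<open>Comparable neighbours have comparable sizes, hence lengths that differ by a bounded amount, so
  fixing the length modulo that bound leaves an antichain.\<close>

lemma neighbours_bounded: "\<exists>B. \<forall>u\<in>A. finite (neighbours u) \<and> card (neighbours u) \<le> B"
proof (rule antichain_bound)
  fix q assume q: "\<And>u F. u \<in> A \<Longrightarrow> F \<subseteq> neighbours u \<Longrightarrow> finite F \<Longrightarrow>
      (\<And>v w. v \<in> F \<Longrightarrow> w \<in> F \<Longrightarrow> v \<noteq> w \<Longrightarrow> v \<parallel> w) \<Longrightarrow> real (card F) \<le> q"
  have "0 < c1 / C1 / C1 / C1" using c1_pos C1_ge_1 by simp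
  from real_arch_pow_inv[OF this \<rho>_less] obtain l where l: "\<rho> ^ l < c1 / C1 / C1 / C1" by blast
  define L where "L = Suc l"
  have len: "length t < L" if "v \<in> neighbours u" "v @ t \<in> neighbours u" for u v t
  proof (rule ccontr)
    assume "\<not> length t < L"
    then have "\<rho> ^ length t \<le> \<rho> ^ l"
      using \<rho>_pos \<rho>_less by (intro power_decreasing) (auto simp: L_def)
    then have small: "size_at t < c1 / C1 / C1 / C1" using size_at_le[of t] l by linarith
    have "c1 / C1 * size_at u \<le> size_at (v @ t)" by (rule neighbours_size(2)[OF that(2)])
    also have "\<dots> \<le> (C1 * size_at v) * size_at t"
      unfolding size_at_append using size_at_pos[of t] foldr_in_X[OF x0_X]
      by (intro mult_right_mono D_le_size_at) auto
    also have "\<dots> \<le> (C1 * (C1 * size_at u)) * size_at t"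
      using C1_ge_1 size_at_pos[of t] by (intro mult_right_mono mult_left_mono neighbours_size(1)[OF that(1)]) auto
    also have "\<dots> < (C1 * (C1 * size_at u)) * (c1 / C1 / C1 / C1)"
      using small C1_ge_1 size_at_pos[of u] by (intro mult_strict_left_mono) auto
    also have "\<dots> = c1 / C1 * size_at u" using C1_ge_1 by (simp add: field_simps)
    finally show False by simp
  qed
  have "finite (neighbours u) \<and> card (neighbours u) \<le> nat \<lfloor>real L * q\<rfloor>" if u: "u \<in> A" for u
  proof (rule finite_if_finite_subsets_card_bdd)
    fix F assume F: "F \<subseteq> neighbours u" "finite F"
    let ?F = "\<lambda>k. {v \<in> F. length v mod L = k}"
    have "real (card (?F k)) \<le> q" for k
    proof (rule q[OF u])
      have no_prefix: "v = w" if vw: "v \<in> ?F k" "w \<in> ?F k" and pre: "prefix v w" for v w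
      proof -
        obtain t where t: "w = v @ t" using pre by (auto simp: prefix_def)
        have "length t < L" using vw F(1) t by (intro len[of v u]) auto
        moreover have "L dvd length t"
          using vw t mod_eq_dvd_iff_nat[of "length v" "length w" L] by auto
        ultimately have "t = []" by (auto dest: dvd_imp_le)
        with t show ?thesis by simp
      qed
      show "v \<parallel> w" if "v \<in> ?F k" "w \<in> ?F k" "v \<noteq> w" for v w
        using no_prefix[OF that(1,2)] no_prefix[OF that(2,1)] that(3) by (intro parallelI) auto
    qed (use F in auto)
    then have sum_le: "(\<Sum>k<L. real (card (?F k))) \<le> (\<Sum>k<L. q)" by (rule sum_mono)
    have "card (\<Union>k<L. ?F k) \<le> (\<Sum>k<L. card (?F k))" by (rule card_UN_le) simp
    moreover have "(\<Union>k<L. ?F k) = F" by (auto simp: L_def)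
    ultimately have "card F \<le> (\<Sum>k<L. card (?F k))" by (simp only:)
    then have "real (card F) \<le> real (\<Sum>k<L. card (?F k))" by (simp only: of_nat_le_iff)
    with sum_le have "real (card F) \<le> (\<Sum>k<L. q)" by (simp only: of_nat_sum)
    then show "card F \<le> nat \<lfloor>real L * q\<rfloor>" by (simp add: le_nat_floor)
  qed
  then show ?thesis by blast
qed

text \<open>For a word \<open>u\<close> with the largest number of neighbours, every neighbour of \<open>w @ u\<close> is already the
  image under \<open>w\<close> of a neighbour of \<open>u\<close>.\<close>

lemma maximal_word: "\<exists>u\<in>A. \<forall>w\<in>A. neighbours (w @ u) = (\<lambda>v. w @ v) ` neighbours u"
proof -
  obtain B where B: "\<And>u. u \<in> A \<Longrightarrow> finite (neighbours u)" "\<And>u. u \<in> A \<Longrightarrow> card (neighbours u) \<le> B"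
    using neighbours_bounded by blast
  have "\<exists>u. u \<in> A \<and> (\<forall>w. w \<in> A \<longrightarrow> card (neighbours w) \<le> card (neighbours u))"
  proof (rule ex_has_greatest_nat)
    show "[] \<in> A" by simp
    show "\<forall>w. w \<in> A \<longrightarrow> card (neighbours w) < Suc B" by (intro allI impI le_imp_less_Suc B(2))
  qed
  then obtain u where u: "u \<in> A" "\<And>w. w \<in> A \<Longrightarrow> card (neighbours w) \<le> card (neighbours u)" by blast
  have "neighbours (w @ u) = (\<lambda>v. w @ v) ` neighbours u" if w: "w \<in> A" for w
  proof (rule card_seteq[symmetric])
    have wu: "w @ u \<in> A" using w u by auto
    show "finite (neighbours (w @ u))" by (rule B(1)[OF wu])
    show "(\<lambda>v. w @ v) ` neighbours u \<subseteq> neighbours (w @ u)" using neighbours_prefix[OF w] by blast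
    show "card (neighbours (w @ u)) \<le> card ((\<lambda>v. w @ v) ` neighbours u)"
      using u(2)[OF wu] by (simp add: card_image inj_on_def)
  qed
  then show ?thesis using u(1) by (intro bexI[of _ u] ballI)
qed

text \<open>Cutting the word of the smaller image at the first prefix \<open>\<tau>\<close> whose size does not exceed that of
  \<open>i # w @ u\<close> gives a word of comparable size, the image of which contains the small one. If the points
  were close, \<open>\<tau>\<close> would be a neighbour of \<open>i # w @ u\<close>, and by maximality of \<open>u\<close> it would begin with
  \<open>i\<close>.\<close>

lemma separation:
  assumes max: "\<And>w. w \<in> A \<Longrightarrow> neighbours (w @ u) = (\<lambda>v. w @ v) ` neighbours u" and u: "u \<in> A"
    and ij: "i < N" "j < N" "i \<noteq> j" and wv: "w \<in> A" "v \<in> A"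
    and le: "size_at (j # v @ u) \<le> size_at (i # w @ u)"
  shows "\<delta> / 2 * size_at (i # w @ u) < dist (foldr s (i # w @ u) x0) (foldr s (j # v @ u) x0)"
proof (rule ccontr)
  let ?t = "i # w @ u" and ?r = "j # v @ u"
  assume "\<not> ?thesis"
  then have close: "dist (foldr s ?t x0) (foldr s ?r x0) \<le> \<delta> / 2 * size_at ?t" by simp
  define n where "n = (LEAST n. size_at (take n ?r) \<le> size_at ?t)"
  have le': "size_at (take (length ?r) ?r) \<le> size_at ?t" using le by simp
  have n: "size_at (take n ?r) \<le> size_at ?t"
    unfolding n_def by (rule LeastI[of "\<lambda>n. size_at (take n ?r) \<le> size_at ?t", OF le'])
  have n_le: "n \<le> length ?r"
    unfolding n_def by (rule Least_le[of "\<lambda>n. size_at (take n ?r) \<le> size_at ?t", OF le'])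
  have "size_at ?t \<le> \<rho> * \<rho> ^ length (w @ u)" using size_at_le[of ?t] by simp
  also have "\<dots> \<le> \<rho> * 1" using \<rho>_pos \<rho>_less by (intro mult_left_mono power_le_one) auto
  finally have "size_at ?t < 1" using \<rho>_less by simp
  have "n \<noteq> 0"
  proof
    assume "n = 0"
    then have "size_at [] \<le> size_at ?t" using n by (simp only: take_0)
    moreover have "size_at [] = 1" by (simp add: size_at_def)
    ultimately show False using \<open>size_at ?t < 1\<close> by (simp only:)
  qed
  then obtain m where m: "n = Suc m" by (cases n) auto
  have big: "size_at ?t < size_at (take m ?r)"
    using not_less_Least[of m "\<lambda>n. size_at (take n ?r) \<le> size_at ?t"] m by (simp add: n_def)
  have m_less: "m < length ?r" using n_le m by simp
  let ?k = "?r ! m" and ?\<tau> = "take n ?r"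
  have rA: "?r \<in> A" using wv u ij by auto
  have kN: "?k < N" using rA nth_mem[OF m_less] by auto
  have \<tau>: "?\<tau> = take m ?r @ [?k]" using m m_less by (simp only: take_Suc_conv_app_nth)
  have "c1 * size_at ?t \<le> size_at ?\<tau>"
  proof -
    have sX: "s ?k x0 \<in> X" by (rule s_X[OF x0_X])
    have "size_at ?t / C1 \<le> size_at (take m ?r) / C1" using big C1_ge_1 by (intro divide_right_mono) auto
    also have "\<dots> \<le> D (take m ?r) (s ?k x0)"
      using size_at_le_D[OF sX, of "take m ?r"] C1_ge_1 by (simp add: field_simps)
    finally have "size_at ?t / C1 * \<kappa> \<le> D (take m ?r) (s ?k x0) * d ?k x0"
      using \<kappa>_le[OF kN x0_X] \<kappa>_pos D_pos[OF sX, of "take m ?r"] by (intro mult_mono) auto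
    also have "\<dots> = size_at ?\<tau>" unfolding \<tau> by (simp add: size_at_def D_append)
    finally show ?thesis by (simp add: c1_def mult.commute)
  qed
  moreover have "foldr s ?\<tau> (foldr s (drop n ?r) x0) = foldr s ?r x0"
    using foldr_append[of s ?\<tau> "drop n ?r"] by (simp only: append_take_drop_id o_apply)
  then have "dist (foldr s ?t x0) (foldr s ?\<tau> (foldr s (drop n ?r) x0)) \<le> \<delta> / 2 * size_at ?t"
    using close by (simp only:)
  ultimately have "adjacent ?t ?\<tau>"
    unfolding adjacent_def using n x0_K foldr_in_K[OF x0_K] by blast
  moreover have "?\<tau> \<in> A" using rA set_take_subset[of n ?r] by (simp only: in_lists_conv_set) blast
  ultimately have "?\<tau> \<in> neighbours ((i # w) @ u)" using adjacent_neighbours by simp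
  moreover have "i # w \<in> A" using ij wv by auto
  ultimately have "?\<tau> \<in> (\<lambda>v. (i # w) @ v) ` neighbours u" by (simp only: max)
  then obtain v' where "?\<tau> = (i # w) @ v'" by (rule imageE)
  then show False using ij(3) by (simp add: m)
qed

text \<open>The radius is small compared with \<open>size_at u\<close>, so that the images of the ball under \<open>foldr s (i # w)\<close>
  and \<open>foldr s (j # v)\<close> are smaller than the separation of their centres.\<close>

lemma disjoint_ball_images:
  "\<exists>x \<epsilon>. x \<in> J \<and> 0 < \<epsilon> \<and> \<epsilon> \<le> \<delta> \<and> (\<forall>i<N. \<forall>j<N. \<forall>w\<in>A. \<forall>v\<in>A. i \<noteq> j \<longrightarrow>
     foldr s (i # w) ` ball x \<epsilon> \<inter> foldr s (j # v) ` ball x \<epsilon> = {})"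
proof -
  from maximal_word obtain u where
    u: "u \<in> A" and max: "\<forall>w\<in>A. neighbours (w @ u) = (\<lambda>v. w @ v) ` neighbours u"
    by (rule bexE)
  let ?x = "foldr s u x0"
  define \<epsilon> where "\<epsilon> = min \<delta> (\<delta> * size_at u / (4 * C1))"
  have \<epsilon>: "0 < \<epsilon>" "\<epsilon> \<le> \<delta>" "4 * C1 * \<epsilon> \<le> \<delta> * size_at u"
  proof -
    show "0 < \<epsilon>" using \<delta>_pos size_at_pos[of u] C1_ge_1 by (simp add: \<epsilon>_def)
    have "4 * C1 * \<epsilon> \<le> 4 * C1 * (\<delta> * size_at u / (4 * C1))"
      using C1_ge_1 by (intro mult_left_mono) (auto simp: \<epsilon>_def)
    then show "4 * C1 * \<epsilon> \<le> \<delta> * size_at u" using C1_ge_1 by simp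
  qed (simp add: \<epsilon>_def)
  have xJ: "?x \<in> J" by (rule foldr_in_J[OF x0_J])
  then have xX: "?x \<in> X" using J_X by blast
  have close: "dist (foldr s w ?x) (foldr s w y) * size_at u \<le> C1 * \<epsilon> * size_at (w @ u)"
    if "y \<in> ball ?x \<epsilon>" for w y
  proof -
    have "dist (foldr s w ?x) (foldr s w y) \<le> C1 * D w ?x * dist ?x y"
      using that \<epsilon> \<delta>_pos by (intro foldr_Lipschitz xX) auto
    also have "\<dots> \<le> C1 * D w ?x * \<epsilon>"
      using that C1_ge_1 D_pos[OF xX, of w] by (intro mult_left_mono) auto
    finally have "dist (foldr s w ?x) (foldr s w y) * size_at u \<le> C1 * D w ?x * \<epsilon> * size_at u"
      using size_at_pos[of u] by (intro mult_right_mono) auto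
    then show ?thesis by (simp add: size_at_append mult_ac)
  qed
  have half: "foldr s (i # w) y \<noteq> foldr s (j # v) z"
    if ij: "i < N" "j < N" "i \<noteq> j" and wv: "w \<in> A" "v \<in> A" and yz: "y \<in> ball ?x \<epsilon>" "z \<in> ball ?x \<epsilon>"
      and le: "size_at (j # v @ u) \<le> size_at (i # w @ u)" for i j w v y z
  proof
    assume eq: "foldr s (i # w) y = foldr s (j # v) z"
    let ?p = "foldr s (i # w) ?x" and ?q = "foldr s (j # v) ?x" and ?e = "foldr s (i # w) y"
    let ?t = "size_at (i # w @ u)"
    have 1: "dist ?p ?e * size_at u \<le> C1 * \<epsilon> * ?t" using close[OF yz(1), of "i # w"] by simp
    have "dist ?q ?e * size_at u \<le> C1 * \<epsilon> * size_at (j # v @ u)"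
      using close[OF yz(2), of "j # v"] unfolding eq by simp
    also have "\<dots> \<le> C1 * \<epsilon> * ?t" using le C1_ge_1 \<epsilon> by (intro mult_left_mono) auto
    finally have 2: "dist ?q ?e * size_at u \<le> C1 * \<epsilon> * ?t" .
    have "dist ?p ?q * size_at u \<le> (dist ?p ?e + dist ?q ?e) * size_at u"
      using size_at_pos[of u] by (intro mult_right_mono dist_triangle2) auto
    also have "\<dots> \<le> 2 * (C1 * \<epsilon> * ?t)" using 1 2 by (simp add: distrib_right)
    also have "\<dots> = (4 * C1 * \<epsilon>) * ?t / 2" by simp
    also have "\<dots> \<le> (\<delta> * size_at u) * ?t / 2"
      using \<epsilon>(3) size_at_pos[of "i # w @ u"] by (intro divide_right_mono mult_right_mono) auto
    also have "\<dots> = (\<delta> / 2 * ?t) * size_at u" by simp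
    finally have "dist ?p ?q \<le> \<delta> / 2 * ?t"
      by (rule mult_right_le_imp_le) (rule size_at_pos)
    moreover have "\<delta> / 2 * ?t < dist ?p ?q"
      using separation[OF max[rule_format] u ij wv le] by (simp only: foldr_append[of s "_ # _", simplified] o_apply append_Cons[symmetric] foldr_append)
    ultimately show False by simp
  qed
  have "foldr s (i # w) ` ball ?x \<epsilon> \<inter> foldr s (j # v) ` ball ?x \<epsilon> = {}"
    if "i < N" "j < N" "w \<in> A" "v \<in> A" "i \<noteq> j" for i j w v
  proof (rule ccontr)
    assume "\<not> ?thesis"
    then obtain y z where yz: "y \<in> ball ?x \<epsilon>" "z \<in> ball ?x \<epsilon>" "foldr s (i # w) y = foldr s (j # v) z"
      by (auto simp del: foldr.simps)
    show False
    proof (cases "size_at (j # v @ u) \<le> size_at (i # w @ u)")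
      case True
      from half[OF that(1,2,5,3,4) yz(1,2) this] yz(3) show False by (rule notE)
    next
      case False
      then have "size_at (i # w @ u) \<le> size_at (j # v @ u)" by simp
      from half[OF that(2,1) that(5)[symmetric] that(4,3) yz(2,1) this] yz(3)[symmetric]
      show False by (rule notE)
    qed
  qed
  then show ?thesis using xJ \<epsilon>(1,2) by blast
qed

end

section \<open>Conformal maps and the Dini condition\<close>

lemma similarity_norm:
  assumes "similarity_matrix (A :: real^'n^'n)"
  shows "norm (A *v v) = onorm ((*v) A) * norm v"
proof -
  obtain c Q where Q: "orthogonal_matrix Q" "A = c *\<^sub>R Q" using assms unfolding similarity_matrix_def by blast
  have "orthogonal_transformation ((*v) Q)"
    using Q(1) by (simp add: orthogonal_transformation_matrix)
  then have nv: "norm (A *v v) = \<bar>c\<bar> * norm v" for v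
    unfolding Q(2) scaleR_matrix_vector_assoc[symmetric] by (simp add: orthogonal_transformation_norm)
  have "onorm ((*v) A) = \<bar>c\<bar>"
  proof (rule antisym)
    show "onorm ((*v) A) \<le> \<bar>c\<bar>" by (rule onorm_le) (simp add: nv)
    show "\<bar>c\<bar> \<le> onorm ((*v) A)"
      using onorm[OF matrix_vector_mul_bounded_linear, of A "axis undefined 1"] by (simp add: nv norm_axis_1)
  qed
  then show ?thesis using nv by simp
qed

lemma conformal_deriv:
  assumes "conformal_self_map X U w" "x \<in> U"
  shows "(w has_derivative (*v) (jacobian w (at x))) (at x)"
    and "norm (jacobian w (at x) *v v) = deriv_norm w x * norm v"
proof -
  show "(w has_derivative (*v) (jacobian w (at x))) (at x)"
    using assms by (simp add: conformal_self_map_def jacobian_works)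
  have "similarity_matrix (jacobian w (at x))" using assms by (simp add: conformal_self_map_def)
  then show "norm (jacobian w (at x) *v v) = deriv_norm w x * norm v"
    unfolding deriv_norm_def by (rule similarity_norm)
qed

text \<open>A similarity stretches every vector by its norm, so a single unit vector detects the norm.\<close>

lemma deriv_norm_continuous:
  assumes "conformal_self_map X U w"
  shows "continuous_on U (deriv_norm w)"
proof -
  let ?e = "axis undefined 1 :: real^'n"
  have "continuous_on U (\<lambda>x. jacobian w (at x))"
    using assms by (simp add: conformal_self_map_def)
  moreover have "continuous_on UNIV (\<lambda>A :: real^'n^'n. A *v ?e)"
    unfolding matrix_vector_mult_def by (intro continuous_intros)
  ultimately have "continuous_on U (\<lambda>x. norm (jacobian w (at x) *v ?e))"
    by (intro continuous_on_norm) (rule continuous_on_compose2[of UNIV], auto)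
  then show ?thesis
    by (rule continuous_on_eq) (simp add: conformal_deriv(2)[OF assms] norm_axis_1)
qed

lemma conformal_Lipschitz:
  assumes "conformal_self_map X U w" "convex S" "S \<subseteq> U" "\<And>y. y \<in> S \<Longrightarrow> deriv_norm w y \<le> c" "y \<in> S" "z \<in> S"
  shows "dist (w y) (w z) \<le> c * dist y z"
  unfolding dist_norm
proof (rule differentiable_bound[OF assms(2)])
  show "(w has_derivative (*v) (jacobian w (at x))) (at x within S)" if "x \<in> S" for x
    by (rule has_derivative_at_withinI[OF conformal_deriv(1)[OF assms(1) subsetD[OF assms(3) that]]])
  show "onorm ((*v) (jacobian w (at x))) \<le> c" if "x \<in> S" for x
    using assms(4)[OF that] by (simp only: deriv_norm_def)
qed (rule assms)+

lemma conformal_open_map: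
  assumes w: "conformal_self_map X U w" and pos: "\<And>x. x \<in> U \<Longrightarrow> 0 < deriv_norm w x"
    and O: "open V" "V \<subseteq> U"
  shows "open (w ` V)"
proof -
  have "w x \<in> interior (w ` V)" if x: "x \<in> V" for x
  proof -
    let ?A = "jacobian w (at x)"
    have xU: "x \<in> U" using x O by blast
    have "inj ((*v) ?A)"
    proof (rule injI)
      fix v v' assume "?A *v v = ?A *v v'"
      then have "norm (?A *v (v - v')) = 0" by (simp add: matrix_vector_mult_diff_distrib)
      then show "v = v'" using conformal_deriv(2)[OF w xU, of "v - v'"] pos[OF xU] by simp
    qed
    then obtain B where "B ** ?A = mat 1" using matrix_left_invertible_injective by blast
    then have "?A ** B = mat 1" using matrix_left_right_inverse by blast
    then have id: "(*v) ?A \<circ> (*v) B = id"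
      by (simp add: fun_eq_iff matrix_vector_mul_assoc)
    have "continuous_on V w"
      using conformal_deriv(1)[OF w] O(2)
      by (intro continuous_at_imp_continuous_on ballI has_derivative_continuous) blast
    from sussmann_open_mapping[OF O(1) this x conformal_deriv(1)[OF w xU] _ id order_refl]
    show ?thesis using x O(1) by (simp add: interior_open)
  qed
  then have "interior (w ` V) = w ` V" by (intro antisym interior_subset image_subsetI)
  then show ?thesis using open_interior[of "w ` V"] by (simp only:)
qed

lemma Dini_modulus_mono: "t \<le> t' \<Longrightarrow> Dini_modulus U p t \<le> Dini_modulus U p t'"
  unfolding Dini_modulus_def by (intro SUP_mono SUP_subset_mono) auto

lemma Dini_modulus_upper:
  "x \<in> U \<Longrightarrow> y \<in> U \<Longrightarrow> dist x y \<le> t \<Longrightarrow> ennreal \<bar>ln (p j x) - ln (p j y)\<bar> \<le> Dini_modulus U p t"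
  unfolding Dini_modulus_def by (rule SUP_upper2[of j], simp, rule SUP_upper2[of "(x, y)"]) auto

text \<open>The Dini integral dominates a multiple of the sum of the moduli along a geometric sequence of
  scales.\<close>

lemma Dini_modulus_sum_finite:
  assumes fin: "(\<integral>\<^sup>+t\<in>{0<..1}. Dini_modulus U p t / ennreal t \<partial>lborel) < \<infinity>" and \<rho>: "0 < \<rho>" "\<rho> < 1"
  shows "(\<Sum>k. Dini_modulus U p (\<rho> ^ Suc k)) < \<infinity>"
proof -
  let ?m = "Dini_modulus U p"
  define I where "I k = {\<rho> ^ Suc k<..\<rho> ^ k}" for k
  have disj: "disjoint_family I"
  proof -
    have "I i \<inter> I j = {}" if "i < j" for i j
    proof -
      have "\<rho> ^ j \<le> \<rho> ^ Suc i" using that \<rho> by (intro power_decreasing) auto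
      then show ?thesis by (auto simp: I_def)
    qed
    then show ?thesis unfolding disjoint_family_on_def by (metis Int_commute linorder_neqE_nat)
  qed
  have piece: "?m (\<rho> ^ Suc k) * ennreal (1 - \<rho>)
      = (\<integral>\<^sup>+t. ?m (\<rho> ^ Suc k) / ennreal (\<rho> ^ k) * indicator (I k) t \<partial>lborel)" for k
  proof -
    have le: "\<rho> ^ Suc k \<le> \<rho> ^ k" using \<rho> by (intro power_decreasing) auto
    have "ennreal (\<rho> ^ k - \<rho> ^ Suc k) = ennreal (1 - \<rho>) * ennreal (\<rho> ^ k)"
      using \<rho> by (subst ennreal_mult[symmetric]) (auto simp: algebra_simps)
    moreover have "emeasure lborel (I k) = ennreal (\<rho> ^ k - \<rho> ^ Suc k)"
      unfolding I_def using le by simp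
    ultimately have "?m (\<rho> ^ Suc k) / ennreal (\<rho> ^ k) * emeasure lborel (I k)
        = ?m (\<rho> ^ Suc k) / ennreal (\<rho> ^ k) * (ennreal (\<rho> ^ k) * ennreal (1 - \<rho>))"
      by (simp only: mult.commute)
    also have "\<dots> = (?m (\<rho> ^ Suc k) / ennreal (\<rho> ^ k) * ennreal (\<rho> ^ k)) * ennreal (1 - \<rho>)"
      by (simp only: mult.assoc)
    also have "?m (\<rho> ^ Suc k) / ennreal (\<rho> ^ k) * ennreal (\<rho> ^ k) = ?m (\<rho> ^ Suc k)"
    proof -
      have "?m (\<rho> ^ Suc k) * ennreal (\<rho> ^ k) / ennreal (\<rho> ^ k) = ?m (\<rho> ^ Suc k)"
        using \<rho> by (intro ennreal_mult_divide_eq) auto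
      then show ?thesis by (simp only: ennreal_times_divide mult.commute)
    qed
    finally show ?thesis by (simp add: nn_integral_cmult_indicator I_def)
  qed
  have "(\<Sum>k. ?m (\<rho> ^ Suc k)) * ennreal (1 - \<rho>)
      = (\<Sum>k. \<integral>\<^sup>+t. ?m (\<rho> ^ Suc k) / ennreal (\<rho> ^ k) * indicator (I k) t \<partial>lborel)"
    by (simp only: piece[symmetric] ennreal_suminf_multc)
  also have "\<dots> = (\<integral>\<^sup>+t. (\<Sum>k. ?m (\<rho> ^ Suc k) / ennreal (\<rho> ^ k) * indicator (I k) t) \<partial>lborel)"
    by (intro nn_integral_suminf[symmetric]) (simp add: I_def)
  also have "\<dots> \<le> (\<integral>\<^sup>+t\<in>{0<..1}. ?m t / ennreal t \<partial>lborel)"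
  proof (rule nn_integral_mono)
    fix t :: real
    show "(\<Sum>k. ?m (\<rho> ^ Suc k) / ennreal (\<rho> ^ k) * indicator (I k) t) \<le> ?m t / ennreal t * indicator {0<..1} t"
    proof (cases "\<exists>k. t \<in> I k")
      case True
      then obtain k where k: "t \<in> I k" by blast
      have t: "\<rho> ^ Suc k < t" "t \<le> \<rho> ^ k" using k by (auto simp: I_def)
      have "0 < \<rho> ^ Suc k" "\<rho> ^ k \<le> 1" using \<rho> by (auto intro: power_le_one)
      then have t01: "t \<in> {0<..1}" using t by (auto simp del: power_Suc)
      have "?m (\<rho> ^ Suc k) / ennreal (\<rho> ^ k) \<le> ?m t / ennreal t"
      proof -
        have "?m (\<rho> ^ Suc k) * ennreal (inverse (\<rho> ^ k)) \<le> ?m t * ennreal (inverse t)"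
          using t t01 by (intro mult_mono Dini_modulus_mono ennreal_leI le_imp_inverse_le) auto
        then show ?thesis using t01 \<rho> by (simp add: divide_ennreal_def inverse_ennreal del: power_Suc)
      qed
      then show ?thesis
        using suminf_cmult_indicator[OF disj k, of "\<lambda>k. ?m (\<rho> ^ Suc k) / ennreal (\<rho> ^ k)"] t01 by simp
    qed simp
  qed
  also have "\<dots> < \<infinity>" by (rule fin)
  finally have "(\<Sum>k. ?m (\<rho> ^ Suc k)) * ennreal (1 - \<rho>) < \<infinity>" .
  then show ?thesis using \<rho> by (auto simp: ennreal_mult_less_top)
qed

text \<open>Summability makes all but finitely many of the ratios at most 1/2, so the maps contract with a
  common ratio.\<close>

lemma uniform_bound_of_powr_summable:
  fixes R :: "nat \<Rightarrow> real"
  assumes R: "\<And>j. 0 < R j" "\<And>j. R j < 1" and t: "0 \<le> t" "summable (\<lambda>j. R j powr t)"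
  shows "0 < t" and "\<exists>\<rho><1. \<forall>j. R j \<le> \<rho>"
proof -
  have "t \<noteq> 0"
  proof
    assume "t = 0"
    then have "(\<lambda>j. R j powr t) = (\<lambda>_. 1)" using R(1) by (simp add: fun_eq_iff less_imp_neq[symmetric])
    then show False using t(2) summable_const_iff[of "1::real"] by simp
  qed
  then show t0: "0 < t" using t by simp
  have "(\<lambda>j. R j powr t) \<longlonglongrightarrow> 0" using t(2) by (rule summable_LIMSEQ_zero)
  then have "\<forall>\<^sub>F j in sequentially. R j powr t < (1/2) powr t"
    by (rule order_tendstoD) simp
  then obtain n where n: "\<And>j. n \<le> j \<Longrightarrow> R j powr t < (1/2) powr t"
    unfolding eventually_sequentially by blast
  have tail: "R j \<le> 1/2" if "n \<le> j" for j
  proof (rule ccontr)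
    assume "\<not> R j \<le> 1/2"
    then have "(1/2) powr t \<le> R j powr t" using t0 by (intro powr_mono2) auto
    then show False using n[OF that] by simp
  qed
  define \<rho> where "\<rho> = Max (insert (1/2) (R ` {..<n}))"
  have "\<rho> < 1" unfolding \<rho>_def using R(2) by (subst Max_less_iff) auto
  moreover have "R j \<le> \<rho>" for j
  proof (cases "j < n")
    case True
    then show ?thesis unfolding \<rho>_def by (intro Max_ge) auto
  next
    case False
    have "1/2 \<le> \<rho>" unfolding \<rho>_def by (intro Max_ge) auto
    then show ?thesis using tail[of j] False by simp
  qed
  ultimately show "\<exists>\<rho><1. \<forall>j. R j \<le> \<rho>" by blast
qed

section \<open>The limit set\<close>

lemma word_map_shift: "word_map s w (Suc n) x = s (w 0) (word_map s (\<lambda>i. w (Suc i)) n x)"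
  by (induction n arbitrary: x) auto

lemma limit_set_subset:
  assumes "\<And>j. s j ` X \<subseteq> X" shows "limit_set X s \<subseteq> X"
proof
  fix x assume "x \<in> limit_set X s"
  then obtain w where "x \<in> word_map s w 1 ` X" unfolding limit_set_def by fastforce
  then show "x \<in> X" using assms by auto
qed

lemma limit_set_forward:
  assumes X: "\<And>j. s j ` X \<subseteq> X" and x: "x \<in> limit_set X s" shows "s j x \<in> limit_set X s"
proof -
  obtain w where w: "\<And>n. 1 \<le> n \<Longrightarrow> x \<in> word_map s w n ` X" using x unfolding limit_set_def by auto
  let ?w = "case_nat j w"
  have xX: "x \<in> X" using limit_set_subset[of s X, OF X] x by blast
  have "s j x \<in> word_map s ?w n ` X" if n: "1 \<le> n" for n
  proof -
    obtain m where m: "n = Suc m" using n by (cases n) auto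
    have "x \<in> word_map s w m ` X" using w[of m] xX by (cases m) auto
    then obtain y where "y \<in> X" "x = word_map s w m y" by blast
    then have "s j x = word_map s ?w n y" unfolding m word_map_shift by simp
    with \<open>y \<in> X\<close> show ?thesis by blast
  qed
  then show ?thesis unfolding limit_set_def by auto
qed

lemma word_map_in: "(\<And>j. s j ` X \<subseteq> X) \<Longrightarrow> x \<in> X \<Longrightarrow> word_map s w n x \<in> X"
  by (induction n arbitrary: x) auto

text \<open>Injectivity of the first map makes the preimages of \<open>x\<close> at all levels the same point.\<close>

lemma limit_set_backward:
  assumes X: "\<And>j. s j ` X \<subseteq> X" and inj: "\<And>j. inj_on (s j) X"
  shows "limit_set X s \<subseteq> (\<Union>j. s j ` limit_set X s)"
proof
  fix x assume "x \<in> limit_set X s"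
  then obtain w where w: "\<And>n. 1 \<le> n \<Longrightarrow> x \<in> word_map s w n ` X" unfolding limit_set_def by auto
  let ?w = "\<lambda>i. w (Suc i)"
  let ?y = "inv_into X (s (w 0)) x"
  have y: "?y \<in> word_map s ?w n ` X" "x = s (w 0) ?y" for n
  proof -
    obtain z where z: "z \<in> X" "x = word_map s w (Suc n) z" using w[of "Suc n"] by auto
    have in_X: "word_map s ?w n z \<in> X" by (rule word_map_in[OF X z(1)])
    have x: "x = s (w 0) (word_map s ?w n z)" using z(2) unfolding word_map_shift .
    have y: "?y = word_map s ?w n z" unfolding x by (rule inv_into_f_f[OF inj in_X])
    show "?y \<in> word_map s ?w n ` X" unfolding y using z(1) by (rule imageI)
    show "x = s (w 0) ?y" unfolding y by (rule x)
  qed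
  have "?y \<in> limit_set X s" unfolding limit_set_def using y(1) by blast
  then show "x \<in> (\<Union>j. s j ` limit_set X s)" using y(2) by blast
qed

section \<open>The finite strong open set condition\<close>

theorem theorem1p2:
  fixes X U0 :: "(real^'n) set"
    and s :: "nat \<Rightarrow> real^'n \<Rightarrow> real^'n"
    and a :: real
  defines "J \<equiv> limit_set X s"
  assumes "compact X" and "locally connected X"
    and "open U0" and "X \<subseteq> U0" and "bounded U0" and "diameter U0 \<le> 1"
    and "infinite_conformal_IFS X U0 s"
    and "theta U0 s < ereal a"
    and "spectral_radius_on (closure J) (transfer_op (closure J) s a) = 1"
    and "hausdorff_measure a J = hausdorff_measure a (closure J)"
    and "hausdorff_measure a (closure J) > 0"
  shows "finite_strong_open_set_condition X U0 s"
proof -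
  let ?d = "\<lambda>j. deriv_norm (s j)" and ?R = "\<lambda>j. sup_deriv U0 (s j)" and ?m = "Dini_modulus U0 (\<lambda>j. deriv_norm (s j))"
  have conf: "conformal_self_map X U0 (s j)" and inj: "inj_on (s j) X"
    and bdd: "bdd_above (?d j ` U0)" and Inf_pos: "0 < (INF x\<in>U0. ?d j x)" and R_less: "?R j < 1" for j
    using \<open>infinite_conformal_IFS X U0 s\<close> by (auto simp: infinite_conformal_IFS_def sup_deriv_def)
  obtain r where r: "0 < r" "r < 1" "\<And>j x y. x \<in> X \<Longrightarrow> y \<in> X \<Longrightarrow> dist (s j x) (s j y) \<le> r * dist x y"
    using \<open>infinite_conformal_IFS X U0 s\<close> unfolding infinite_conformal_IFS_def by blast
  have Dini_fin: "(\<integral>\<^sup>+t\<in>{0<..1}. ?m t / ennreal t \<partial>lborel) < \<infinity>" and d_pos: "\<And>j x. x \<in> U0 \<Longrightarrow> 0 < ?d j x"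
    using \<open>infinite_conformal_IFS X U0 s\<close> unfolding infinite_conformal_IFS_def uniformly_Dini_continuous_def by blast+
  have sX: "s j ` X \<subseteq> X" for j using conf by (simp add: conformal_self_map_def)
  have J_X: "J \<subseteq> X" unfolding J_def by (rule limit_set_subset[of s X, OF sX])
  have J_ne: "J \<noteq> {}" using \<open>hausdorff_measure a (closure J) > 0\<close> by (auto simp: hausdorff_measure_empty)
  have d_le_R: "?d j x \<le> ?R j" if "x \<in> U0" for j x
    unfolding sup_deriv_def by (rule cSUP_upper[OF that bdd])
  obtain x0 where x0: "x0 \<in> J" using J_ne by blast
  have R_pos: "0 < ?R j" for j
  proof -
    have "x0 \<in> U0" using x0 J_X \<open>X \<subseteq> U0\<close> by blast
    then show ?thesis using d_pos[of x0 j] d_le_R[of x0 j] by linarith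
  qed
  obtain t where t: "0 \<le> t" "t < a" "summable (\<lambda>j. ?R j powr t)"
    using \<open>theta U0 s < ereal a\<close> unfolding theta_def Inf_less_iff by auto
  have t_pos: "0 < t" by (rule uniform_bound_of_powr_summable(1)[OF R_pos R_less t(1,3)])
  obtain \<rho>0 where \<rho>0: "\<rho>0 < 1" "\<And>j. ?R j \<le> \<rho>0"
    using uniform_bound_of_powr_summable(2)[OF R_pos R_less t(1,3)] by blast
  obtain e where e: "0 < e" "(\<Union>x\<in>X. ball x e) \<subseteq> U0"
    using compact_subset_open_imp_ball_epsilon_subset[OF \<open>compact X\<close> \<open>open U0\<close> \<open>X \<subseteq> U0\<close>] by blast
  define \<rho> where "\<rho> = max (max \<rho>0 r) (max (1 - e / 2) (1 / 2))"
  define \<delta> where "\<delta> = min e (1 / 2)"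
  have \<rho>: "0 < \<rho>" "\<rho> < 1" "\<rho>0 \<le> \<rho>" "r \<le> \<rho>" "1 - e / 2 \<le> \<rho>" "1 / 2 \<le> \<rho>"
  proof -
    show half: "1 / 2 \<le> \<rho>" unfolding \<rho>_def by (intro max.coboundedI2 order_refl)
    then show "0 < \<rho>" by linarith
    show "\<rho>0 \<le> \<rho>" "r \<le> \<rho>" "1 - e / 2 \<le> \<rho>" unfolding \<rho>_def by (simp_all add: le_max_iff_disj)
    show "\<rho> < 1" using r \<rho>0 e unfolding \<rho>_def by simp
  qed
  have \<delta>: "0 < \<delta>" "\<delta> \<le> e" "\<delta> \<le> \<rho>" using e \<rho> by (auto simp: \<delta>_def)
  have ball_U: "ball x \<delta> \<subseteq> U0" if "x \<in> X" for x
    using e(2) subset_ball[OF \<delta>(2)] that by blast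
  (* The ball of radius e around y lies in U0, so moving y away from x by e / 2 stays in U0. *)
  have X_diam: "dist x y \<le> \<rho>" if xy: "x \<in> X" "y \<in> X" for x y
  proof (cases "x = y")
    case False
    define c where "c = e / 2 / norm (y - x)"
    define z where "z = y + c *\<^sub>R (y - x)"
    have c: "0 < c" "c * norm (y - x) = e / 2" using False e by (simp_all add: c_def)
    have "dist y z = e / 2" using c by (simp add: z_def dist_norm)
    then have "z \<in> ball y e" using e(1) by simp
    then have "z \<in> U0" using e(2) xy(2) by blast
    then have "dist x z \<le> 1"
      using diameter_bounded_bound[OF \<open>bounded U0\<close>, of x z] xy \<open>X \<subseteq> U0\<close> \<open>diameter U0 \<le> 1\<close> by auto
    moreover have "x - z = - ((1 + c) *\<^sub>R (y - x))" by (simp add: z_def algebra_simps)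
    then have "dist x z = (1 + c) * norm (y - x)"
      using c(1) by (simp only: dist_norm norm_minus_cancel norm_scaleR abs_of_pos add_pos_pos zero_less_one)
    then have "dist x z = dist x y + e / 2" using c(2) by (simp add: distrib_right dist_norm norm_minus_commute)
    ultimately show ?thesis using \<rho>(5) by linarith
  qed (use \<rho> in simp)
  have m_sum: "(\<Sum>k. ?m (\<rho> ^ Suc k)) < \<infinity>" by (rule Dini_modulus_sum_finite[OF Dini_fin \<rho>(1,2)])
  then have m_fin: "?m (\<rho> ^ Suc k) < \<infinity>" for k
    using sum_le_suminf[of "\<lambda>k. ?m (\<rho> ^ Suc k)" "{k}"] by (auto intro: le_less_trans)
  define \<alpha> where "\<alpha> k = enn2real (?m (\<rho> ^ Suc k))" for k
  have \<alpha>_eq: "ennreal (\<alpha> k) = ?m (\<rho> ^ Suc k)" for k using m_fin[of k] by (simp add: \<alpha>_def del: power_Suc)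
  interpret distortion_system X U0 s ?d \<rho> \<delta> \<alpha>
  proof
    show "s j x \<in> X" if "x \<in> X" for j x using sX that by blast
    show "dist (s j x) (s j y) \<le> \<rho> * dist x y" if "x \<in> X" "y \<in> X" for j x y
      using r(3)[OF that, of j] mult_right_mono[OF \<rho>(4), of "dist x y"] by simp
    show "dist (s j y) (s j z) \<le> c * dist y z"
      if "x \<in> X" "q \<le> \<delta>" "\<And>y. y \<in> ball x q \<Longrightarrow> ?d j y \<le> c" "y \<in> ball x q" "z \<in> ball x q" for x q j c y z
    proof (rule conformal_Lipschitz[OF conf convex_ball _ that(3-5)])
      show "ball x q \<subseteq> U0" using subset_ball[OF that(2)] ball_U[OF that(1)] by (rule order_trans)
    qed
    show "?d j x \<le> \<rho>" if "x \<in> U0" for j x using d_le_R[OF that, of j] \<rho>0(2)[of j] \<rho>(3) by linarith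
    show "0 \<le> \<alpha> k" for k by (simp add: \<alpha>_def)
    have "(\<Sum>k. ennreal (\<alpha> k)) \<noteq> top" using m_sum by (simp add: \<alpha>_eq del: power_Suc)
    then show "summable \<alpha>" by (rule summable_suminf_not_top[rotated]) (simp add: \<alpha>_def)
    show "\<bar>ln (?d j x) - ln (?d j y)\<bar> \<le> \<alpha> k" if "x \<in> U0" "y \<in> U0" "dist x y \<le> \<rho> ^ Suc k" for j x y k
      using Dini_modulus_upper[OF that, of "\<lambda>j. deriv_norm (s j)" j] unfolding \<alpha>_eq[symmetric]
      by (simp add: \<alpha>_def)
  qed (use \<open>compact X\<close> inj ball_U \<delta> \<rho> X_diam d_pos in auto)
  interpret hausdorff_system X U0 s ?d \<rho> \<delta> \<alpha> a J "closure J" "\<lambda>j. ?R j powr t"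
  proof
    show "0 < a" using t by simp
    show "s j x \<in> J" if "x \<in> J" for j x using limit_set_forward[of s X, OF sX] that unfolding J_def by blast
    show "J \<subseteq> (\<Union>j. s j ` J)" unfolding J_def by (rule limit_set_backward[of s X, OF sX inj])
    show "continuous_on X (?d j)" for j
      using continuous_on_subset[OF deriv_norm_continuous[OF conf] \<open>X \<subseteq> U0\<close>] .
    show "?d j x powr a \<le> ?R j powr t" if "x \<in> U0" for x j
    proof -
      have "?d j x powr a \<le> ?R j powr a"
        using d_le_R[OF that] d_pos[OF that, of j] t by (intro powr_mono2) auto
      also have "\<dots> \<le> ?R j powr t" using t R_pos[of j] R_less[of j] by (intro powr_mono') auto
      finally show ?thesis .
    qed
    show "spectral_radius_on (closure J)
        (\<lambda>f. restrict (\<lambda>x. \<Sum>j. of_real (?d j x powr a) * f (s j x)) (closure J)) = 1"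
      using \<open>spectral_radius_on (closure J) (transfer_op (closure J) s a) = 1\<close>
      by (simp only: transfer_op_def[abs_def])
  qed (use J_ne J_X t assms in auto)
  show ?thesis
    unfolding finite_strong_open_set_condition_def
  proof (intro allI impI)
    fix N :: nat
    define \<kappa> where "\<kappa> = Min (insert 1 ((\<lambda>j. INF x\<in>U0. ?d j x) ` {..<N}))"
    have \<kappa>: "0 < \<kappa>" "\<kappa> \<le> 1" unfolding \<kappa>_def using Inf_pos by (auto simp: Min_gr_iff)
    have \<kappa>_le: "\<kappa> \<le> ?d j x" if "j < N" "x \<in> X" for j x
    proof -
      have "\<kappa> \<le> (INF x\<in>U0. ?d j x)" unfolding \<kappa>_def using that by (intro Min_le) auto
      also have "\<dots> \<le> ?d j x"
        using that \<open>X \<subseteq> U0\<close> d_pos by (intro cINF_lower bdd_belowI[of _ 0]) (auto intro: less_imp_le)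
      finally show ?thesis .
    qed
    interpret finite_alphabet X U0 s ?d \<rho> \<delta> \<alpha> a J "closure J" "\<lambda>j. ?R j powr t" N x0 \<kappa>
      by standard (use x0 \<kappa> \<kappa>_le in auto)
    from disjoint_ball_images obtain x \<epsilon> where x: "x \<in> J" "0 < \<epsilon>" "\<epsilon> \<le> \<delta>"
      and disj: "\<forall>i<N. \<forall>j<N. \<forall>w\<in>A. \<forall>v\<in>A. i \<noteq> j \<longrightarrow>
        foldr s (i # w) ` ball x \<epsilon> \<inter> foldr s (j # v) ` ball x \<epsilon> = {}"
      by (elim exE conjE) (rule that; assumption)
    have xX: "x \<in> X" using x J_X by blast
    define V where "V = (\<Union>w\<in>A. foldr s w ` ball x \<epsilon>)"
    have in_U: "foldr s w ` ball x \<epsilon> \<subseteq> U0" for w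
    proof
      fix y assume "y \<in> foldr s w ` ball x \<epsilon>"
      then have "y \<in> ball (foldr s w x) \<delta>"
        using foldr_ball[OF xX] subset_ball[OF x(3)] by blast
      then show "y \<in> U0" using ball_U[OF foldr_in_X[OF xX]] by blast
    qed
    have op: "open (foldr s w ` ball x \<epsilon>)" for w
    proof (induction w)
      case (Cons j w)
      have "open (s j ` foldr s w ` ball x \<epsilon>)"
        by (rule conformal_open_map[OF conf d_pos Cons.IH in_U])
      then show ?case by (simp add: image_comp)
    qed simp
    have "osc_set U0 s N V"
      unfolding osc_set_def
    proof (intro conjI allI impI)
      show "open V" unfolding V_def using op by blast
      show "V \<subseteq> U0" unfolding V_def using in_U by blast
      show "V \<noteq> {}" unfolding V_def using x(2) by (auto intro!: bexI[of _ "[]"])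
      show "s j ` V \<subseteq> V" if "j < N" for j
      proof
        fix y assume "y \<in> s j ` V"
        then obtain z where z: "z \<in> V" "y = s j z" by blast
        then obtain w where w: "w \<in> A" "z \<in> foldr s w ` ball x \<epsilon>" unfolding V_def by blast
        have "y \<in> foldr s (j # w) ` ball x \<epsilon>" using z(2) w(2) by auto
        moreover have "j # w \<in> A" using w(1) that by simp
        ultimately show "y \<in> V" unfolding V_def by (rule UN_I[rotated])
      qed
      show "s i ` V \<inter> s j ` V = {}" if "i < N" "j < N" "i \<noteq> j" for i j
      proof (rule ccontr)
        assume "s i ` V \<inter> s j ` V \<noteq> {}"
        then obtain y z where yz: "y \<in> V" "z \<in> V" "s i y = s j z" by blast
        then obtain w v where w: "w \<in> A" "y \<in> foldr s w ` ball x \<epsilon>" and v: "v \<in> A" "z \<in> foldr s v ` ball x \<epsilon>"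
          unfolding V_def by blast
        have "s i y \<in> foldr s (i # w) ` ball x \<epsilon>" using w(2) by auto
        moreover have "s i y \<in> foldr s (j # v) ` ball x \<epsilon>" unfolding yz(3) using v(2) by auto
        ultimately show False using disj[rule_format, OF that(1,2) w(1) v(1) that(3)] by blast
      qed
    qed
    moreover have "x \<in> V" unfolding V_def using x(2) by (auto intro!: bexI[of _ "[]"])
    ultimately show "\<exists>V. osc_set U0 s N V \<and> V \<inter> limit_set X s \<noteq> {}" using x(1) unfolding J_def by blast
  qed
qed

end
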